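(* Let $G$ be a profinite group with the embedding property, and $S(G)$ its complete system. Then $\mathrm{Th}(S(G))$ weakly eliminates imaginaries. Furthermore, every imaginary of $S(G)$ is equi-definable with an imaginary of the form $([\alpha],\epsilon)$, where $\alpha\in S(G)$ and $\epsilon$ is an imaginary of the group $[\alpha]$.
   Context: A profinite group $G$ has the embedding property if for all finite groups $A,B$ and continuous epimorphisms $f:G\to A$, $g:B\to A$, $f':G\to B$, there is an epimorphism $h:G\to B$ with $f=g\circ h$. The complete system $S(G)$ is the $\omega$-sorted structure in the language $\mathcal L_G=\{\le,C,P,1\}$ with universe the disjoint union of the quotients $G/N$ ($N$ open normal), $gN$ of sort $n$ iff $[G:N]\le n$, $gN\le hM$ iff $N\subseteq M$, $C(gN,hM)$ iff $gN\subseteq hM$, $P(g_1N_1,g_2N_2,g_3N_3)$ iff $N_1=N_2=N_3$ and $g_1g_2N_1=g_3N_1$, $1=G/G$; model theory is in $\omega$-sorted logic. For $\alpha\in S(G)$, $[\alpha]$ is its class for the equivalence relation $\alpha\sim\beta\iff(\alpha\le\beta\wedge\beta\le\alpha)$; $[\alpha]$ is the finite quotient group $G/N$ containing $\alpha$, with group law given by $P$, and is itself an imaginary (finite definable set); an imaginary of the group $[\alpha]$ is an element of the $eq$-expansion of this finite group. A theory weakly eliminates imaginaries if for every imaginary $e$ there is a real tuple $c$ with $e\in\mathrm{dcl}^{eq}(c)$ and $c\in\mathrm{acl}^{eq}(e)$. *)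

theory Defs
  imports "HOL-Analysis.Analysis" "HOL-Algebra.Coset"
begin

section \<open>Sorted first-order logic\<close>

text \<open>
  Languages with constants \<open>'c\<close>, relation symbols \<open>'r\<close> and sorts \<open>'s\<close>.  The sorts of a structure
  are arbitrary subsets of \<open>'u\<close> and may overlap; the universe of a structure is by definition
  the union of its sorts, and every quantifier is restricted to a sort.  With \<open>'s = nat\<close> this
  is \<open>\<omega>\<close>-sorted logic: a model has no element outside the sorts.  Arities are not
  part of the language; a relation is interpreted on finite lists.
\<close>

datatype 'c trm = Var nat | Cst 'c

datatype ('s, 'c, 'r) fm =
    Eq "'c trm" "'c trm"
  | Rel 'r "'c trm list"
  | Neg "('s, 'c, 'r) fm"
  | Conj "('s, 'c, 'r) fm" "('s, 'c, 'r) fm"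
  | Exs 's nat "('s, 'c, 'r) fm"

fun fv_trm :: "'c trm \<Rightarrow> nat set" where
  "fv_trm (Var x) = {x}"
| "fv_trm (Cst c) = {}"

fun fv :: "('s, 'c, 'r) fm \<Rightarrow> nat set" where
  "fv (Eq t u) = fv_trm t \<union> fv_trm u"
| "fv (Rel r ts) = (\<Union>t\<in>set ts. fv_trm t)"
| "fv (Neg \<phi>) = fv \<phi>"
| "fv (Conj \<phi> \<psi>) = fv \<phi> \<union> fv \<psi>"
| "fv (Exs s x \<phi>) = fv \<phi> - {x}"

record ('s, 'c, 'r, 'u) struct =
  sort_dom :: "'s \<Rightarrow> 'u set"
  const_int :: "'c \<Rightarrow> 'u"
  rel_int :: "'r \<Rightarrow> 'u list \<Rightarrow> bool"

definition universe :: "('s, 'c, 'r, 'u) struct \<Rightarrow> 'u set" where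
  "universe M = (\<Union>s. sort_dom M s)"

definition is_structure :: "('s, 'c, 'r, 'u) struct \<Rightarrow> bool" where
  "is_structure M \<longleftrightarrow> (\<forall>c. const_int M c \<in> universe M)"

fun trm_val :: "('s, 'c, 'r, 'u) struct \<Rightarrow> (nat \<Rightarrow> 'u) \<Rightarrow> 'c trm \<Rightarrow> 'u" where
  "trm_val M v (Var x) = v x"
| "trm_val M v (Cst c) = const_int M c"

fun sat :: "('s, 'c, 'r, 'u) struct \<Rightarrow> (nat \<Rightarrow> 'u) \<Rightarrow> ('s, 'c, 'r) fm \<Rightarrow> bool" where
  "sat M v (Eq t u) \<longleftrightarrow> trm_val M v t = trm_val M v u"
| "sat M v (Rel r ts) \<longleftrightarrow> rel_int M r (map (trm_val M v) ts)"
| "sat M v (Neg \<phi>) \<longleftrightarrow> \<not> sat M v \<phi>"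
| "sat M v (Conj \<phi> \<psi>) \<longleftrightarrow> sat M v \<phi> \<and> sat M v \<psi>"
| "sat M v (Exs s x \<phi>) \<longleftrightarrow> (\<exists>a\<in>sort_dom M s. sat M (v(x := a)) \<phi>)"

definition Th :: "('s, 'c, 'r, 'u) struct \<Rightarrow> ('s, 'c, 'r) fm set" where
  "Th M = {\<phi>. fv \<phi> = {} \<and> (\<forall>v. sat M v \<phi>)}"

definition models :: "('s, 'c, 'r, 'u) struct \<Rightarrow> ('s, 'c, 'r) fm set \<Rightarrow> bool" where
  "models M T \<longleftrightarrow> is_structure M \<and> (\<forall>\<phi>\<in>T. \<forall>v. sat M v \<phi>)"

text \<open>
  A finite tuple \<open>c\<close> is used as the valuation \<open>(!) c\<close>, giving the variable \<open>i\<close> the value \<open>c ! i\<close>;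
  the bound on \<open>fv\<close> makes the values beyond the length of \<open>c\<close> irrelevant.  Below, variable 0 is
  the variable of the defined set and \<open>c\<close> is the tuple of parameters.
\<close>

definition definable_in_sort ::
    "('s, 'c, 'r, 'u) struct \<Rightarrow> 'u set \<Rightarrow> 's \<Rightarrow> 'u set \<Rightarrow> bool" where
  "definable_in_sort M A s X \<longleftrightarrow>
     (\<exists>\<phi> c. set c \<subseteq> A \<and> fv \<phi> \<subseteq> {..length c} \<and> X = {x \<in> sort_dom M s. sat M ((!) (x # c)) \<phi>})"

definition dcl :: "('s, 'c, 'r, 'u) struct \<Rightarrow> 'u set \<Rightarrow> 'u set" where
  "dcl M A = {e. \<exists>s. definable_in_sort M A s {e}}"

definition acl :: "('s, 'c, 'r, 'u) struct \<Rightarrow> 'u set \<Rightarrow> 'u set" where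
  "acl M A = {e. \<exists>s X. definable_in_sort M A s X \<and> finite X \<and> e \<in> X}"

section \<open>The eq-expansion\<close>

definition tuples :: "('s, 'c, 'r, 'u) struct \<Rightarrow> 's list \<Rightarrow> 'u list set" where
  "tuples M ss = {us. list_all2 (\<lambda>u s. u \<in> sort_dom M s) us ss}"

definition fm_rel ::
    "('s, 'c, 'r, 'u) struct \<Rightarrow> 's list \<Rightarrow> ('s, 'c, 'r) fm \<Rightarrow> ('u list \<times> 'u list) set" where
  "fm_rel M ss \<phi> = {(us, vs). us \<in> tuples M ss \<and> vs \<in> tuples M ss \<and> sat M ((!) (us @ vs)) \<phi>}"

definition defines_equiv ::
    "('s, 'c, 'r, 'u) struct \<Rightarrow> 's list \<Rightarrow> ('s, 'c, 'r) fm \<Rightarrow> bool" where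
  "defines_equiv M ss \<phi> \<longleftrightarrow>
     fv \<phi> \<subseteq> {..<2 * length ss} \<and> equiv (tuples M ss) (fm_rel M ss \<phi>)"

text \<open>
  The sorts of the eq-expansion are the sorts of the structure together with one sort \<open>Quot ss \<phi>\<close>
  for every formula \<open>\<phi>\<close> without parameters that defines an equivalence relation on the product of
  the sorts \<open>ss\<close>; the sort is empty if \<open>\<phi>\<close> does not define an equivalence relation.  The new
  relation symbol \<open>Proj ss \<phi>\<close> is the graph of the projection sending a tuple to its class.
\<close>

datatype ('s, 'c, 'r) eq_sort = Home 's | Quot "'s list" "('s, 'c, 'r) fm"

datatype ('s, 'c, 'r) eq_rel = Base 'r | Proj "'s list" "('s, 'c, 'r) fm"

datatype ('s, 'c, 'r, 'u) eq_elem = Real 'u | Imag "'s list" "('s, 'c, 'r) fm" "'u list set"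

fun eq_dom :: "('s, 'c, 'r, 'u) struct \<Rightarrow> ('s, 'c, 'r) eq_sort \<Rightarrow> ('s, 'c, 'r, 'u) eq_elem set" where
  "eq_dom M (Home s) = Real ` sort_dom M s"
| "eq_dom M (Quot ss \<phi>) =
     (if defines_equiv M ss \<phi> then Imag ss \<phi> ` (tuples M ss // fm_rel M ss \<phi>) else {})"

fun eq_rel_int ::
    "('s, 'c, 'r, 'u) struct \<Rightarrow> ('s, 'c, 'r) eq_rel \<Rightarrow> ('s, 'c, 'r, 'u) eq_elem list \<Rightarrow> bool" where
  "eq_rel_int M (Base r) es \<longleftrightarrow> (\<exists>us. es = map Real us \<and> rel_int M r us)"
| "eq_rel_int M (Proj ss \<phi>) es \<longleftrightarrow>
     defines_equiv M ss \<phi> \<and>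
     (\<exists>us\<in>tuples M ss. es = map Real us @ [Imag ss \<phi> (fm_rel M ss \<phi> `` {us})])"

definition eq_expansion ::
    "('s, 'c, 'r, 'u) struct \<Rightarrow>
     (('s, 'c, 'r) eq_sort, 'c, ('s, 'c, 'r) eq_rel, ('s, 'c, 'r, 'u) eq_elem) struct" where
  "eq_expansion M =
     \<lparr>sort_dom = eq_dom M, const_int = (\<lambda>c. Real (const_int M c)), rel_int = eq_rel_int M\<rparr>"

abbreviation imaginaries :: "('s, 'c, 'r, 'u) struct \<Rightarrow> ('s, 'c, 'r, 'u) eq_elem set" where
  "imaginaries M \<equiv> universe (eq_expansion M)"

abbreviation dcl_eq ::
    "('s, 'c, 'r, 'u) struct \<Rightarrow> ('s, 'c, 'r, 'u) eq_elem set \<Rightarrow> ('s, 'c, 'r, 'u) eq_elem set" where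
  "dcl_eq M \<equiv> dcl (eq_expansion M)"

abbreviation acl_eq ::
    "('s, 'c, 'r, 'u) struct \<Rightarrow> ('s, 'c, 'r, 'u) eq_elem set \<Rightarrow> ('s, 'c, 'r, 'u) eq_elem set" where
  "acl_eq M \<equiv> acl (eq_expansion M)"

definition equidefinable ::
    "('s, 'c, 'r, 'u) struct \<Rightarrow> ('s, 'c, 'r, 'u) eq_elem \<Rightarrow> ('s, 'c, 'r, 'u) eq_elem \<Rightarrow> bool" where
  "equidefinable M e f \<longleftrightarrow> e \<in> dcl_eq M {f} \<and> f \<in> dcl_eq M {e}"

text \<open>
  HOL cannot quantify over types inside a formula, so the type \<open>'u\<close> of the models is a parameter;
  a theorem with \<open>'u\<close> a type variable covers all models.
\<close>

definition weakly_eliminates_imaginaries :: "'u itself \<Rightarrow> ('s, 'c, 'r) fm set \<Rightarrow> bool" where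
  "weakly_eliminates_imaginaries (U :: 'u itself) T \<longleftrightarrow>
     (\<forall>M :: ('s, 'c, 'r, 'u) struct. models M T \<longrightarrow>
        (\<forall>e\<in>imaginaries M. \<exists>c. set c \<subseteq> universe M \<and>
           e \<in> dcl_eq M (Real ` set c) \<and> Real ` set c \<subseteq> acl_eq M {e}))"

section \<open>Profinite groups\<close>

text \<open>A profinite group is a compact, Hausdorff, totally disconnected topological group.\<close>

locale profinite_group = group G for G :: "('a, 'm) monoid_scheme" (structure) +
  fixes T :: "'a topology"
  assumes topspace_eq: "topspace T = carrier G"
    and continuous_mult: "continuous_map (prod_topology T T) T (\<lambda>(x, y). x \<otimes> y)"
    and continuous_inv: "continuous_map T T (\<lambda>x. inv x)"
    and compact: "compact_space T"
    and Hausdorff: "Hausdorff_space T"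
    and totally_disconnected: "\<And>S. connectedin T S \<Longrightarrow> \<exists>a. S \<subseteq> {a}"

definition continuous_epi ::
    "('a, 'm) monoid_scheme \<Rightarrow> 'a topology \<Rightarrow> ('b, 'n) monoid_scheme \<Rightarrow> ('a \<Rightarrow> 'b) set" where
  "continuous_epi G T A =
     {f \<in> epi G A. continuous_map T (discrete_topology (carrier A)) f}"

text \<open>
  Every finite group has an isomorphic copy with elements in \<open>nat\<close>.  Finite groups are discrete,
  so only the epimorphisms defined on \<open>G\<close> carry a continuity condition.
\<close>

definition embedding_property :: "('a, 'm) monoid_scheme \<Rightarrow> 'a topology \<Rightarrow> bool" where
  "embedding_property G T \<longleftrightarrow>
     (\<forall>(A :: nat monoid) (B :: nat monoid) f g f'.
        group A \<and> finite (carrier A) \<and> group B \<and> finite (carrier B) \<and>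
        f \<in> continuous_epi G T A \<and> g \<in> epi B A \<and> f' \<in> continuous_epi G T B \<longrightarrow>
        (\<exists>h\<in>continuous_epi G T B. \<forall>x\<in>carrier G. f x = g (h x)))"

section \<open>The complete system of a profinite group\<close>

datatype cs_const = C_one

datatype cs_rel = R_le | R_C | R_P

definition open_normal :: "('a, 'm) monoid_scheme \<Rightarrow> 'a topology \<Rightarrow> 'a set set" where
  "open_normal G T = {N. N \<lhd> G \<and> openin T N}"

text \<open>The coset \<open>gN\<close>, as an element of the disjoint union of all \<open>G/N\<close>, is the pair \<open>(N, gN)\<close>.\<close>

definition cs_univ :: "('a, 'm) monoid_scheme \<Rightarrow> 'a topology \<Rightarrow> ('a set \<times> 'a set) set" where
  "cs_univ G T = (SIGMA N:open_normal G T. carrier (G Mod N))"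

fun cs_rel_int ::
    "('a, 'm) monoid_scheme \<Rightarrow> cs_rel \<Rightarrow> ('a set \<times> 'a set) list \<Rightarrow> bool" where
  "cs_rel_int G R_le [(N, X), (M, Y)] \<longleftrightarrow> N \<subseteq> M"
| "cs_rel_int G R_C [(N, X), (M, Y)] \<longleftrightarrow> X \<subseteq> Y"
| "cs_rel_int G R_P [(N1, X1), (N2, X2), (N3, X3)] \<longleftrightarrow>
     N1 = N2 \<and> N2 = N3 \<and> X1 \<otimes>\<^bsub>G Mod N1\<^esub> X2 = X3"
| "cs_rel_int G _ _ \<longleftrightarrow> False"

definition complete_system ::
    "('a, 'm) monoid_scheme \<Rightarrow> 'a topology \<Rightarrow> (nat, cs_const, cs_rel, 'a set \<times> 'a set) struct" where
  "complete_system G T =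
     \<lparr>sort_dom = (\<lambda>n. {(N, X) \<in> cs_univ G T. finite (carrier (G Mod N)) \<and> card (carrier (G Mod N)) \<le> n}),
      const_int = (\<lambda>_. (carrier G, carrier G)),
      rel_int = (\<lambda>r us. set us \<subseteq> cs_univ G T \<and> cs_rel_int G r us)\<rparr>"

section \<open>The groups \<open>[\<alpha>]\<close> and their imaginaries\<close>

definition sim_class :: "(nat, cs_const, cs_rel, 'u) struct \<Rightarrow> 'u \<Rightarrow> 'u set" where
  "sim_class S \<alpha> = {\<beta> \<in> universe S. rel_int S R_le [\<alpha>, \<beta>] \<and> rel_int S R_le [\<beta>, \<alpha>]}"

text \<open>The identity is the unique idempotent of the multiplication given by \<open>R_P\<close>.\<close>

definition class_group :: "(nat, cs_const, cs_rel, 'u) struct \<Rightarrow> 'u \<Rightarrow> 'u monoid" where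
  "class_group S \<alpha> =
     \<lparr>carrier = sim_class S \<alpha>,
      mult = (\<lambda>\<beta> \<gamma>. THE \<delta>. \<delta> \<in> sim_class S \<alpha> \<and> rel_int S R_P [\<beta>, \<gamma>, \<delta>]),
      one = (THE \<beta>. \<beta> \<in> sim_class S \<alpha> \<and> rel_int S R_P [\<beta>, \<beta>, \<beta>])\<rparr>"

datatype grp_const = G_one

datatype grp_rel = G_mult

text \<open>A group as a one-sorted structure: the identity and the graph of the multiplication.\<close>

definition group_struct ::
    "('a, 'm) monoid_scheme \<Rightarrow> (unit, grp_const, grp_rel, 'a) struct" where
  "group_struct H =
     \<lparr>sort_dom = (\<lambda>_. carrier H),
      const_int = (\<lambda>_. \<one>\<^bsub>H\<^esub>),
      rel_int = (\<lambda>_ us. \<exists>x\<in>carrier H. \<exists>y\<in>carrier H. us = [x, y, x \<otimes>\<^bsub>H\<^esub> y])\<rparr>"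

text \<open>
  The set of tuples an imaginary stands for.  An element of the home sort is identified with its
  class modulo equality.
\<close>

fun imag_tuples :: "('s, 'c, 'r, 'u) eq_elem \<Rightarrow> 'u list set" where
  "imag_tuples (Real a) = {[a]}"
| "imag_tuples (Imag ss \<phi> X) = X"

text \<open>
  For an imaginary \<open>\<epsilon>\<close> of the group \<open>[\<alpha>]\<close>, the pair \<open>([\<alpha>], \<epsilon>)\<close> has as components the
  \<open>\<sim>\<close>-class \<open>[\<alpha>]\<close> and the class of tuples \<open>\<epsilon>\<close>.  As an element of the eq-expansion of \<open>S\<close> it is
  the class consisting of the tuples \<open>\<beta> # b\<close> with \<open>\<beta> \<in> [\<alpha>]\<close> and \<open>b \<in> \<epsilon>\<close>.  This set of
  tuples is a class for more than one equivalence relation definable in \<open>S\<close>; the corresponding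
  imaginaries are equi-definable with each other.
\<close>

definition is_class_pair ::
    "(nat, cs_const, cs_rel, 'u) struct \<Rightarrow> 'u \<Rightarrow> (unit, grp_const, grp_rel, 'u) eq_elem \<Rightarrow>
     (nat, cs_const, cs_rel, 'u) eq_elem \<Rightarrow> bool" where
  "is_class_pair S \<alpha> \<epsilon> p \<longleftrightarrow>
     p \<in> imaginaries S \<and>
     (\<exists>ss \<phi>. p = Imag ss \<phi> {\<beta> # b | \<beta> b. \<beta> \<in> sim_class S \<alpha> \<and> b \<in> imag_tuples \<epsilon>})"

end

theory Submission
  imports Defs "HOL-Algebra.Zassenhaus"
begin

text \<open>
  By the embedding property the isomorphisms between finite quotients of \<open>G\<close> form a back-and-forth
  system on \<open>S(G)\<close>.  There are only finitely many isomorphism types of tuples in given sorts, and each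
  is isolated by a formula; so definability without parameters is the same as invariance under this system.

  Let \<open>e\<close> be the class of a tuple modulo a definable equivalence relation.  Call an open normal
  subgroup \<open>N\<close> a support of \<open>e\<close> if every isomorphism between finite quotients that is the identity
  on \<open>G/N\<close> fixes \<open>e\<close>.  Only finitely many supports have minimal index, and so their intersection \<open>C\<close>
  is a support that is definable from \<open>e\<close>.  An enumeration of \<open>G/C\<close> is therefore algebraic over \<open>e\<close>, and
  \<open>e\<close> is definable from it.  The pair of \<open>G/C\<close> and the set of its enumerations that are conjugate over
  \<open>e\<close> is interdefinable with \<open>e\<close>.

  These are elementary properties of \<open>S(G)\<close> with uniform bounds, and so they pass to all models of its theory.
\<close>

section \<open>Sorted formulas\<close>

text \<open>Two obstacles shape the proof. \<open>S\<close> need not have enough automorphisms to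
  test definability by them; partial isomorphisms, written as subgroups of
  \<open>G \<times> G\<close>, take their place, and the embedding property enters as the
  possibility to shrink such a subgroup until its left kernel lies in a prescribed open normal
  subgroup. Compactness is replaced by counting: on a fixed list of sorts only finitely many
  relations are invariant. This bounds the index of \<open>C\<close> over all classes of one sort,
  because the relations "index at most k" cannot be pairwise distinct for all k. It also leaves
  finitely many candidate formulas for codes, so that the existence of a code is a single sentence.

  Nothing provides a largest support, so no single support is distinguished by the class; this is
  why a whole finite family of them is intersected. The elimination is only weak because different
  enumerations of \<open>G/C\<close> may be conjugate over \<open>e\<close>.\<close>

lemma set_zip_map: "set (zip xs (map f xs)) = (\<lambda>x. (x, f x)) ` set xs"
  by (induction xs) auto

lemma set_zip_converse: "(set (zip xs ys))\<inverse> = set (zip ys xs)"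
  by (auto simp: set_zip)

lemma set_zip_relcomp:
  "length xs = length ys \<Longrightarrow> length ys = length zs \<Longrightarrow> set (zip xs zs) \<subseteq> set (zip xs ys) O set (zip ys zs)"
  by (force simp: set_zip relcomp_unfold)

lemma set_zip_self: "set (zip a a) = Id_on (set a)"
  by (induction a) auto

lemma card_set_le_of_nth_eq:
  assumes "length ys = length xs" "\<And>i j. i < length xs \<Longrightarrow> j < length xs \<Longrightarrow> ys ! i = ys ! j \<Longrightarrow> xs ! i = xs ! j"
  shows "card (set xs) \<le> card (set ys)"
proof -
  have "\<forall>x \<in> set xs. \<exists>i < length xs. xs ! i = x" by (metis in_set_conv_nth)
  then obtain f where f: "\<And>x. x \<in> set xs \<Longrightarrow> f x < length xs \<and> xs ! f x = x" by metis
  have "inj_on (\<lambda>x. ys ! f x) (set xs)"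
    by (rule inj_onI) (metis assms(2) f)
  moreover have "(\<lambda>x. ys ! f x) ` set xs \<subseteq> set ys" using f assms(1) by auto
  ultimately show ?thesis by (meson List.finite_set card_inj_on_le)
qed

lemma sat_cong:
  "(\<And>x. x \<in> fv \<phi> \<Longrightarrow> v x = v' x) \<Longrightarrow> sat M v \<phi> \<longleftrightarrow> sat M v' \<phi>"
proof (induction \<phi> arbitrary: v v')
  case (Eq t u)
  have "trm_val M v t = trm_val M v' t" using Eq by (cases t) auto
  moreover have "trm_val M v u = trm_val M v' u" using Eq by (cases u) auto
  ultimately show ?case by simp
next
  case (Rel r ts)
  have "trm_val M v t = trm_val M v' t" if "t \<in> set ts" for t using Rel that by (cases t) force+
  then have "map (trm_val M v) ts = map (trm_val M v') ts" by simp
  then show ?case by (simp del: map_eq_conv)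
next
  case (Neg \<phi>) then show ?case by (metis fv.simps(3) sat.simps(3))
next
  case (Conj \<phi>1 \<phi>2) then show ?case by (metis UnCI fv.simps(4) sat.simps(4))
next
  case (Exs s x \<phi>)
  have "sat M (v(x := a)) \<phi> \<longleftrightarrow> sat M (v'(x := a)) \<phi>" for a by (rule Exs.IH) (use Exs.prems in auto)
  then show ?case by simp
qed

section \<open>Injective renaming of variables\<close>

fun ren_trm :: "(nat \<Rightarrow> nat) \<Rightarrow> 'c trm \<Rightarrow> 'c trm" where
  "ren_trm \<pi> (Var x) = Var (\<pi> x)"
| "ren_trm \<pi> (Cst c) = Cst c"

text \<open>Bound variables are renamed as well; \<open>\<pi>\<close> has to be injective.\<close>

fun ren :: "(nat \<Rightarrow> nat) \<Rightarrow> ('s, 'c, 'r) fm \<Rightarrow> ('s, 'c, 'r) fm" where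
  "ren \<pi> (Eq t u) = Eq (ren_trm \<pi> t) (ren_trm \<pi> u)"
| "ren \<pi> (Rel r ts) = Rel r (map (ren_trm \<pi>) ts)"
| "ren \<pi> (Neg \<phi>) = Neg (ren \<pi> \<phi>)"
| "ren \<pi> (Conj \<phi> \<psi>) = Conj (ren \<pi> \<phi>) (ren \<pi> \<psi>)"
| "ren \<pi> (Exs s x \<phi>) = Exs s (\<pi> x) (ren \<pi> \<phi>)"

lemma trm_val_ren: "trm_val M v (ren_trm \<pi> t) = trm_val M (v \<circ> \<pi>) t"
  by (cases t) auto

text \<open>Because bound variables move along with the free ones, no capture can occur; injectivity
  makes an update at \<open>\<pi> x\<close> commute with precomposition by
  \<open>\<pi>\<close>.\<close>

lemma sat_ren:
  assumes "inj \<pi>"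
  shows "sat M v (ren \<pi> \<phi>) \<longleftrightarrow> sat M (v \<circ> \<pi>) \<phi>"
proof (induction \<phi> arbitrary: v)
  case (Exs s x \<phi>)
  have "v(\<pi> x := a) \<circ> \<pi> = (v \<circ> \<pi>)(x := a)" for a
    using assms by (auto simp: fun_eq_iff inj_eq)
  then show ?case unfolding ren.simps sat.simps Exs.IH by simp
qed (auto simp: trm_val_ren comp_def)

lemma fv_ren_trm: "fv_trm (ren_trm \<pi> t) = \<pi> ` fv_trm t"
  by (cases t) auto

lemma fv_ren: "inj \<pi> \<Longrightarrow> fv (ren \<pi> \<phi>) = \<pi> ` fv \<phi>"
  by (induction \<phi>) (auto simp: fv_ren_trm image_Un image_UN image_set_diff)

section \<open>Derived connectives and blocks of quantifiers\<close>

definition Imp :: "('s, 'c, 'r) fm \<Rightarrow> ('s, 'c, 'r) fm \<Rightarrow> ('s, 'c, 'r) fm" where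
  "Imp \<phi> \<psi> = Neg (Conj \<phi> (Neg \<psi>))"

text \<open>The syntax has no truth constant. The empty conjunction is the equation of an arbitrary
  constant with itself, which is closed and always true.\<close>

fun conjs :: "('s, 'c, 'r) fm list \<Rightarrow> ('s, 'c, 'r) fm" where
  "conjs [] = Eq (Cst undefined) (Cst undefined)"
| "conjs (\<phi> # \<phi>s) = Conj \<phi> (conjs \<phi>s)"

definition disjs :: "('s, 'c, 'r) fm list \<Rightarrow> ('s, 'c, 'r) fm" where
  "disjs \<phi>s = Neg (conjs (map Neg \<phi>s))"

lemma sat_Imp [simp]: "sat M v (Imp \<phi> \<psi>) \<longleftrightarrow> (sat M v \<phi> \<longrightarrow> sat M v \<psi>)"
  and fv_Imp [simp]: "fv (Imp \<phi> \<psi>) = fv \<phi> \<union> fv \<psi>"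
  by (auto simp: Imp_def)

lemma sat_conjs [simp]: "sat M v (conjs \<phi>s) \<longleftrightarrow> (\<forall>\<phi> \<in> set \<phi>s. sat M v \<phi>)"
  and fv_conjs [simp]: "fv (conjs \<phi>s) = (\<Union>\<phi> \<in> set \<phi>s. fv \<phi>)"
  by (induction \<phi>s) auto

lemma sat_disjs [simp]: "sat M v (disjs \<phi>s) \<longleftrightarrow> (\<exists>\<phi> \<in> set \<phi>s. sat M v \<phi>)"
  and fv_disjs [simp]: "fv (disjs \<phi>s) = (\<Union>\<phi> \<in> set \<phi>s. fv \<phi>)"
  by (auto simp: disjs_def)

fun exl :: "nat \<Rightarrow> 's list \<Rightarrow> ('s, 'c, 'r) fm \<Rightarrow> ('s, 'c, 'r) fm" where
  "exl k [] \<phi> = \<phi>"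
| "exl k (s # ss) \<phi> = Exs s k (exl (Suc k) ss \<phi>)"

definition alls :: "nat \<Rightarrow> 's list \<Rightarrow> ('s, 'c, 'r) fm \<Rightarrow> ('s, 'c, 'r) fm" where
  "alls k ss \<phi> = Neg (exl k ss (Neg \<phi>))"

definition upd :: "(nat \<Rightarrow> 'u) \<Rightarrow> nat \<Rightarrow> 'u list \<Rightarrow> nat \<Rightarrow> 'u" where
  "upd v k us = (\<lambda>i. if k \<le> i \<and> i < k + length us then us ! (i - k) else v i)"

lemma tuples_Nil [simp]: "us \<in> tuples M [] \<longleftrightarrow> us = []"
  and tuples_Cons: "us \<in> tuples M (s # ss) \<longleftrightarrow> (\<exists>a vs. us = a # vs \<and> a \<in> sort_dom M s \<and> vs \<in> tuples M ss)"
  by (auto simp: tuples_def list_all2_Cons2)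

lemma bex_tuples_Cons: "(\<exists>us \<in> tuples M (s # ss). P us) \<longleftrightarrow> (\<exists>a \<in> sort_dom M s. \<exists>us \<in> tuples M ss. P (a # us))"
  by (auto simp: tuples_Cons) blast+

lemma tuples_length: "us \<in> tuples M ss \<Longrightarrow> length us = length ss"
  by (simp add: tuples_def list_all2_lengthD)

lemma tuples_append: "us \<in> tuples M (ss @ ts) \<longleftrightarrow> (\<exists>as bs. us = as @ bs \<and> as \<in> tuples M ss \<and> bs \<in> tuples M ts)"
  by (auto simp: tuples_def list_all2_append2 intro: list_all2_appendI) (metis list_all2_lengthD)

lemma tuples_nth: "us \<in> tuples M ss \<Longrightarrow> i < length ss \<Longrightarrow> us ! i \<in> sort_dom M (ss ! i)"
  by (simp add: tuples_def list_all2_conv_all_nth)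

lemma tuples_replicate: "us \<in> tuples M (replicate n s) \<longleftrightarrow> length us = n \<and> set us \<subseteq> sort_dom M s"
  by (auto simp: tuples_def list_all2_conv_all_nth in_set_conv_nth subset_iff)

lemma sat_exl: "sat M v (exl k ss \<phi>) \<longleftrightarrow> (\<exists>us \<in> tuples M ss. sat M (upd v k us) \<phi>)"
proof (induction ss arbitrary: k v)
  case Nil
  have "upd v k [] = v" by (auto simp: upd_def fun_eq_iff)
  then show ?case by simp
next
  case (Cons s ss)
  have "upd (v(k := a)) (Suc k) us = upd v k (a # us)" for a us
    by (auto simp: upd_def fun_eq_iff nth_Cons' Suc_le_eq)
  then show ?case unfolding exl.simps sat.simps Cons.IH bex_tuples_Cons by simp
qed

lemma fv_exl: "fv (exl k ss \<phi>) = fv \<phi> - {k..<k + length ss}"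
  by (induction ss arbitrary: k) auto

lemma sat_alls: "sat M v (alls k ss \<phi>) \<longleftrightarrow> (\<forall>us \<in> tuples M ss. sat M (upd v k us) \<phi>)"
  and fv_alls: "fv (alls k ss \<phi>) = fv \<phi> - {k..<k + length ss}"
  by (auto simp: alls_def sat_exl fv_exl)

lemma sat_upd_append:
  assumes "fv \<phi> \<subseteq> {..<length as + length bs}"
  shows "sat M (upd ((!) as) (length as) bs) \<phi> \<longleftrightarrow> sat M ((!) (as @ bs)) \<phi>"
  by (rule sat_cong) (use assms in \<open>auto simp: upd_def nth_append\<close>)

lemma sat_ren_nth:
  assumes "inj \<pi>" "fv \<phi> \<subseteq> {..<length us}" "\<And>i. i < length us \<Longrightarrow> v (\<pi> i) = us ! i"
  shows "sat M v (ren \<pi> \<phi>) \<longleftrightarrow> sat M ((!) us) \<phi>"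
  unfolding sat_ren[OF assms(1)] by (rule sat_cong) (use assms in auto)

section \<open>Boolean combinations of finitely many formulas\<close>

definition diag :: "('s, 'c, 'r) fm list \<Rightarrow> ('s, 'c, 'r) fm set \<Rightarrow> ('s, 'c, 'r) fm" where
  "diag \<phi>s p = conjs (map (\<lambda>\<phi>. if \<phi> \<in> p then \<phi> else Neg \<phi>) \<phi>s)"

lemma sat_diag: "sat M v (diag \<phi>s p) \<longleftrightarrow> (\<forall>\<phi> \<in> set \<phi>s. sat M v \<phi> \<longleftrightarrow> \<phi> \<in> p)"
  and fv_diag: "fv (diag \<phi>s p) = (\<Union>\<phi> \<in> set \<phi>s. fv \<phi>)"
  unfolding diag_def by (induction \<phi>s) auto

text \<open>A predicate that respects agreement on \<open>L\<close> is a union of truth patterns on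
  \<open>L\<close>, hence a disjunction of diagrams. One finite \<open>\<Phi>\<close> serves all
  \<open>D\<close> and \<open>Q\<close>; this uniformity is the source of every later bound.\<close>

lemma boolean_combinations:
  fixes M :: "('s, 'c, 'r, 'u) struct"
  assumes "finite L" "\<And>\<phi>. \<phi> \<in> L \<Longrightarrow> fv \<phi> \<subseteq> V"
  shows "\<exists>\<Phi>. finite \<Phi> \<and> (\<forall>\<psi> \<in> \<Phi>. fv \<psi> \<subseteq> V) \<and>
    (\<forall>D Q. (\<forall>v \<in> D. \<forall>v' \<in> D. Q v \<longrightarrow> (\<forall>\<phi> \<in> L. sat M v \<phi> \<longleftrightarrow> sat M v' \<phi>) \<longrightarrow> Q v') \<longrightarrow>
       (\<exists>\<psi> \<in> \<Phi>. \<forall>v \<in> D. sat M v \<psi> \<longleftrightarrow> Q v))"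
proof -
  obtain Ls where Ls: "set Ls = L" using finite_list[OF assms(1)] by blast
  \<comment> \<open>There are only finitely many lists without repetition over the finite set
    \<open>Pow L\<close>.\<close>
  define \<Phi> where "\<Phi> = (\<lambda>ps. disjs (map (diag Ls) ps)) ` {ps. set ps \<subseteq> Pow L \<and> distinct ps}"
  have sat_tp: "sat M v (diag Ls p) \<longleftrightarrow> {\<phi> \<in> L. sat M v \<phi>} = p" if "p \<subseteq> L" for v p
    unfolding sat_diag Ls using that by blast
  have fin: "finite \<Phi>" unfolding \<Phi>_def using assms(1) by (intro finite_imageI finite_subset_distinct) simp
  have fvs: "fv \<psi> \<subseteq> V" if \<psi>: "\<psi> \<in> \<Phi>" for \<psi>
  proof -
    obtain ps where "\<psi> = disjs (map (diag Ls) ps)" using \<psi> unfolding \<Phi>_def by blast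
    then have "fv \<psi> = (\<Union>p \<in> set ps. \<Union>\<phi> \<in> L. fv \<phi>)" by (simp add: fv_diag Ls)
    then have "fv \<psi> \<subseteq> (\<Union>\<phi> \<in> L. fv \<phi>)" by blast
    then show ?thesis using assms(2) by (meson UN_least order_trans)
  qed
  have ex: "\<exists>\<psi> \<in> \<Phi>. \<forall>v \<in> D. sat M v \<psi> \<longleftrightarrow> Q v"
    if *: "\<forall>v \<in> D. \<forall>v' \<in> D. Q v \<longrightarrow> (\<forall>\<phi> \<in> L. sat M v \<phi> \<longleftrightarrow> sat M v' \<phi>) \<longrightarrow> Q v'" for D Q
  proof -
    \<comment> \<open>The patterns realized by a point of \<open>D\<close> satisfying
      \<open>Q\<close>; the assumption on \<open>Q\<close> says that no other point of
      \<open>D\<close> shares one of them.\<close>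
    define \<P> where "\<P> = {{\<phi> \<in> L. sat M v \<phi>} | v. v \<in> D \<and> Q v}"
    have "\<P> \<subseteq> Pow L" by (auto simp: \<P>_def)
    then have "finite \<P>" using assms(1) by (meson finite_Pow_iff finite_subset)
    then obtain ps where ps: "set ps = \<P>" "distinct ps" using finite_distinct_list by blast
    have "sat M v (disjs (map (diag Ls) ps)) \<longleftrightarrow> Q v" if v: "v \<in> D" for v
    proof
      assume "sat M v (disjs (map (diag Ls) ps))"
      then obtain p where "p \<in> \<P>" "sat M v (diag Ls p)" using ps by auto
      then have "{\<phi> \<in> L. sat M v \<phi>} = p" using sat_tp \<open>\<P> \<subseteq> Pow L\<close> by blast
      then obtain v' where v': "v' \<in> D" "Q v'" "{\<phi> \<in> L. sat M v \<phi>} = {\<phi> \<in> L. sat M v' \<phi>}"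
        using \<open>p \<in> \<P>\<close> by (auto simp: \<P>_def)
      have "\<forall>\<phi> \<in> L. sat M v' \<phi> \<longleftrightarrow> sat M v \<phi>" using v'(3) by blast
      then show "Q v" using * v v'(1,2) by blast
    next
      assume "Q v"
      then have "{\<phi> \<in> L. sat M v \<phi>} \<in> \<P>" using v by (auto simp: \<P>_def)
      then show "sat M v (disjs (map (diag Ls) ps))" using ps sat_tp[of "{\<phi> \<in> L. sat M v \<phi>}" v] by auto
    qed
    moreover have "disjs (map (diag Ls) ps) \<in> \<Phi>" using ps \<open>\<P> \<subseteq> Pow L\<close> by (auto simp: \<Phi>_def)
    ultimately show ?thesis by blast
  qed
  show ?thesis by (intro exI[of _ \<Phi>] conjI ballI allI impI) (rule fin, erule fvs, erule ex)
qed

section \<open>Formulas in the eq-expansion\<close>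

fun tr :: "('s, 'c, 'r) fm \<Rightarrow> (('s, 'c, 'r) eq_sort, 'c, ('s, 'c, 'r) eq_rel) fm" where
  "tr (Eq t u) = Eq t u"
| "tr (Rel r ts) = Rel (Base r) ts"
| "tr (Neg \<phi>) = Neg (tr \<phi>)"
| "tr (Conj \<phi> \<psi>) = Conj (tr \<phi>) (tr \<psi>)"
| "tr (Exs s x \<phi>) = Exs (Home s) x (tr \<phi>)"

lemma eq_expansion_simps [simp]:
  "sort_dom (eq_expansion M) = eq_dom M"
  "const_int (eq_expansion M) = (\<lambda>c. Real (const_int M c))"
  "rel_int (eq_expansion M) = eq_rel_int M"
  by (auto simp: eq_expansion_def)

lemma map_Real_eq_iff [simp]: "map Real us = map Real vs \<longleftrightarrow> us = vs"
  by (rule inj_map_eq_map) (simp add: inj_def)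

lemma fv_tr [simp]: "fv (tr \<phi>) = fv \<phi>"
  by (induction \<phi>) auto

lemma sat_tr:
  assumes "\<And>x. x \<in> fv \<phi> \<Longrightarrow> w x = Real (v x)"
  shows "sat (eq_expansion M) w (tr \<phi>) \<longleftrightarrow> sat M v \<phi>"
  using assms
proof (induction \<phi> arbitrary: w v)
  case (Eq t u)
  have "trm_val (eq_expansion M) w t = Real (trm_val M v t)" using Eq by (cases t) auto
  moreover have "trm_val (eq_expansion M) w u = Real (trm_val M v u)" using Eq by (cases u) auto
  ultimately show ?case by simp
next
  case (Rel r ts)
  have "trm_val (eq_expansion M) w t = Real (trm_val M v t)" if "t \<in> set ts" for t
    using Rel that by (cases t) force+
  then have eq: "map (trm_val (eq_expansion M) w) ts = map Real (map (trm_val M v) ts)" by simp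
  show ?case unfolding sat.simps tr.simps eq_expansion_simps eq_rel_int.simps eq map_Real_eq_iff by auto
next
  case (Neg \<phi>) then show ?case by (metis fv.simps(3) sat.simps(3) tr.simps(3))
next
  case (Conj \<phi>1 \<phi>2) then show ?case by (metis UnCI fv.simps(4) sat.simps(4) tr.simps(4))
next
  case (Exs s x \<phi>)
  have "sat (eq_expansion M) (w(x := Real a)) (tr \<phi>) \<longleftrightarrow> sat M (v(x := a)) \<phi>" for a
    by (rule Exs.IH) (use Exs.prems in auto)
  then show ?case by auto
qed

lemma tuples_Home: "us \<in> tuples (eq_expansion M) (map Home ss) \<longleftrightarrow> (\<exists>vs \<in> tuples M ss. us = map Real vs)"
proof (induction ss arbitrary: us)
  case (Cons s ss)
  show ?case
  proof
    assume "us \<in> tuples (eq_expansion M) (map Home (s # ss))"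
    then obtain a vs where "us = Real a # map Real vs" "a \<in> sort_dom M s" "vs \<in> tuples M ss"
      using Cons by (auto simp: tuples_Cons)
    then show "\<exists>vs \<in> tuples M (s # ss). us = map Real vs" by (intro bexI[of _ "a # vs"]) (auto simp: tuples_Cons)
  qed (use Cons in \<open>force simp: tuples_Cons\<close>)
qed simp

lemma sat_exl_Home:
  "sat (eq_expansion M) w (exl k (map Home ss) \<theta>) \<longleftrightarrow>
     (\<exists>us \<in> tuples M ss. sat (eq_expansion M) (upd w k (map Real us)) \<theta>)"
  by (auto simp: sat_exl tuples_Home)

lemma bex_tuples_append:
  "(\<exists>us \<in> tuples M (ss @ ts). P us) \<longleftrightarrow> (\<exists>us \<in> tuples M ss. \<exists>vs \<in> tuples M ts. P (us @ vs))"
  by (unfold Bex_def tuples_append) blast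

lemma imaginaries_eq: "imaginaries M = (\<Union>\<sigma>. eq_dom M \<sigma>)"
  by (simp only: universe_def eq_expansion_simps)

text \<open>A home sort is handled as the quotient of its 1-tuples by equality. This lets
  \<open>cls\<close>, \<open>eqf\<close> and \<open>proj_fm\<close> treat real and imaginary
  elements alike.\<close>

fun arity :: "('s, 'c, 'r) eq_sort \<Rightarrow> 's list" where
  "arity (Home s) = [s]"
| "arity (Quot ss \<phi>) = ss"

fun cls :: "('s, 'c, 'r, 'u) struct \<Rightarrow> ('s, 'c, 'r) eq_sort \<Rightarrow> 'u list \<Rightarrow> ('s, 'c, 'r, 'u) eq_elem" where
  "cls M (Home s) us = Real (hd us)"
| "cls M (Quot ss \<phi>) us = Imag ss \<phi> (fm_rel M ss \<phi> `` {us})"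

fun eqf :: "('s, 'c, 'r) eq_sort \<Rightarrow> ('s, 'c, 'r) fm" where
  "eqf (Home s) = Eq (Var 0) (Var 1)"
| "eqf (Quot ss \<phi>) = \<phi>"

fun proj_fm :: "('s, 'c, 'r) eq_sort \<Rightarrow> nat \<Rightarrow> nat \<Rightarrow> (('s, 'c, 'r) eq_sort, 'c, ('s, 'c, 'r) eq_rel) fm" where
  "proj_fm (Home s) k x = Eq (Var k) (Var x)"
| "proj_fm (Quot ss \<phi>) k x = Rel (Proj ss \<phi>) (map Var [k..<k + length ss] @ [Var x])"

fun wf_sort :: "('s, 'c, 'r, 'u) struct \<Rightarrow> ('s, 'c, 'r) eq_sort \<Rightarrow> bool" where
  "wf_sort M (Home s) \<longleftrightarrow> True"
| "wf_sort M (Quot ss \<phi>) \<longleftrightarrow> defines_equiv M ss \<phi>"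

lemma fv_proj_fm [simp]: "fv (proj_fm \<sigma> k x) = {k..<k + length (arity \<sigma>)} \<union> {x}"
  by (cases \<sigma>) auto

lemma eq_dom_cls: "e \<in> eq_dom M \<sigma> \<longleftrightarrow> wf_sort M \<sigma> \<and> (\<exists>us \<in> tuples M (arity \<sigma>). e = cls M \<sigma> us)"
  by (cases \<sigma>) (auto simp: bex_tuples_Cons quotient_def)

lemma sat_eqf:
  assumes "wf_sort M \<sigma>" "us \<in> tuples M (arity \<sigma>)" "vs \<in> tuples M (arity \<sigma>)"
  shows "sat M ((!) (us @ vs)) (eqf \<sigma>) \<longleftrightarrow> cls M \<sigma> us = cls M \<sigma> vs"
proof (cases \<sigma>)
  case (Home s)
  then show ?thesis using assms by (auto simp: tuples_Cons)
next
  case (Quot ss \<phi>)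
  then have "equiv (tuples M ss) (fm_rel M ss \<phi>)" using assms by (simp add: defines_equiv_def)
  from eq_equiv_class_iff[OF this, of us vs] show ?thesis using assms Quot by (simp add: fm_rel_def)
qed

lemma fv_eqf: "wf_sort M \<sigma> \<Longrightarrow> fv (eqf \<sigma>) \<subseteq> {..<2 * length (arity \<sigma>)}"
  by (cases \<sigma>) (auto simp: defines_equiv_def)

lemma sat_proj_fm:
  assumes "wf_sort M \<sigma>" "us \<in> tuples M (arity \<sigma>)" "\<And>i. i < length us \<Longrightarrow> w (k + i) = Real (us ! i)"
  shows "sat (eq_expansion M) w (proj_fm \<sigma> k x) \<longleftrightarrow> w x = cls M \<sigma> us"
proof (cases \<sigma>)
  case (Home s)
  then show ?thesis using assms(2) assms(3)[of 0] by (auto simp: tuples_Cons)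
next
  case (Quot ss \<phi>)
  have "map w [k..<k + length ss] = map Real us"
    using assms tuples_length[OF assms(2)] Quot by (intro nth_equalityI) auto
  then have "sat (eq_expansion M) w (proj_fm \<sigma> k x) \<longleftrightarrow> (\<exists>us' \<in> tuples M ss. us = us' \<and> w x = Imag ss \<phi> (fm_rel M ss \<phi> `` {us'}))"
    using assms(1) Quot by (auto simp: comp_def)
  then show ?thesis using assms(2) Quot by auto
qed

section \<open>Criteria for definability and algebraicity in the eq-expansion\<close>

lemma inj_add_2: "inj ((+) (2::nat))"
  by (simp add: inj_def)

lemma dcl_eq_realI:
  assumes e: "e \<in> eq_dom M \<sigma>" and fv: "fv \<psi> \<subseteq> {..<length (arity \<sigma>) + length c}"
    and ex: "\<exists>us \<in> tuples M (arity \<sigma>). cls M \<sigma> us = e \<and> sat M ((!) (us @ c)) \<psi>"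
    and un: "\<And>us. us \<in> tuples M (arity \<sigma>) \<Longrightarrow> sat M ((!) (us @ c)) \<psi> \<Longrightarrow> cls M \<sigma> us = e"
  shows "e \<in> dcl_eq M (Real ` set c)"
proof -
  let ?l = "length (arity \<sigma>)" and ?n = "length c"
  \<comment> \<open>In \<open>\<psi>\<close> the representative comes first and the parameters
    second. In \<open>definable_in_sort\<close> variable 0 is the defined element and the parameters
    follow at once, so the representative moves behind them, where it is quantified away. The last
    branch keeps \<open>\<pi>\<close> injective.\<close>
  define \<pi> where "\<pi> i = (if i < ?l then Suc ?n + i else if i < ?l + ?n then Suc (i - ?l) else Suc i)" for i
  have \<pi>: "inj \<pi>" by (auto simp: inj_def \<pi>_def split: if_splits)
  define \<theta> where "\<theta> = exl (Suc ?n) (map Home (arity \<sigma>)) (Conj (proj_fm \<sigma> (Suc ?n) 0) (ren \<pi> (tr \<psi>)))"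
  have "\<pi> ` fv \<psi> \<subseteq> {..<Suc ?n + ?l}" using fv by (force simp: \<pi>_def)
  then have fv\<theta>: "fv \<theta> \<subseteq> {..length (map Real c)}"
    by (auto simp: \<theta>_def fv_exl fv_ren[OF \<pi>])
  have wf: "wf_sort M \<sigma>" using e by (simp add: eq_dom_cls)
  have "sat (eq_expansion M) ((!) (x # map Real c)) \<theta> \<longleftrightarrow> x = e" for x
  proof -
    have "sat (eq_expansion M) (upd ((!) (x # map Real c)) (Suc ?n) (map Real us)) (Conj (proj_fm \<sigma> (Suc ?n) 0) (ren \<pi> (tr \<psi>)))
        \<longleftrightarrow> x = cls M \<sigma> us \<and> sat M ((!) (us @ c)) \<psi>" if us: "us \<in> tuples M (arity \<sigma>)" for us
    proof -
      let ?w = "upd ((!) (x # map Real c)) (Suc ?n) (map Real us)"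
      have l: "length us = ?l" using tuples_length[OF us] .
      have "sat (eq_expansion M) ?w (proj_fm \<sigma> (Suc ?n) 0) \<longleftrightarrow> ?w 0 = cls M \<sigma> us"
        by (rule sat_proj_fm[OF wf us]) (simp add: upd_def)
      moreover have "sat (eq_expansion M) ?w (ren \<pi> (tr \<psi>)) \<longleftrightarrow> sat M ((!) (us @ c)) \<psi>"
        unfolding sat_ren[OF \<pi>]
        by (rule sat_tr) (use fv l in \<open>auto simp: upd_def \<pi>_def nth_append\<close>)
      ultimately show ?thesis by (simp add: upd_def)
    qed
    then show ?thesis unfolding \<theta>_def sat_exl_Home using ex un by metis
  qed
  then have "definable_in_sort (eq_expansion M) (Real ` set c) \<sigma> {e}"
    unfolding definable_in_sort_def using fv\<theta> e by (intro exI[of _ \<theta>] exI[of _ "map Real c"]) auto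
  then show ?thesis by (auto simp: dcl_def)
qed

text \<open>The common pattern of \<open>dcl_eq_imagI\<close> and \<open>acl_eq_realI\<close>.
  Variable 0 is the defined element, variable 1 the imaginary parameter, and the block from 2 on
  holds a representative of the parameter followed by a real tuple.\<close>

lemma definable_from_class:
  assumes e: "e \<in> eq_dom M \<sigma>" and fv: "fv \<psi> \<subseteq> {..<length (arity \<sigma>) + length ts}" "fv \<zeta> \<subseteq> {..<2 + length (arity \<sigma>) + length ts} - {1}"
    and \<zeta>: "\<And>x us c. us \<in> tuples M (arity \<sigma>) \<Longrightarrow> c \<in> tuples M ts \<Longrightarrow>
      sat (eq_expansion M) (upd ((!) [x, e]) 2 (map Real (us @ c))) \<zeta> \<longleftrightarrow> Z x us c"
  shows "definable_in_sort (eq_expansion M) {e} \<tau> {x \<in> eq_dom M \<tau>. \<exists>us \<in> tuples M (arity \<sigma>). \<exists>c \<in> tuples M ts.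
    cls M \<sigma> us = e \<and> sat M ((!) (us @ c)) \<psi> \<and> Z x us c}"
proof -
  let ?l = "length (arity \<sigma>)"
  define \<eta> where "\<eta> = Conj (proj_fm \<sigma> 2 1) (Conj (ren ((+) 2) (tr \<psi>)) \<zeta>)"
  define \<theta> where "\<theta> = exl 2 (map Home (arity \<sigma> @ ts)) \<eta>"
  have fv\<theta>: "fv \<theta> \<subseteq> {..length [e]}"
    using fv by (auto simp: \<theta>_def \<eta>_def fv_exl fv_ren)
  have wf: "wf_sort M \<sigma>" using e by (simp add: eq_dom_cls)
  have "sat (eq_expansion M) (upd ((!) [x, e]) 2 (map Real (us @ c))) \<eta>
      \<longleftrightarrow> cls M \<sigma> us = e \<and> sat M ((!) (us @ c)) \<psi> \<and> Z x us c"
    if us: "us \<in> tuples M (arity \<sigma>)" and c: "c \<in> tuples M ts" for us c x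
  proof -
    let ?w = "upd ((!) [x, e]) 2 (map Real (us @ c))"
    have l: "length us = ?l" "length c = length ts" using tuples_length us c by blast+
    have "sat (eq_expansion M) ?w (proj_fm \<sigma> 2 1) \<longleftrightarrow> ?w 1 = cls M \<sigma> us"
      by (rule sat_proj_fm[OF wf us]) (simp add: upd_def nth_append)
    moreover have "sat (eq_expansion M) ?w (ren ((+) 2) (tr \<psi>)) \<longleftrightarrow> sat M ((!) (us @ c)) \<psi>"
      unfolding sat_ren[OF inj_add_2]
      by (rule sat_tr) (use fv l in \<open>auto simp: upd_def nth_append\<close>)
    ultimately show ?thesis using \<zeta>[OF us c] by (auto simp: \<eta>_def upd_def)
  qed
  then have "sat (eq_expansion M) ((!) [x, e]) \<theta> \<longleftrightarrow> (\<exists>us \<in> tuples M (arity \<sigma>). \<exists>c \<in> tuples M ts.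
      cls M \<sigma> us = e \<and> sat M ((!) (us @ c)) \<psi> \<and> Z x us c)" for x
    unfolding \<theta>_def sat_exl_Home bex_tuples_append by simp
  then show ?thesis
    unfolding definable_in_sort_def using fv\<theta> by (intro exI[of _ \<theta>] exI[of _ "[e]"]) auto
qed

lemma dcl_eq_imagI:
  assumes e: "e \<in> eq_dom M \<sigma>" and p: "p \<in> eq_dom M \<tau>"
    and fv: "fv \<psi> \<subseteq> {..<length (arity \<tau>) + length (arity \<sigma>)}"
    and ex: "us \<in> tuples M (arity \<sigma>)" "vs \<in> tuples M (arity \<tau>)" "cls M \<sigma> us = e" "cls M \<tau> vs = p" "sat M ((!) (vs @ us)) \<psi>"
    and un: "\<And>us vs. us \<in> tuples M (arity \<sigma>) \<Longrightarrow> vs \<in> tuples M (arity \<tau>) \<Longrightarrow> cls M \<tau> vs = p \<Longrightarrow>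
      sat M ((!) (vs @ us)) \<psi> \<Longrightarrow> cls M \<sigma> us = e"
  shows "e \<in> dcl_eq M {p}"
proof -
  have wf: "wf_sort M \<sigma>" using e by (simp add: eq_dom_cls)
  have "definable_in_sort (eq_expansion M) {p} \<sigma> {x \<in> eq_dom M \<sigma>. \<exists>vs \<in> tuples M (arity \<tau>). \<exists>us \<in> tuples M (arity \<sigma>).
      cls M \<tau> vs = p \<and> sat M ((!) (vs @ us)) \<psi> \<and> x = cls M \<sigma> us}"
  proof (rule definable_from_class[OF p fv, where \<zeta> = "proj_fm \<sigma> (2 + length (arity \<tau>)) 0"])
    fix x us vs assume us: "us \<in> tuples M (arity \<sigma>)" and vs: "vs \<in> tuples M (arity \<tau>)"
    let ?w = "upd ((!) [x, p]) 2 (map Real (vs @ us))"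
    have "sat (eq_expansion M) ?w (proj_fm \<sigma> (2 + length (arity \<tau>)) 0) \<longleftrightarrow> ?w 0 = cls M \<sigma> us"
      by (rule sat_proj_fm[OF wf us]) (use tuples_length[OF vs] in \<open>simp add: upd_def nth_append\<close>)
    then show "sat (eq_expansion M) ?w (proj_fm \<sigma> (2 + length (arity \<tau>)) 0) \<longleftrightarrow> x = cls M \<sigma> us" by (simp add: upd_def)
  qed auto
  also have "{x \<in> eq_dom M \<sigma>. \<exists>vs \<in> tuples M (arity \<tau>). \<exists>us \<in> tuples M (arity \<sigma>).
      cls M \<tau> vs = p \<and> sat M ((!) (vs @ us)) \<psi> \<and> x = cls M \<sigma> us} = {e}"
    using ex un e by blast
  finally show ?thesis by (auto simp: dcl_def)
qed

text \<open>Algebraicity is checked one coordinate at a time: the \<open>j\<close>-th entries of all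
  tuples related by \<open>\<psi>\<close> to some representative of \<open>e\<close> form a set that
  is definable over \<open>e\<close> and contained in the image of \<open>F\<close>.\<close>

lemma acl_eq_realI:
  fixes M :: "('s, 'c, 'r, 'u) struct"
  assumes e: "e \<in> eq_dom M \<sigma>" and fv: "fv \<psi> \<subseteq> {..<length (arity \<sigma>) + length ts}"
    and fin: "finite F" "\<And>us c. us \<in> tuples M (arity \<sigma>) \<Longrightarrow> c \<in> tuples M ts \<Longrightarrow> cls M \<sigma> us = e \<Longrightarrow> sat M ((!) (us @ c)) \<psi> \<Longrightarrow> set c \<subseteq> F"
    and ex: "us \<in> tuples M (arity \<sigma>)" "c \<in> tuples M ts" "cls M \<sigma> us = e" "sat M ((!) (us @ c)) \<psi>"
  shows "Real ` set c \<subseteq> acl_eq M {e}"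
proof
  fix y :: "('s, 'c, 'r, 'u) eq_elem" assume "y \<in> Real ` set c"
  then obtain j where j: "j < length ts" "y = Real (c ! j)"
    using tuples_length[OF ex(2)] by (auto simp: in_set_conv_nth)
  define X where "X = {x \<in> eq_dom M (Home (ts ! j)). \<exists>us \<in> tuples M (arity \<sigma>). \<exists>c \<in> tuples M ts.
      cls M \<sigma> us = e \<and> sat M ((!) (us @ c)) \<psi> \<and> x = Real (c ! j)}"
  have "definable_in_sort (eq_expansion M) {e} (Home (ts ! j)) X"
    unfolding X_def
    by (rule definable_from_class[OF e fv, where \<zeta> = "Eq (Var 0) (Var (2 + length (arity \<sigma>) + j))"])
      (use j in \<open>auto simp: upd_def nth_append dest!: tuples_length\<close>)
  moreover have "X \<subseteq> Real ` F"
  proof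
    fix x assume "x \<in> X"
    then obtain us c where "us \<in> tuples M (arity \<sigma>)" "c \<in> tuples M ts" "cls M \<sigma> us = e" "x = Real (c ! j)" "sat M ((!) (us @ c)) \<psi>"
      unfolding X_def by auto
    moreover from this have "c ! j \<in> F" using fin(2)[of us c] j tuples_length[of c M ts] nth_mem[of j c] by auto
    ultimately show "x \<in> Real ` F" by simp
  qed
  then have "finite X" using fin(1) finite_subset by blast
  moreover have "y \<in> X"
    unfolding X_def using ex j tuples_nth[OF ex(2), of j] by auto
  ultimately show "y \<in> acl_eq M {e}" unfolding acl_def by blast
qed

section \<open>Transfer between models of a complete theory\<close>

definition tsat :: "('s, 'c, 'r, 'u) struct \<Rightarrow> 's list \<Rightarrow> ('s, 'c, 'r) fm \<Rightarrow> bool" where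
  "tsat M ss \<phi> \<longleftrightarrow> (\<forall>us \<in> tuples M ss. sat M ((!) us) \<phi>)"

lemma sat_upd_0:
  "us \<in> tuples M ss \<Longrightarrow> fv \<phi> \<subseteq> {..<length ss} \<Longrightarrow> sat M (upd v 0 us) \<phi> \<longleftrightarrow> sat M ((!) us) \<phi>"
  by (rule sat_cong) (auto simp: upd_def dest!: tuples_length)

text \<open>\<open>Th S\<close> is complete: the universal closure is a sentence whose truth value
  does not depend on the valuation, so it or its negation belongs to \<open>Th S\<close>.\<close>

lemma tsat_transfer:
  assumes "models M (Th S)" "fv \<phi> \<subseteq> {..<length ss}"
  shows "tsat M ss \<phi> \<longleftrightarrow> tsat S ss \<phi>"
proof -
  define \<theta> where "\<theta> = alls 0 ss \<phi>"
  have fv: "fv \<theta> = {}" "fv (Neg \<theta>) = {}" using assms(2) by (auto simp: \<theta>_def fv_alls)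
  have S: "sat S v \<theta> \<longleftrightarrow> tsat S ss \<phi>" for v unfolding \<theta>_def sat_alls tsat_def by (intro ball_cong refl sat_upd_0[OF _ assms(2)])
  have M: "sat M v \<theta> \<longleftrightarrow> tsat M ss \<phi>" for v unfolding \<theta>_def sat_alls tsat_def by (intro ball_cong refl sat_upd_0[OF _ assms(2)])
  have "\<theta> \<in> Th S \<or> Neg \<theta> \<in> Th S" using fv S by (auto simp: Th_def)
  moreover have "\<theta> \<in> Th S \<Longrightarrow> tsat S ss \<phi>" "Neg \<theta> \<in> Th S \<Longrightarrow> \<not> tsat S ss \<phi>" using S by (auto simp: Th_def)
  moreover have "\<theta> \<in> Th S \<Longrightarrow> tsat M ss \<phi>" "Neg \<theta> \<in> Th S \<Longrightarrow> \<not> tsat M ss \<phi>"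
    using M assms(1) by (fastforce simp: models_def)+
  ultimately show ?thesis by blast
qed

lemma sat_append_prefix:
  "fv \<phi> \<subseteq> {..<length as} \<Longrightarrow> sat M ((!) (as @ bs)) \<phi> \<longleftrightarrow> sat M ((!) as) \<phi>"
  by (rule sat_cong) (auto simp: nth_append)

lemma ball_tuples_append:
  "(\<forall>us \<in> tuples M (ss @ ts). P us) \<longleftrightarrow> (\<forall>us \<in> tuples M ss. \<forall>vs \<in> tuples M ts. P (us @ vs))"
  by (unfold Ball_def tuples_append) blast

lemma tsat_append: "tsat M (ss @ ts) \<phi> \<longleftrightarrow> (\<forall>us \<in> tuples M ss. \<forall>vs \<in> tuples M ts. sat M ((!) (us @ vs)) \<phi>)"
  by (auto simp: tsat_def tuples_append)

section \<open>Transfer of definable equivalence relations\<close>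

lemma equiv_Collect_iff:
  "equiv T {(x, y). x \<in> T \<and> y \<in> T \<and> P x y} \<longleftrightarrow>
     (\<forall>x \<in> T. P x x) \<and> (\<forall>x \<in> T. \<forall>y \<in> T. P x y \<longrightarrow> P y x) \<and>
     (\<forall>x \<in> T. \<forall>y \<in> T. \<forall>z \<in> T. P x y \<and> P y z \<longrightarrow> P x z)" (is "?L \<longleftrightarrow> ?R")
proof
  assume ?L
  then have r: "refl_on T {(x, y). x \<in> T \<and> y \<in> T \<and> P x y}" and s: "sym {(x, y). x \<in> T \<and> y \<in> T \<and> P x y}"
    and t: "trans {(x, y). x \<in> T \<and> y \<in> T \<and> P x y}" by (simp_all add: equiv_def)
  show ?R
  proof (intro conjI ballI impI)
    fix x assume "x \<in> T"
    then show "P x x" using refl_onD[OF r, of x] by simp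
  next
    fix x y assume "x \<in> T" "y \<in> T" "P x y"
    then show "P y x" using symD[OF s, of x y] by simp
  next
    fix x y z assume "x \<in> T" "y \<in> T" "z \<in> T" "P x y \<and> P y z"
    then show "P x z" using transD[OF t, of x y z] by simp
  qed
next
  assume R: ?R
  show ?L
  proof (intro equivI)
    show "{(x, y). x \<in> T \<and> y \<in> T \<and> P x y} \<subseteq> T \<times> T" by auto
    show "refl_on T {(x, y). x \<in> T \<and> y \<in> T \<and> P x y}" using R by (intro refl_onI) simp
    show "sym {(x, y). x \<in> T \<and> y \<in> T \<and> P x y}" using R by (intro symI) simp
    show "trans {(x, y). x \<in> T \<and> y \<in> T \<and> P x y}"
    proof (rule transI)
      fix x y z assume "(x, y) \<in> {(x, y). x \<in> T \<and> y \<in> T \<and> P x y}" "(y, z) \<in> {(x, y). x \<in> T \<and> y \<in> T \<and> P x y}"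
      then have "x \<in> T" "y \<in> T" "z \<in> T" "P x y \<and> P y z" by simp_all
      then show "(x, z) \<in> {(x, y). x \<in> T \<and> y \<in> T \<and> P x y}"
        using conjunct2[OF conjunct2[OF R], THEN bspec, of x, THEN bspec, of y, THEN bspec, of z] by simp
    qed
  qed
qed

text \<open>To be read on three consecutive blocks x, y, z of length \<open>l\<close>. Reflexivity
  is phrased as an implication from x = y so that all conditions share these blocks; the renamings
  produce \<open>\<phi>\<close> at (y, x), (y, z) and (x, z).\<close>

definition equiv_fm :: "nat \<Rightarrow> ('s, 'c, 'r) fm \<Rightarrow> ('s, 'c, 'r) fm" where
  "equiv_fm l \<phi> =
     Conj (Imp (conjs (map (\<lambda>i. Eq (Var i) (Var (l + i))) [0..<l])) \<phi>)
    (Conj (Imp \<phi> (ren (\<lambda>i. if i < l then l + i else if i < 2 * l then i - l else i) \<phi>))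
          (Imp (Conj \<phi> (ren ((+) l) \<phi>)) (ren (\<lambda>i. if i < l then i else l + i) \<phi>)))"

lemma defines_equiv_iff:
  assumes "fv \<phi> \<subseteq> {..<2 * length ss}"
  shows "defines_equiv M ss \<phi> \<longleftrightarrow> tsat M (ss @ ss @ ss) (equiv_fm (length ss) \<phi>)"
proof -
  define P where "P x y \<longleftrightarrow> sat M ((!) (x @ y)) \<phi>" for x y
  let ?T = "tuples M ss" and ?l = "length ss"
  have sat: "sat M ((!) (x @ y @ z)) (equiv_fm ?l \<phi>) \<longleftrightarrow>
      (x = y \<longrightarrow> P x y) \<and> (P x y \<longrightarrow> P y x) \<and> (P x y \<and> P y z \<longrightarrow> P x z)"
    if "x \<in> ?T" "y \<in> ?T" "z \<in> ?T" for x y z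
  proof -
    note l = that[THEN tuples_length]
    have 1: "sat M ((!) (x @ y @ z)) \<phi> \<longleftrightarrow> P x y"
      using sat_append_prefix[of \<phi> "x @ y" M z] assms l by (simp add: P_def mult_2)
    have 2: "sat M ((!) (x @ y @ z)) (ren (\<lambda>i. if i < ?l then ?l + i else if i < 2 * ?l then i - ?l else i) \<phi>) \<longleftrightarrow> P y x"
      unfolding P_def by (rule sat_ren_nth) (use assms l in \<open>auto simp: inj_def nth_append split: if_splits\<close>)
    have 3: "sat M ((!) (x @ y @ z)) (ren ((+) ?l) \<phi>) \<longleftrightarrow> P y z"
      unfolding P_def by (rule sat_ren_nth) (use assms l in \<open>auto simp: inj_def nth_append split: if_splits\<close>)
    have 4: "sat M ((!) (x @ y @ z)) (ren (\<lambda>i. if i < ?l then i else ?l + i) \<phi>) \<longleftrightarrow> P x z"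
      unfolding P_def by (rule sat_ren_nth) (use assms l in \<open>auto simp: inj_def nth_append split: if_splits\<close>)
    have 5: "sat M ((!) (x @ y @ z)) (conjs (map (\<lambda>i. Eq (Var i) (Var (?l + i))) [0..<?l])) \<longleftrightarrow> x = y"
    proof -
      have "x = y \<longleftrightarrow> (\<forall>i \<in> {0..<?l}. x ! i = y ! i)" using l list_eq_iff_nth_eq[of x y] by (simp add: Ball_def)
      then show ?thesis using l by (simp add: nth_append)
    qed
    show ?thesis unfolding equiv_fm_def sat.simps sat_Imp 1 2 3 4 5 ..
  qed
  have "equiv ?T (fm_rel M ss \<phi>) \<longleftrightarrow>
      (\<forall>x \<in> ?T. P x x) \<and> (\<forall>x \<in> ?T. \<forall>y \<in> ?T. P x y \<longrightarrow> P y x) \<and> (\<forall>x \<in> ?T. \<forall>y \<in> ?T. \<forall>z \<in> ?T. P x y \<and> P y z \<longrightarrow> P x z)"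
    using equiv_Collect_iff[of ?T P] by (simp add: fm_rel_def P_def)
  also have "\<dots> \<longleftrightarrow> tsat M (ss @ ss @ ss) (equiv_fm ?l \<phi>)"
  proof -
    have "tsat M (ss @ ss @ ss) (equiv_fm ?l \<phi>) \<longleftrightarrow>
      (\<forall>x \<in> ?T. \<forall>y \<in> ?T. \<forall>z \<in> ?T. (x = y \<longrightarrow> P x y) \<and> (P x y \<longrightarrow> P y x) \<and> (P x y \<and> P y z \<longrightarrow> P x z))"
      unfolding tsat_append ball_tuples_append by (simp add: sat)
    then show ?thesis by blast
  qed
  finally show ?thesis using assms by (simp add: defines_equiv_def)
qed

lemma defines_equiv_transfer:
  assumes "models M (Th S)"
  shows "defines_equiv M ss \<phi> \<longleftrightarrow> defines_equiv S ss \<phi>"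
proof (cases "fv \<phi> \<subseteq> {..<2 * length ss}")
  case True
  have "fv (equiv_fm (length ss) \<phi>) \<subseteq> {..<length (ss @ ss @ ss)}"
  proof -
    have *: "inj (\<lambda>i. if i < l then l + i else if i < 2 * l then i - l else i)" "inj (\<lambda>i. if i < l then i else l + i)" "inj ((+) l)" for l :: nat
      by (auto simp: inj_def split: if_splits)
    show ?thesis using True by (force simp: equiv_fm_def fv_ren[OF *(1)] fv_ren[OF *(2)] fv_ren[OF *(3)] subset_iff)
  qed
  from tsat_transfer[OF assms this] show ?thesis using defines_equiv_iff[OF True] by metis
qed (simp add: defines_equiv_def)

lemma wf_sort_transfer: "models M (Th S) \<Longrightarrow> wf_sort M \<sigma> \<longleftrightarrow> wf_sort S \<sigma>"
  by (cases \<sigma>) (auto simp: defines_equiv_transfer)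

text \<open>The formula \<open>\<psi>(a, c)\<close> says that \<open>c\<close> is one of finitely many codes of the class of \<open>a\<close>.  To make the
  finiteness elementary, the entries of all codes are required to occur in one tuple \<open>d\<close>.\<close>

definition codes :: "('s, 'c, 'r, 'u) struct \<Rightarrow> ('s, 'c, 'r) eq_sort \<Rightarrow> 's list \<Rightarrow> ('s, 'c, 'r) fm \<Rightarrow> bool" where
  "codes M \<sigma> ts \<psi> \<longleftrightarrow>
     (\<forall>a \<in> tuples M (arity \<sigma>). \<forall>c \<in> tuples M ts. \<forall>a' \<in> tuples M (arity \<sigma>). sat M ((!) (a @ c)) \<psi> \<longrightarrow>
        (sat M ((!) (a' @ c)) \<psi> \<longleftrightarrow> sat M ((!) (a @ a')) (eqf \<sigma>))) \<and>
     (\<forall>a \<in> tuples M (arity \<sigma>). \<exists>d \<in> tuples M ts. \<forall>c \<in> tuples M ts. sat M ((!) (a @ c)) \<psi> \<longrightarrow> set c \<subseteq> set d)"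

text \<open>The blocks are a, c, a' in this order. \<open>\<psi>'\<close> is \<open>\<psi>\<close>
  at (a', c), and \<open>\<epsilon>\<close> is the equivalence of a and a'. The values of the
  renamings beyond these blocks keep them injective.\<close>

definition codes_fm1 :: "('s, 'c, 'r) eq_sort \<Rightarrow> nat \<Rightarrow> ('s, 'c, 'r) fm \<Rightarrow> ('s, 'c, 'r) fm" where
  "codes_fm1 \<sigma> n \<psi> =
     (let l = length (arity \<sigma>); \<psi>' = ren (\<lambda>i. if i < l then i + l + n else if i < l + n then i else i + l) \<psi>;
          \<epsilon> = ren (\<lambda>i. if i < l then i else i + n) (eqf \<sigma>)
      in Imp \<psi> (Conj (Imp \<psi>' \<epsilon>) (Imp \<epsilon> \<psi>')))"

text \<open>The blocks are a, d, c. The inclusion of the entries of c among those of d can be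
  spelled out as a finite formula because both have length \<open>n\<close>.\<close>

definition codes_fm2 :: "('s, 'c, 'r) eq_sort \<Rightarrow> 's list \<Rightarrow> ('s, 'c, 'r) fm \<Rightarrow> ('s, 'c, 'r) fm" where
  "codes_fm2 \<sigma> ts \<psi> =
     (let l = length (arity \<sigma>); n = length ts
      in exl l ts (alls (l + n) ts (Imp (ren (\<lambda>i. if i < l then i else i + n) \<psi>)
           (conjs (map (\<lambda>i. disjs (map (\<lambda>j. Eq (Var (l + n + i)) (Var (l + j))) [0..<n])) [0..<n])))))"

lemma inj_codes:
  "inj (\<lambda>i. if i < l then i + l + n else if i < l + n then i else i + l :: nat)"
  "inj (\<lambda>i. if i < l then i else i + n :: nat)"
  by (auto simp: inj_def split: if_splits)

lemma codes_iff:
  assumes \<sigma>: "wf_sort M \<sigma>" and \<psi>: "fv \<psi> \<subseteq> {..<length (arity \<sigma>) + length ts}"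
  shows "codes M \<sigma> ts \<psi> \<longleftrightarrow> tsat M (arity \<sigma> @ ts @ arity \<sigma>) (codes_fm1 \<sigma> (length ts) \<psi>) \<and> tsat M (arity \<sigma>) (codes_fm2 \<sigma> ts \<psi>)"
proof -
  let ?l = "length (arity \<sigma>)" and ?n = "length ts"
  note fvE = fv_eqf[OF \<sigma>]
  have 1: "sat M ((!) (a @ c @ a')) (codes_fm1 \<sigma> ?n \<psi>) \<longleftrightarrow>
      (sat M ((!) (a @ c)) \<psi> \<longrightarrow> (sat M ((!) (a' @ c)) \<psi> \<longleftrightarrow> sat M ((!) (a @ a')) (eqf \<sigma>)))"
    if "a \<in> tuples M (arity \<sigma>)" "c \<in> tuples M ts" "a' \<in> tuples M (arity \<sigma>)" for a c a'
  proof -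
    note l = that[THEN tuples_length]
    have a: "sat M ((!) (a @ c @ a')) \<psi> \<longleftrightarrow> sat M ((!) (a @ c)) \<psi>"
      using sat_append_prefix[of \<psi> "a @ c" M a'] \<psi> l by simp
    have b: "sat M ((!) (a @ c @ a')) (ren (\<lambda>i. if i < ?l then i + ?l + ?n else if i < ?l + ?n then i else i + ?l) \<psi>) \<longleftrightarrow>
        sat M ((!) (a' @ c)) \<psi>"
      by (rule sat_ren_nth[OF inj_codes(1)]) (use \<psi> l in \<open>auto simp: nth_append\<close>)
    have c: "sat M ((!) (a @ c @ a')) (ren (\<lambda>i. if i < ?l then i else i + ?n) (eqf \<sigma>)) \<longleftrightarrow> sat M ((!) (a @ a')) (eqf \<sigma>)"
      by (rule sat_ren_nth[OF inj_codes(2)]) (use fvE l in \<open>auto simp: nth_append mult_2\<close>)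
    show ?thesis unfolding codes_fm1_def Let_def sat_Imp sat.simps a b c by blast
  qed
  have 2: "sat M ((!) a) (codes_fm2 \<sigma> ts \<psi>) \<longleftrightarrow>
      (\<exists>d \<in> tuples M ts. \<forall>c \<in> tuples M ts. sat M ((!) (a @ c)) \<psi> \<longrightarrow> set c \<subseteq> set d)"
    if a: "a \<in> tuples M (arity \<sigma>)" for a
  proof -
    have "sat M (upd (upd ((!) a) ?l d) (?l + ?n) c) (Imp (ren (\<lambda>i. if i < ?l then i else i + ?n) \<psi>)
           (conjs (map (\<lambda>i. disjs (map (\<lambda>j. Eq (Var (?l + ?n + i)) (Var (?l + j))) [0..<?n])) [0..<?n]))) \<longleftrightarrow>
       (sat M ((!) (a @ c)) \<psi> \<longrightarrow> set c \<subseteq> set d)"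
      if d: "d \<in> tuples M ts" and c: "c \<in> tuples M ts" for c d
    proof -
      let ?v = "upd (upd ((!) a) ?l d) (?l + ?n) c"
      have l: "length a = ?l" "length c = ?n" "length d = ?n" using a c d tuples_length by blast+
      have x: "sat M ?v (ren (\<lambda>i. if i < ?l then i else i + ?n) \<psi>) \<longleftrightarrow> sat M ((!) (a @ c)) \<psi>"
        by (rule sat_ren_nth[OF inj_codes(2)]) (use \<psi> l in \<open>auto simp: nth_append upd_def\<close>)
      have "set c \<subseteq> set d \<longleftrightarrow> (\<forall>i < ?n. \<exists>j < ?n. c ! i = d ! j)"
        unfolding subset_eq all_set_conv_all_nth in_set_conv_nth l by (simp add: eq_commute)
      moreover have "?v (?l + ?n + i) = c ! i" "?v (?l + i) = d ! i" if "i < ?n" for i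
        using that l by (auto simp: upd_def)
      ultimately have y: "(\<forall>i \<in> {0..<?n}. \<exists>j \<in> {0..<?n}. ?v (?l + ?n + i) = ?v (?l + j)) \<longleftrightarrow> set c \<subseteq> set d"
        by (simp add: Ball_def Bex_def)
      show ?thesis unfolding sat_Imp x y[symmetric] by (simp add: add.assoc)
    qed
    then show ?thesis unfolding codes_fm2_def Let_def sat_exl sat_alls by simp
  qed
  show ?thesis unfolding codes_def tsat_append ball_tuples_append using 1 2 by (simp add: tsat_def)
qed

lemma codes_transfer:
  assumes M: "models M (Th S)" and \<sigma>: "wf_sort M \<sigma>" and \<psi>: "fv \<psi> \<subseteq> {..<length (arity \<sigma>) + length ts}"
  shows "codes M \<sigma> ts \<psi> \<longleftrightarrow> codes S \<sigma> ts \<psi>"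
proof -
  have \<sigma>S: "wf_sort S \<sigma>" using \<sigma> wf_sort_transfer[OF M] by blast
  note fvE = fv_eqf[OF \<sigma>]
  have 1: "fv (codes_fm1 \<sigma> (length ts) \<psi>) \<subseteq> {..<length (arity \<sigma> @ ts @ arity \<sigma>)}"
    using \<psi> fvE by (fastforce simp: codes_fm1_def Let_def fv_ren[OF inj_codes(1)] fv_ren[OF inj_codes(2)] subset_iff)
  have 2: "fv (codes_fm2 \<sigma> ts \<psi>) \<subseteq> {..<length (arity \<sigma>)}"
    using \<psi> by (fastforce simp: codes_fm2_def Let_def fv_exl fv_alls fv_ren[OF inj_codes(2)] subset_iff)
  show ?thesis
    unfolding codes_iff[OF \<sigma> \<psi>] codes_iff[OF \<sigma>S \<psi>] tsat_transfer[OF M 1] tsat_transfer[OF M 2] ..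
qed

text \<open>The first clause of \<open>codes\<close> lets \<open>c\<close> determine the class. The
  second gives a tuple \<open>d\<close> that contains all codes relative to the representative
  \<open>a\<close>; by the first clause these are the codes relative to any other representative of
  \<open>e\<close>.\<close>

lemma codes_weak_elimination:
  assumes \<psi>: "fv \<psi> \<subseteq> {..<length (arity \<sigma>) + length ts}" and codes: "codes M \<sigma> ts \<psi>"
    and e: "e \<in> eq_dom M \<sigma>" and a: "a \<in> tuples M (arity \<sigma>)" "cls M \<sigma> a = e"
    and c: "c \<in> tuples M ts" "sat M ((!) (a @ c)) \<psi>"
  shows "e \<in> dcl_eq M (Real ` set c)" "Real ` set c \<subseteq> acl_eq M {e}"
proof -
  have \<sigma>: "wf_sort M \<sigma>" using e by (simp add: eq_dom_cls)
  have E: "sat M ((!) (a @ c)) \<psi> \<Longrightarrow> sat M ((!) (a' @ c)) \<psi> \<longleftrightarrow> cls M \<sigma> a = cls M \<sigma> a'"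
    if "a \<in> tuples M (arity \<sigma>)" "c \<in> tuples M ts" "a' \<in> tuples M (arity \<sigma>)" for a c a'
    using codes that sat_eqf[OF \<sigma> that(1,3)] unfolding codes_def by blast
  have l: "length c = length ts" using tuples_length c by blast
  show "e \<in> dcl_eq M (Real ` set c)"
  proof (rule dcl_eq_realI[OF e])
    show "fv \<psi> \<subseteq> {..<length (arity \<sigma>) + length c}" using \<psi> l by simp
    show "\<exists>us \<in> tuples M (arity \<sigma>). cls M \<sigma> us = e \<and> sat M ((!) (us @ c)) \<psi>" using a c by blast
    fix us assume "us \<in> tuples M (arity \<sigma>)" "sat M ((!) (us @ c)) \<psi>"
    then show "cls M \<sigma> us = e" using E[of us c a] a c by simp
  qed
  obtain d where d: "\<And>c. c \<in> tuples M ts \<Longrightarrow> sat M ((!) (a @ c)) \<psi> \<Longrightarrow> set c \<subseteq> set d"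
    using codes a(1) unfolding codes_def by blast
  show "Real ` set c \<subseteq> acl_eq M {e}"
  proof (rule acl_eq_realI[OF e \<psi>, of "set d" a c])
    fix us c' assume *: "us \<in> tuples M (arity \<sigma>)" "c' \<in> tuples M ts" "cls M \<sigma> us = e" "sat M ((!) (us @ c')) \<psi>"
    then show "set c' \<subseteq> set d" using d[OF *(2)] E[OF *(1,2) a(1)] a(2) by simp
  qed (use a c in auto)
qed

lemma tuples_subset_universe: "us \<in> tuples M ss \<Longrightarrow> set us \<subseteq> universe M"
  using tuples_nth tuples_length by (fastforce simp: universe_def in_set_conv_nth)

text \<open>Finiteness of \<open>\<Phi>\<close> turns "every tuple has a code for one of the
  formulas" into a single first-order statement, although the right formula varies with the
  tuple.\<close>

lemma weak_elimination_transfer: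
  fixes S :: "('s, 'c, 'r, 'w) struct" and U :: "'u itself"
  assumes "\<And>\<sigma>. wf_sort S \<sigma> \<Longrightarrow> \<exists>ts \<Phi>. finite \<Phi> \<and> (\<forall>\<psi> \<in> \<Phi>. fv \<psi> \<subseteq> {..<length (arity \<sigma>) + length ts}) \<and>
     (\<forall>a \<in> tuples S (arity \<sigma>). \<exists>\<psi> \<in> \<Phi>. codes S \<sigma> ts \<psi> \<and> (\<exists>c \<in> tuples S ts. sat S ((!) (a @ c)) \<psi>))"
  shows "weakly_eliminates_imaginaries U (Th S)"
  unfolding weakly_eliminates_imaginaries_def
proof (intro allI impI ballI)
  fix M :: "('s, 'c, 'r, 'u) struct" and e
  assume M: "models M (Th S)" and "e \<in> imaginaries M"
  then obtain \<sigma> where e: "e \<in> eq_dom M \<sigma>" by (auto simp: universe_def)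
  then obtain a where \<sigma>: "wf_sort M \<sigma>" and a: "a \<in> tuples M (arity \<sigma>)" "cls M \<sigma> a = e"
    by (auto simp: eq_dom_cls)
  obtain ts \<Phi> where \<Phi>: "finite \<Phi>" "\<And>\<psi>. \<psi> \<in> \<Phi> \<Longrightarrow> fv \<psi> \<subseteq> {..<length (arity \<sigma>) + length ts}"
     and S: "\<forall>a \<in> tuples S (arity \<sigma>). \<exists>\<psi> \<in> \<Phi>. codes S \<sigma> ts \<psi> \<and> (\<exists>c \<in> tuples S ts. sat S ((!) (a @ c)) \<psi>)"
    using assms[of \<sigma>] wf_sort_transfer[OF M] \<sigma> by metis
  have fin: "finite {\<psi> \<in> \<Phi>. codes S \<sigma> ts \<psi>}" using \<Phi>(1) by simp
  \<comment> \<open>Only formulas that code in \<open>S\<close> enter the disjunction. Since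
    \<open>codes\<close> transfers, whichever disjunct holds in \<open>M\<close> codes there as
    well.\<close>
  obtain ps where ps: "set ps = {\<psi> \<in> \<Phi>. codes S \<sigma> ts \<psi>}" using finite_list[OF fin] by blast
  define \<theta> where "\<theta> = disjs (map (exl (length (arity \<sigma>)) ts) ps)"
  have ex: "sat N ((!) a) (exl (length (arity \<sigma>)) ts \<psi>) \<longleftrightarrow> (\<exists>c \<in> tuples N ts. sat N ((!) (a @ c)) \<psi>)"
    if "a \<in> tuples N (arity \<sigma>)" "\<psi> \<in> \<Phi>" for N :: "('s, 'c, 'r, 'w) struct" and a \<psi>
    unfolding sat_exl using sat_upd_append[of \<psi> a _ N] \<Phi>(2)[OF that(2)] tuples_length[OF that(1)] tuples_length[of _ N ts]
    by (intro bex_cong) auto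
  have "tsat S (arity \<sigma>) \<theta>"
    unfolding tsat_def \<theta>_def using S ps ex by fastforce
  moreover have "fv \<theta> \<subseteq> {..<length (arity \<sigma>)}"
    using \<Phi>(2) ps by (fastforce simp: \<theta>_def fv_exl)
  ultimately have "tsat M (arity \<sigma>) \<theta>" using tsat_transfer[OF M] by blast
  then obtain \<psi> where \<psi>: "\<psi> \<in> set ps" "sat M ((!) a) (exl (length (arity \<sigma>)) ts \<psi>)"
    using a unfolding tsat_def \<theta>_def by auto
  then have "\<psi> \<in> \<Phi>" "codes S \<sigma> ts \<psi>" using ps by auto
  have "codes M \<sigma> ts \<psi>" using codes_transfer[OF M \<sigma> \<Phi>(2)[OF \<open>\<psi> \<in> \<Phi>\<close>]] \<open>codes S \<sigma> ts \<psi>\<close> by simp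
  moreover obtain c where c: "c \<in> tuples M ts" "sat M ((!) (a @ c)) \<psi>"
    using \<psi>(2) sat_upd_append[of \<psi> a _ M] \<Phi>(2)[OF \<open>\<psi> \<in> \<Phi>\<close>] tuples_length[OF a(1)] tuples_length[of _ M ts]
    unfolding sat_exl by auto
  ultimately have "e \<in> dcl_eq M (Real ` set c)" "Real ` set c \<subseteq> acl_eq M {e}"
    using codes_weak_elimination[OF \<Phi>(2)[OF \<open>\<psi> \<in> \<Phi>\<close>] _ e a c] by auto
  moreover have "set c \<subseteq> universe M"
    using tuples_subset_universe[OF c(1)] .
  ultimately show "\<exists>c. set c \<subseteq> universe M \<and> e \<in> dcl_eq M (Real ` set c) \<and> Real ` set c \<subseteq> acl_eq M {e}"
    by blast
qed

section \<open>Isomorphisms between finite quotients\<close>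

lemma (in group) mem_rcoset_iff:
  assumes "subgroup H G" "x \<in> carrier G"
  shows "y \<in> H #> x \<longleftrightarrow> y \<in> carrier G \<and> y \<otimes> inv x \<in> H"
  using subgroup.rcos_module[OF assms(1) is_group assms(2)] r_coset_subset_G[OF subgroup.subset[OF assms(1)] assms(2)]
  by auto

context profinite_group
begin

definition levels :: "'a set set" where
  "levels = {N \<in> open_normal G T. finite (rcosets N)}"

text \<open>The graph of an isomorphism between two finite quotients of \<open>G\<close>, pulled back to a subgroup of \<open>G \<times> G\<close>
  that projects onto both factors.  The two kernels are the subgroups by which \<open>G\<close> is divided.\<close>

definition corr :: "('a \<times> 'a) set \<Rightarrow> bool" where
  "corr R \<longleftrightarrow> R \<subseteq> carrier G \<times> carrier G \<and>
     (\<forall>x y x' y'. (x, y) \<in> R \<and> (x', y') \<in> R \<longrightarrow> (x \<otimes> x', y \<otimes> y') \<in> R) \<and>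
     (\<forall>x y. (x, y) \<in> R \<longrightarrow> (inv x, inv y) \<in> R) \<and>
     carrier G \<subseteq> Domain R \<and> carrier G \<subseteq> Range R \<and>
     {x. (x, \<one>) \<in> R} \<in> levels \<and> {y. (\<one>, y) \<in> R} \<in> levels"

section \<open>Open normal subgroups of finite index\<close>

lemma level_normal: "N \<in> levels \<Longrightarrow> N \<lhd> G"
  and level_open: "N \<in> levels \<Longrightarrow> openin T N"
  and level_finite: "N \<in> levels \<Longrightarrow> finite (rcosets N)"
  by (auto simp: levels_def open_normal_def)

lemma level_subgroup: "N \<in> levels \<Longrightarrow> subgroup N G"
  by (simp add: level_normal normal_imp_subgroup)

lemma openin_translate:
  assumes "openin T N" "a \<in> carrier G"
  shows "openin T {x \<in> carrier G. x \<otimes> a \<in> N}"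
proof -
  have "continuous_map T (prod_topology T T) (\<lambda>x. (x, a))"
    using assms topspace_eq by (intro continuous_map_pairedI) auto
  from continuous_map_compose[OF this continuous_mult]
  have "continuous_map T T (\<lambda>x. x \<otimes> a)" by (simp add: o_def)
  from openin_continuous_map_preimage[OF this assms(1)] show ?thesis by (simp add: topspace_eq)
qed

lemma openin_subgroup_supset:
  assumes N: "openin T N" "subgroup N G" and K: "subgroup K G" and "N \<subseteq> K"
  shows "openin T K"
proof (subst openin_subopen, intro ballI)
  fix x assume x: "x \<in> K"
  then have xG: "x \<in> carrier G" using subgroup.subset[OF K] by auto
  let ?V = "{y \<in> carrier G. y \<otimes> inv x \<in> N}"
  have "y \<in> K" if "y \<in> ?V" for y
  proof -
    have "y \<otimes> inv x \<otimes> x \<in> K" using that \<open>N \<subseteq> K\<close> x subgroup.m_closed[OF K] by blast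
    then show ?thesis using that xG by (simp add: m_assoc)
  qed
  moreover have "x \<in> ?V" using xG subgroup.one_closed[OF N(2)] by simp
  ultimately show "\<exists>V. openin T V \<and> x \<in> V \<and> V \<subseteq> K"
    using openin_translate[OF N(1), of "inv x"] xG by (intro exI[of _ ?V]) auto
qed

lemma rcos_mono_eq:
  assumes "subgroup N G" "subgroup K G" "N \<subseteq> K" "x \<in> carrier G" "y \<in> carrier G" "N #> x = N #> y"
  shows "K #> x = K #> y"
proof -
  have "x \<in> N #> y" using assms rcos_self by metis
  then have "x \<in> K #> y" using assms by (auto simp: mem_rcoset_iff)
  then show ?thesis using assms repr_independence by metis
qed

lemma rcosets_map:
  assumes "subgroup N G" "subgroup K G" "N \<subseteq> K"
  obtains f where "\<And>x. x \<in> carrier G \<Longrightarrow> f (N #> x) = K #> x" "rcosets K = f ` (rcosets N)"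
proof -
  define f where "f X = K #> (SOME x. x \<in> carrier G \<and> X = N #> x)" for X
  have f: "f (N #> x) = K #> x" if "x \<in> carrier G" for x
    using someI[of "\<lambda>z. z \<in> carrier G \<and> N #> x = N #> z" x] that
      rcos_mono_eq[OF assms, of x "SOME z. z \<in> carrier G \<and> N #> x = N #> z"] by (auto simp: f_def)
  moreover have "rcosets K = f ` (rcosets N)" by (force simp: RCOSETS_def f)
  ultimately show thesis by (rule that)
qed

lemma level_supset:
  assumes N: "N \<in> levels" and K: "K \<lhd> G" and "N \<subseteq> K"
  shows "K \<in> levels"
proof -
  have "openin T K"
    using openin_subgroup_supset[OF level_open[OF N] level_subgroup[OF N] normal_imp_subgroup[OF K] \<open>N \<subseteq> K\<close>] .
  moreover have "finite (rcosets K)"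
    using rcosets_map[OF level_subgroup[OF N] normal_imp_subgroup[OF K] \<open>N \<subseteq> K\<close>] level_finite[OF N] finite_imageI by metis
  ultimately show ?thesis using K by (simp add: levels_def open_normal_def)
qed

lemma card_rcosets_mono:
  assumes N: "N \<in> levels" and K: "K \<in> levels" and "N \<subseteq> K"
  shows "card (rcosets K) \<le> card (rcosets N)"
  using rcosets_map[OF level_subgroup[OF N] level_subgroup[OF K] \<open>N \<subseteq> K\<close>] level_finite[OF N] card_image_le by metis

lemma card_rcosets_eqD:
  assumes N: "N \<in> levels" and K: "K \<in> levels" and "N \<subseteq> K" and le: "card (rcosets N) \<le> card (rcosets K)"
  shows "N = K"
proof (rule ccontr)
  assume "N \<noteq> K"
  then obtain k where k: "k \<in> K" "k \<notin> N" using \<open>N \<subseteq> K\<close> by auto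
  have kG: "k \<in> carrier G" using k subgroup.subset[OF level_subgroup[OF K]] by auto
  obtain f where f: "\<And>x. x \<in> carrier G \<Longrightarrow> f (N #> x) = K #> x" and eq: "rcosets K = f ` (rcosets N)"
    using rcosets_map[OF level_subgroup[OF N] level_subgroup[OF K] \<open>N \<subseteq> K\<close>] by blast
  have inj: "inj_on f (rcosets N)"
    using le eq card_image_le[OF level_finite[OF N], of f] level_finite[OF N] eq_card_imp_inj_on[of "rcosets N" f] by simp
  have "K #> k = K #> \<one>" using k kG K level_subgroup by (metis coset_join2 coset_mult_one subgroup.subset)
  then have "f (N #> k) = f (N #> \<one>)" using f kG by simp
  then have "N #> k = N #> \<one>" using inj kG by (auto simp: inj_on_def RCOSETS_def)
  then have "k \<in> N #> \<one>" using rcos_self[OF kG level_subgroup[OF N]] by simp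
  then show False using k kG N level_subgroup by (metis coset_mult_one subgroup.subset)
qed

lemma carrier_level: "carrier G \<in> levels"
proof -
  have "carrier G \<lhd> G"
    by (rule normal_invI[OF subgroup_self]) simp
  moreover have "rcosets (carrier G) = {carrier G}"
    by (auto simp: RCOSETS_def coset_join2 subgroup_self)
  ultimately show ?thesis using openin_topspace[of T] by (simp add: levels_def open_normal_def topspace_eq)
qed

lemma rcos_Int:
  assumes "subgroup N G" "subgroup K G" "x \<in> carrier G"
  shows "(N \<inter> K) #> x = (N #> x) \<inter> (K #> x)"
  using assms subgroups_Inter_pair[OF assms(1,2)] by (auto simp: mem_rcoset_iff)

lemma level_Int:
  assumes N: "N \<in> levels" and K: "K \<in> levels"
  shows "N \<inter> K \<in> levels" and "card (rcosets (N \<inter> K)) \<le> card (rcosets N) * card (rcosets K)"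
proof -
  have sub: "rcosets (N \<inter> K) \<subseteq> (\<lambda>(X, Y). X \<inter> Y) ` ((rcosets N) \<times> (rcosets K))"
    by (auto simp: RCOSETS_def rcos_Int[OF level_subgroup[OF N] level_subgroup[OF K]])
  have fin: "finite ((rcosets N) \<times> (rcosets K))" using level_finite assms by auto
  show "card (rcosets (N \<inter> K)) \<le> card (rcosets N) * card (rcosets K)"
    using card_mono[OF finite_imageI[OF fin] sub] card_image_le[OF fin, of "\<lambda>(X, Y). X \<inter> Y"]
    by (simp add: card_cartesian_product)
  have "N \<inter> K \<lhd> G" using normal_subgroup_intersect level_normal assms by auto
  then show "N \<inter> K \<in> levels" using finite_subset[OF sub finite_imageI[OF fin]] openin_Int[OF level_open level_open, OF assms]
    by (simp add: levels_def open_normal_def)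
qed

text \<open>Supplies the join of two levels, by which independence is expressed: \<open>C\<close>
  and \<open>M\<close> are independent over \<open>K\<close> when \<open>C <#> M\<close> is all of
  \<open>K\<close>.\<close>

lemma level_setmult:
  assumes N: "N \<in> levels" and K: "K \<in> levels"
  shows "N <#> K \<in> levels" "N \<subseteq> N <#> K" "K \<subseteq> N <#> K"
proof -
  interpret N: normal N G using N level_normal by blast
  interpret K: normal K G using K level_normal by blast
  show a: "N \<subseteq> N <#> K"
  proof
    fix n assume n: "n \<in> N"
    then have "n \<otimes> \<one> \<in> N <#> K" using K.one_closed unfolding set_mult_def by blast
    then show "n \<in> N <#> K" using n by simp
  qed
  show "K \<subseteq> N <#> K"
  proof
    fix k assume k: "k \<in> K"
    then have "\<one> \<otimes> k \<in> N <#> K" using N.one_closed unfolding set_mult_def by blast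
    then show "k \<in> N <#> K" using k by simp
  qed
  have "N <#> K \<lhd> G"
  proof (rule normal_invI)
    show "subgroup (N <#> K) G"
      using N.normal_axioms K.is_subgroup mult_norm_subgroup by blast
    fix x h assume x: "x \<in> carrier G" and "h \<in> N <#> K"
    then obtain n k where h: "h = n \<otimes> k" "n \<in> N" "k \<in> K" by (auto simp: set_mult_def)
    have G: "n \<in> carrier G" "k \<in> carrier G" using h by auto
    have "inv x \<otimes> (x \<otimes> (k \<otimes> inv x)) = k \<otimes> inv x"
      using x G by (metis inv_closed inv_solve_left m_closed)
    then have "x \<otimes> h \<otimes> inv x = (x \<otimes> n \<otimes> inv x) \<otimes> (x \<otimes> k \<otimes> inv x)"
      using x G h(1) by (simp add: m_assoc)
    then show "x \<otimes> h \<otimes> inv x \<in> N <#> K"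
      using N.inv_op_closed2[OF x h(2)] K.inv_op_closed2[OF x h(3)] unfolding set_mult_def by blast
  qed
  then show "N <#> K \<in> levels" using level_supset[OF N _ a] by simp
qed

text \<open>A subgroup containing \<open>N\<close> is a union of cosets of \<open>N\<close>, and
  these are finite in number.\<close>

lemma finite_levels_above:
  assumes "N \<in> levels" shows "finite {K \<in> levels. N \<subseteq> K}"
proof (rule finite_subset)
  show "{K \<in> levels. N \<subseteq> K} \<subseteq> Union ` Pow (rcosets N)"
  proof
    fix K assume K: "K \<in> {K \<in> levels. N \<subseteq> K}"
    have "K = \<Union>{N #> x |x. x \<in> K}"
    proof (intro equalityI subsetI)
      fix x assume "x \<in> K"
      then show "x \<in> \<Union>{N #> x |x. x \<in> K}"
        using rcos_self[OF _ level_subgroup[OF assms], of x] K subgroup.mem_carrier[OF level_subgroup, of K x] by auto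
    next
      fix x assume "x \<in> \<Union>{N #> x |x. x \<in> K}"
      then obtain y where "y \<in> K" "x \<in> N #> y" by auto
      then show "x \<in> K" using K subgroup.m_closed[OF level_subgroup] by (auto simp: r_coset_def)
    qed
    moreover have "{N #> x |x. x \<in> K} \<subseteq> rcosets N"
      using K subgroup.mem_carrier[OF level_subgroup] by (auto simp: RCOSETS_def)
    ultimately show "K \<in> Union ` Pow (rcosets N)" by blast
  qed
qed (simp add: level_finite[OF assms])

definition elems :: "('a set \<times> 'a set) set" where
  "elems = (SIGMA N:levels. rcosets N)"

text \<open>Only the cosets are compared, because a coset determines its subgroup.\<close>

definition mv :: "('a \<times> 'a) set \<Rightarrow> 'a set \<times> 'a set \<Rightarrow> 'a set \<times> 'a set \<Rightarrow> bool" where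
  "mv R \<alpha> \<beta> \<longleftrightarrow> (\<forall>x y. (x, y) \<in> R \<longrightarrow> (x \<in> snd \<alpha> \<longleftrightarrow> y \<in> snd \<beta>))"

text \<open>A single isomorphism has to move all pairs in \<open>P\<close>.\<close>

definition sim :: "(('a set \<times> 'a set) \<times> ('a set \<times> 'a set)) set \<Rightarrow> bool" where
  "sim P \<longleftrightarrow> P \<subseteq> elems \<times> elems \<and> (\<exists>R. corr R \<and> (\<forall>\<alpha> \<beta>. (\<alpha>, \<beta>) \<in> P \<longrightarrow> mv R \<alpha> \<beta>))"

section \<open>Calculus of correspondences and of the elements they move\<close>

lemma corr_carrier: "corr R \<Longrightarrow> (x, y) \<in> R \<Longrightarrow> x \<in> carrier G \<and> y \<in> carrier G"
  and corr_mult: "corr R \<Longrightarrow> (x, y) \<in> R \<Longrightarrow> (x', y') \<in> R \<Longrightarrow> (x \<otimes> x', y \<otimes> y') \<in> R"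
  and corr_inv: "corr R \<Longrightarrow> (x, y) \<in> R \<Longrightarrow> (inv x, inv y) \<in> R"
  and corr_lker: "corr R \<Longrightarrow> {x. (x, \<one>) \<in> R} \<in> levels"
  and corr_rker: "corr R \<Longrightarrow> {y. (\<one>, y) \<in> R} \<in> levels"
  by (auto simp: corr_def)

lemma corr_total: "corr R \<Longrightarrow> x \<in> carrier G \<Longrightarrow> \<exists>y. (x, y) \<in> R"
  and corr_onto: "corr R \<Longrightarrow> y \<in> carrier G \<Longrightarrow> \<exists>x. (x, y) \<in> R"
  by (auto simp: corr_def subset_iff Domain_iff Range_iff)

lemma corr_one: "corr R \<Longrightarrow> (\<one>, \<one>) \<in> R"
  using subgroup.one_closed[OF level_subgroup[OF corr_lker]] by simp

lemma corr_converse: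
  assumes "corr R" shows "corr (R\<inverse>)"
  using assms by (auto simp: corr_def)

text \<open>Since \<open>R\<close> projects onto the second factor, a conjugation on the right lifts
  to a conjugation on the left, where \<open>N\<close> is stable.\<close>

lemma corr_image_normal:
  assumes R: "corr R" and N: "N \<lhd> G"
  shows "R `` N \<lhd> G"
proof (rule normal_invI)
  note [simp] = normal_imp_subgroup[OF N]
  show "subgroup (R `` N) G"
  proof
    show "R `` N \<subseteq> carrier G" using corr_carrier[OF R] by auto
    show "\<one> \<in> R `` N" using corr_one[OF R] subgroup.one_closed[OF normal_imp_subgroup[OF N]] by auto
  next
    fix x y assume "x \<in> R `` N" "y \<in> R `` N"
    then show "x \<otimes> y \<in> R `` N"
      using corr_mult[OF R] subgroup.m_closed[OF normal_imp_subgroup[OF N]] by blast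
  next
    fix x assume "x \<in> R `` N"
    then show "inv x \<in> R `` N"
      using corr_inv[OF R] subgroup.m_inv_closed[OF normal_imp_subgroup[OF N]] by blast
  qed
  fix y h assume y: "y \<in> carrier G" and "h \<in> R `` N"
  then obtain n x where "n \<in> N" "(n, h) \<in> R" "(x, y) \<in> R" using corr_onto[OF R] by blast
  moreover from this have "x \<in> carrier G" using corr_carrier[OF R] by blast
  ultimately show "y \<otimes> h \<otimes> inv y \<in> R `` N"
    using normal.inv_op_closed2[OF N, of x n] corr_mult[OF R] corr_inv[OF R] by blast
qed

lemma corr_image_level:
  assumes R: "corr R" and N: "N \<in> levels"
  shows "R `` N \<in> levels"
  using level_supset[OF corr_rker[OF R] corr_image_normal[OF R level_normal[OF N]]]
    subgroup.one_closed[OF level_subgroup[OF N]] by blast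

text \<open>The kernels of the composite are the image of one kernel and the preimage of another, so
  they are levels by \<open>corr_image_level\<close>.\<close>

lemma corr_relcomp:
  assumes R: "corr R" and R': "corr R'"
  shows "corr (R O R')"
proof -
  have "{x. (x, \<one>) \<in> R O R'} = R\<inverse> `` {x. (x, \<one>) \<in> R'}" by auto
  moreover have "{x. (\<one>, x) \<in> R O R'} = R' `` {x. (\<one>, x) \<in> R}" by auto
  ultimately have "{x. (x, \<one>) \<in> R O R'} \<in> levels" "{x. (\<one>, x) \<in> R O R'} \<in> levels"
    using corr_image_level[OF corr_converse[OF R] corr_lker[OF R']] corr_image_level[OF R' corr_rker[OF R]] by auto
  moreover have "\<exists>z. (x, z) \<in> R O R'" if "x \<in> carrier G" for x
    using corr_total[OF R that] corr_carrier[OF R] corr_total[OF R'] by blast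
  moreover have "\<exists>z. (z, x) \<in> R O R'" if "x \<in> carrier G" for x
    using corr_onto[OF R' that] corr_carrier[OF R'] corr_onto[OF R] by blast
  moreover have "(x \<otimes> x', z \<otimes> z') \<in> R O R'" if "(x, z) \<in> R O R'" "(x', z') \<in> R O R'" for x z x' z'
    using that corr_mult[OF R] corr_mult[OF R'] by blast
  moreover have "(inv x, inv z) \<in> R O R'" if "(x, z) \<in> R O R'" for x z
    using that corr_inv[OF R] corr_inv[OF R'] by blast
  moreover have "R O R' \<subseteq> carrier G \<times> carrier G"
    using corr_carrier[OF R] corr_carrier[OF R'] by auto
  ultimately show ?thesis unfolding corr_def by blast
qed

lemma rcos_eq_self_iff:
  assumes "subgroup N G" "x \<in> carrier G"
  shows "N #> x = N \<longleftrightarrow> x \<in> N"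
  using coset_join1[OF _ assms(2,1)] coset_join2[OF assms(2,1)] by blast

text \<open>This relation is the graph of the identity of \<open>G/N\<close>, pulled back to
  \<open>G \<times> G\<close>; both of its kernels are \<open>N\<close>.\<close>

lemma corr_level:
  assumes N: "N \<in> levels"
  shows "corr {(x, y). x \<in> carrier G \<and> y \<in> carrier G \<and> N #> x = N #> y}"
proof -
  interpret N: normal N G using N level_normal by blast
  have eq: "{x. x \<in> carrier G \<and> N #> x = N #> \<one>} = N" "{x. x \<in> carrier G \<and> N #> \<one> = N #> x} = N"
    using rcos_eq_self_iff[OF N.is_subgroup] N.subset by auto
  have m: "N #> (x \<otimes> x') = N #> (y \<otimes> y')"
    if "x \<in> carrier G" "x' \<in> carrier G" "y \<in> carrier G" "y' \<in> carrier G" "N #> x = N #> y" "N #> x' = N #> y'"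
    for x y x' y' using that N.rcos_sum by metis
  have i: "N #> inv x = N #> inv y" if "x \<in> carrier G" "y \<in> carrier G" "N #> x = N #> y" for x y
    using that N.rcos_inv by metis
  show ?thesis unfolding corr_def using eq N m i by auto
qed

lemma elem_rcos:
  assumes "\<alpha> \<in> elems" "x \<in> snd \<alpha>"
  shows "x \<in> carrier G" "snd \<alpha> = fst \<alpha> #> x"
    "y \<in> snd \<alpha> \<longleftrightarrow> y \<in> carrier G \<and> y \<otimes> inv x \<in> fst \<alpha>"
    "n \<in> fst \<alpha> \<longleftrightarrow> n \<in> carrier G \<and> n \<otimes> x \<in> snd \<alpha>"
proof -
  obtain N X where \<alpha>: "\<alpha> = (N, X)" "N \<in> levels" "X \<in> rcosets N" using assms by (auto simp: elems_def)
  then obtain a where a: "a \<in> carrier G" "X = N #> a" by (auto simp: RCOSETS_def)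
  have N: "subgroup N G" using level_subgroup \<alpha> by simp
  show x: "x \<in> carrier G" using assms a \<alpha> N by (auto simp: mem_rcoset_iff)
  have X: "X = N #> x" using repr_independence[OF _ a(1) N, of x] a assms \<alpha> by simp
  show "snd \<alpha> = fst \<alpha> #> x" "y \<in> snd \<alpha> \<longleftrightarrow> y \<in> carrier G \<and> y \<otimes> inv x \<in> fst \<alpha>"
    using X N x \<alpha> by (auto simp: mem_rcoset_iff)
  show "n \<in> fst \<alpha> \<longleftrightarrow> n \<in> carrier G \<and> n \<otimes> x \<in> snd \<alpha>"
    using X N x \<alpha> subgroup.mem_carrier[OF N] by (auto simp: mem_rcoset_iff m_assoc)
qed

lemma elem_nonempty: "\<alpha> \<in> elems \<Longrightarrow> \<exists>x. x \<in> snd \<alpha>"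
  by (auto simp: elems_def RCOSETS_def) (metis level_subgroup rcos_self)

lemma elem_level: "\<alpha> \<in> elems \<Longrightarrow> fst \<alpha> \<in> levels"
  by (auto simp: elems_def)

lemma elem_subset: "\<alpha> \<in> elems \<Longrightarrow> snd \<alpha> \<subseteq> carrier G"
  using elem_rcos(1) by (meson subsetI)

text \<open>The subgroup is recovered from the coset: its members are those \<open>n\<close> for
  which multiplying a point of the coset by \<open>n\<close> stays inside. \<open>R\<close> respects
  products, so moving the coset also moves the subgroup.\<close>

lemma mv_fst:
  assumes R: "corr R" and "\<alpha> \<in> elems" "\<beta> \<in> elems" and mv: "mv R \<alpha> \<beta>" and xy: "(x, y) \<in> R"
  shows "x \<in> fst \<alpha> \<longleftrightarrow> y \<in> fst \<beta>"
proof -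
  obtain a where a: "a \<in> snd \<alpha>" using elem_nonempty assms by blast
  then obtain b where ab: "(a, b) \<in> R" using corr_total[OF R] elem_rcos(1) assms by blast
  then have b: "b \<in> snd \<beta>" using mv a by (simp add: mv_def)
  have "x \<otimes> a \<in> snd \<alpha> \<longleftrightarrow> y \<otimes> b \<in> snd \<beta>" using mv corr_mult[OF R xy ab] by (simp add: mv_def)
  then show ?thesis using elem_rcos(4)[OF \<open>\<alpha> \<in> elems\<close> a] elem_rcos(4)[OF \<open>\<beta> \<in> elems\<close> b] corr_carrier[OF R xy] by simp
qed

lemma corr_subset:
  assumes R: "corr R" and A: "A \<subseteq> carrier G" and "\<And>x y. (x, y) \<in> R \<Longrightarrow> x \<in> A \<longleftrightarrow> y \<in> A'" "\<And>x y. (x, y) \<in> R \<Longrightarrow> x \<in> B \<longleftrightarrow> y \<in> B'"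
    and "A' \<subseteq> carrier G"
  shows "A \<subseteq> B \<longleftrightarrow> A' \<subseteq> B'"
  using assms corr_total[OF R] corr_onto[OF R] by (meson subset_iff)

lemma mv_le:
  assumes "corr R" "\<alpha> \<in> elems" "\<beta> \<in> elems" "\<alpha>' \<in> elems" "\<beta>' \<in> elems" "mv R \<alpha> \<alpha>'" "mv R \<beta> \<beta>'"
  shows "fst \<alpha> \<subseteq> fst \<beta> \<longleftrightarrow> fst \<alpha>' \<subseteq> fst \<beta>'" "snd \<alpha> \<subseteq> snd \<beta> \<longleftrightarrow> snd \<alpha>' \<subseteq> snd \<beta>'" "fst \<alpha> = fst \<beta> \<longleftrightarrow> fst \<alpha>' = fst \<beta>'"
    "\<alpha> = \<beta> \<longleftrightarrow> \<alpha>' = \<beta>'"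
proof -
  have sub: "fst \<gamma> \<subseteq> carrier G" if "\<gamma> \<in> elems" for \<gamma>
    using that elem_level level_subgroup subgroup.subset by metis
  note c = corr_subset[OF assms(1)]
  have 1: "fst \<alpha> \<subseteq> fst \<beta> \<longleftrightarrow> fst \<alpha>' \<subseteq> fst \<beta>'" "fst \<beta> \<subseteq> fst \<alpha> \<longleftrightarrow> fst \<beta>' \<subseteq> fst \<alpha>'"
    by (rule c; use assms sub mv_fst in blast)+
  have 2: "snd \<alpha> \<subseteq> snd \<beta> \<longleftrightarrow> snd \<alpha>' \<subseteq> snd \<beta>'" "snd \<beta> \<subseteq> snd \<alpha> \<longleftrightarrow> snd \<beta>' \<subseteq> snd \<alpha>'"
    by (rule c; use assms elem_subset in \<open>auto simp: mv_def\<close>)+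
  show "fst \<alpha> \<subseteq> fst \<beta> \<longleftrightarrow> fst \<alpha>' \<subseteq> fst \<beta>'" "snd \<alpha> \<subseteq> snd \<beta> \<longleftrightarrow> snd \<alpha>' \<subseteq> snd \<beta>'" "fst \<alpha> = fst \<beta> \<longleftrightarrow> fst \<alpha>' = fst \<beta>'"
    using 1 2 by auto
  show "\<alpha> = \<beta> \<longleftrightarrow> \<alpha>' = \<beta>'" using 1 2 by (simp add: prod_eq_iff set_eq_subset)
qed

lemma mv_mult:
  assumes R: "corr R" and e: "\<alpha> \<in> elems" "\<beta> \<in> elems" "\<gamma> \<in> elems" "\<alpha>' \<in> elems" "\<beta>' \<in> elems" "\<gamma>' \<in> elems"
    and m: "mv R \<alpha> \<alpha>'" "mv R \<beta> \<beta>'" "mv R \<gamma> \<gamma>'" and eq: "snd \<alpha> <#> snd \<beta> = snd \<gamma>"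
  shows "snd \<alpha>' <#> snd \<beta>' = snd \<gamma>'"
proof (intro equalityI subsetI)
  fix z assume "z \<in> snd \<alpha>' <#> snd \<beta>'"
  then obtain x' y' where z: "z = x' \<otimes> y'" "x' \<in> snd \<alpha>'" "y' \<in> snd \<beta>'" by (auto simp: set_mult_def)
  then obtain x y where xy: "(x, x') \<in> R" "(y, y') \<in> R" using corr_onto[OF R] elem_subset[OF e(4)] elem_subset[OF e(5)] by (meson subsetD)
  then have "x \<in> snd \<alpha>" "y \<in> snd \<beta>" using m z by (auto simp: mv_def)
  then have "x \<otimes> y \<in> snd \<gamma>" unfolding eq[symmetric] set_mult_def by blast
  then show "z \<in> snd \<gamma>'" using m(3) corr_mult[OF R xy] z by (simp add: mv_def)
next
  fix z' assume z': "z' \<in> snd \<gamma>'"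
  then obtain z where z: "(z, z') \<in> R" using corr_onto[OF R] elem_subset[OF e(6)] by (meson subsetD)
  then have "z \<in> snd \<gamma>" using m(3) z' by (simp add: mv_def)
  then obtain x y where xy: "z = x \<otimes> y" "x \<in> snd \<alpha>" "y \<in> snd \<beta>"
    unfolding eq[symmetric] set_mult_def by blast
  then have xyG: "x \<in> carrier G" "y \<in> carrier G" using elem_subset[OF e(1)] elem_subset[OF e(2)] by auto
  obtain x' where x': "(x, x') \<in> R" using corr_total[OF R xyG(1)] by blast
  \<comment> \<open>An arbitrary partner of \<open>y\<close> would give the product
    \<open>z'\<close> only up to the right kernel. Dividing \<open>z'\<close> by \<open>x'\<close>
    gives a partner with exactly this product.\<close>
  have "(inv x \<otimes> z, inv x' \<otimes> z') \<in> R" using corr_mult[OF R corr_inv[OF R x'] z] .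
  moreover have "inv x \<otimes> z = y" using xy xyG by (simp add: m_assoc[symmetric])
  ultimately have "inv x' \<otimes> z' \<in> snd \<beta>'" using m(2) xy by (simp add: mv_def)
  moreover have "x' \<in> snd \<alpha>'" using m(1) x' xy by (simp add: mv_def)
  moreover have "z' = x' \<otimes> (inv x' \<otimes> z')" using corr_carrier[OF R x'] corr_carrier[OF R z]
    by (simp add: m_assoc[symmetric])
  ultimately show "z' \<in> snd \<alpha>' <#> snd \<beta>'" unfolding set_mult_def by blast
qed

lemma corr_image_rcos:
  assumes R: "corr R" and N: "N \<in> levels" and xy: "(x, y) \<in> R"
  shows "R `` (N #> x) = R `` N #> y"
proof -
  have G: "x \<in> carrier G" "y \<in> carrier G" using corr_carrier[OF R xy] by auto
  show ?thesis
  proof (intro equalityI subsetI)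
    fix z assume "z \<in> R `` (N #> x)"
    then obtain n where n: "n \<in> N" "(n \<otimes> x, z) \<in> R" by (auto simp: r_coset_def)
    have nG: "n \<in> carrier G" using n subgroup.mem_carrier[OF level_subgroup[OF N]] by simp
    have "(n \<otimes> x \<otimes> inv x, z \<otimes> inv y) \<in> R" using corr_mult[OF R n(2) corr_inv[OF R xy]] .
    then have "z \<otimes> inv y \<in> R `` N" using n nG G by (auto simp: m_assoc)
    then show "z \<in> R `` N #> y"
      using mem_rcoset_iff[OF level_subgroup[OF corr_image_level[OF R N]] G(2)] corr_carrier[OF R n(2)] by simp
  next
    fix z assume "z \<in> R `` N #> y"
    then obtain n n' where n: "n \<in> N" "(n, n') \<in> R" "z = n' \<otimes> y" by (auto simp: r_coset_def)
    then show "z \<in> R `` (N #> x)" using corr_mult[OF R n(2) xy] by (auto simp: r_coset_def)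
  qed
qed

text \<open>When the left kernel lies in the subgroup of \<open>\<alpha>\<close>, two elements with
  a common partner lie in the same coset of that subgroup. Hence nothing outside
  \<open>\<alpha>\<close> is related to the image of \<open>\<alpha>\<close>.\<close>

lemma corr_image_elem:
  assumes R: "corr R" and \<alpha>: "\<alpha> \<in> elems" and le: "{x. (x, \<one>) \<in> R} \<subseteq> fst \<alpha>"
  shows "(R `` fst \<alpha>, R `` snd \<alpha>) \<in> elems" "mv R \<alpha> (R `` fst \<alpha>, R `` snd \<alpha>)"
proof -
  obtain x where x: "x \<in> snd \<alpha>" using elem_nonempty[OF \<alpha>] by blast
  then obtain y where xy: "(x, y) \<in> R" using corr_total[OF R] elem_rcos(1)[OF \<alpha>] by blast
  have "R `` snd \<alpha> = R `` fst \<alpha> #> y"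
    using corr_image_rcos[OF R elem_level[OF \<alpha>] xy] elem_rcos(2)[OF \<alpha> x] by simp
  then show "(R `` fst \<alpha>, R `` snd \<alpha>) \<in> elems"
    using corr_image_level[OF R elem_level[OF \<alpha>]] corr_carrier[OF R xy] by (auto simp: elems_def RCOSETS_def)
  have "u \<in> snd \<alpha>" if uv: "(u, v) \<in> R" and v: "v \<in> R `` snd \<alpha>" for u v
  proof -
    obtain w where w: "w \<in> snd \<alpha>" "(w, v) \<in> R" using v by auto
    have G: "w \<in> carrier G" "u \<in> carrier G" "v \<in> carrier G"
      using corr_carrier[OF R uv] corr_carrier[OF R w(2)] by auto
    have "(u \<otimes> inv w, v \<otimes> inv v) \<in> R" using corr_mult[OF R uv corr_inv[OF R w(2)]] .
    then have "u \<otimes> inv w \<in> fst \<alpha>" using le G by auto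
    then show ?thesis using elem_rcos(3)[OF \<alpha> w(1)] G by simp
  qed
  then show "mv R \<alpha> (R `` fst \<alpha>, R `` snd \<alpha>)" by (auto simp: mv_def)
qed

lemma mv_card_le:
  assumes R: "corr R" and "\<alpha> \<in> elems" "\<beta> \<in> elems" and mv: "mv R \<alpha> \<beta>"
  shows "card (rcosets (fst \<beta>)) \<le> card (rcosets (fst \<alpha>))"
proof -
  have "R `` fst \<alpha> = fst \<beta>"
  proof (intro equalityI subsetI)
    fix y assume "y \<in> fst \<beta>"
    then have "y \<in> carrier G" using subgroup.mem_carrier[OF level_subgroup[OF elem_level[OF \<open>\<beta> \<in> elems\<close>]]] by simp
    then obtain x where "(x, y) \<in> R" using corr_onto[OF R] by blast
    then show "y \<in> R `` fst \<alpha>" using mv_fst[OF assms, of x y] \<open>y \<in> fst \<beta>\<close> by blast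
  next
    fix y assume "y \<in> R `` fst \<alpha>"
    then obtain x where "x \<in> fst \<alpha>" "(x, y) \<in> R" by blast
    then show "y \<in> fst \<beta>" using mv_fst[OF assms, of x y] by blast
  qed
  have "rcosets (fst \<beta>) \<subseteq> (``) R ` (rcosets (fst \<alpha>))"
  proof
    fix Y assume "Y \<in> rcosets (fst \<beta>)"
    then obtain y where y: "y \<in> carrier G" "Y = fst \<beta> #> y" by (auto simp: RCOSETS_def)
    then obtain x where x: "(x, y) \<in> R" using corr_onto[OF R] by blast
    then have "Y = R `` (fst \<alpha> #> x)"
      using y corr_image_rcos[OF R elem_level[OF \<open>\<alpha> \<in> elems\<close>] x] \<open>R `` fst \<alpha> = fst \<beta>\<close> by simp
    then show "Y \<in> (``) R ` (rcosets (fst \<alpha>))" using corr_carrier[OF R x] by (auto simp: RCOSETS_def)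
  qed
  then show ?thesis using level_finite[OF elem_level[OF \<open>\<alpha> \<in> elems\<close>]]
    by (meson card_image_le card_mono finite_imageI le_trans)
qed

lemma mv_card:
  assumes R: "corr R" and "\<alpha> \<in> elems" "\<beta> \<in> elems" and mv: "mv R \<alpha> \<beta>"
  shows "card (rcosets (fst \<alpha>)) = card (rcosets (fst \<beta>))"
  using mv_card_le[OF assms] mv_card_le[OF corr_converse[OF R] assms(3,2)] mv
  by (auto simp: mv_def)

section \<open>Finite partial isomorphisms\<close>

lemma simI: "P \<subseteq> elems \<times> elems \<Longrightarrow> corr R \<Longrightarrow> (\<And>\<alpha> \<beta>. (\<alpha>, \<beta>) \<in> P \<Longrightarrow> mv R \<alpha> \<beta>) \<Longrightarrow> sim P"
  unfolding sim_def by blast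

lemma sim_mono: "sim P \<Longrightarrow> Q \<subseteq> P \<Longrightarrow> sim Q"
  unfolding sim_def by (meson subset_iff)

lemma sim_converse: "sim P \<Longrightarrow> sim (P\<inverse>)"
  unfolding sim_def using corr_converse by (fastforce simp: mv_def)

lemma sim_relcomp:
  assumes "sim P" "sim Q" shows "sim (P O Q)"
proof -
  obtain R where R: "corr R" "\<And>\<alpha> \<beta>. (\<alpha>, \<beta>) \<in> P \<Longrightarrow> mv R \<alpha> \<beta>" and P: "P \<subseteq> elems \<times> elems"
    using assms(1) unfolding sim_def by blast
  obtain R' where R': "corr R'" "\<And>\<alpha> \<beta>. (\<alpha>, \<beta>) \<in> Q \<Longrightarrow> mv R' \<alpha> \<beta>" and Q: "Q \<subseteq> elems \<times> elems"
    using assms(2) unfolding sim_def by blast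
  have "mv (R O R') \<alpha> \<gamma>" if \<alpha>\<gamma>: "(\<alpha>, \<gamma>) \<in> P O Q" for \<alpha> \<gamma>
  proof -
    obtain \<beta> where "mv R \<alpha> \<beta>" "mv R' \<beta> \<gamma>" using \<alpha>\<gamma> R(2) R'(2) by blast
    then show ?thesis by (auto simp: mv_def)
  qed
  moreover have "P O Q \<subseteq> elems \<times> elems" using P Q by auto
  ultimately show ?thesis using simI[OF _ corr_relcomp[OF R(1) R'(1)]] by simp
qed

lemma levels_Inter:
  assumes "finite \<N>" "\<N> \<subseteq> levels" shows "carrier G \<inter> \<Inter>\<N> \<in> levels"
  using assms
proof (induction rule: finite_induct)
  case empty then show ?case using carrier_level by simp
next
  case (insert N \<N>)
  then show ?case using level_Int(1)[of N "carrier G \<inter> \<Inter>\<N>"] by (simp add: Int_left_commute)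
qed

text \<open>All members of a finite set are unions of cosets of the intersection of their subgroups,
  so the identity of that one quotient fixes them.\<close>

lemma sim_refl:
  assumes "finite F" "F \<subseteq> elems" shows "sim (Id_on F)"
proof -
  define N where "N = carrier G \<inter> \<Inter>(fst ` F)"
  have N: "N \<in> levels" unfolding N_def using assms elem_level by (intro levels_Inter) auto
  have "mv {(x, y). x \<in> carrier G \<and> y \<in> carrier G \<and> N #> x = N #> y} \<alpha> \<alpha>" if "\<alpha> \<in> F" for \<alpha>
  proof -
    have \<alpha>: "\<alpha> \<in> elems" using that assms by auto
    have sub: "N \<subseteq> fst \<alpha>" using that by (auto simp: N_def)
    have "y \<in> snd \<alpha>" if x: "x \<in> snd \<alpha>" and y: "y \<in> carrier G" "N #> x = N #> y" for x y
    proof -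
      have "fst \<alpha> #> x = fst \<alpha> #> y"
        using rcos_mono_eq[OF level_subgroup[OF N] level_subgroup[OF elem_level[OF \<alpha>]] sub _ y] elem_rcos(1)[OF \<alpha> x] by simp
      then show ?thesis using elem_rcos(2)[OF \<alpha> x] rcos_self[OF y(1) level_subgroup[OF elem_level[OF \<alpha>]]] by simp
    qed
    then show ?thesis unfolding mv_def by (smt (verit) case_prodD mem_Collect_eq)
  qed
  then show ?thesis using simI[OF _ corr_level[OF N], of "Id_on F"] assms by auto
qed

text \<open>The amalgam of an isomorphism over \<open>G/K\<close> with the identity of \<open>G/C\<close>, where \<open>C\<close> and the
  kernels of the isomorphism are independent over \<open>K\<close>.\<close>

lemma corr_amalgam:
  assumes R: "corr R" and C: "C \<in> levels" and K: "K \<in> levels" and "C \<subseteq> K"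
    and id: "\<And>x y. (x, y) \<in> R \<Longrightarrow> K #> x = K #> y"
    and l: "K \<subseteq> C <#> {x. (x, \<one>) \<in> R}" and r: "K \<subseteq> C <#> {y. (\<one>, y) \<in> R}"
  shows "corr {(x, y) \<in> R. C #> x = C #> y}" (is "corr ?R")
proof -
  interpret C: normal C G using C level_normal by blast
  note Rc = corr_level[OF C]
  have "{x. (x, \<one>) \<in> ?R} = {x. (x, \<one>) \<in> R} \<inter> C" "{x. (\<one>, x) \<in> ?R} = {x. (\<one>, x) \<in> R} \<inter> C"
    using rcos_eq_self_iff[OF C.is_subgroup] corr_carrier[OF R] C.subset by (auto simp: eq_commute[of C])
  then have k: "{x. (x, \<one>) \<in> ?R} \<in> levels" "{x. (\<one>, x) \<in> ?R} \<in> levels"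
    using level_Int(1)[OF corr_lker[OF R] C] level_Int(1)[OF corr_rker[OF R] C] by auto
  \<comment> \<open>\<open>x\<close> and \<open>y\<close> differ by an element of \<open>K\<close>,
    which splits as \<open>c \<otimes> m\<close> with \<open>c\<close> in \<open>C\<close> and
    \<open>m\<close> in the right kernel. Replacing \<open>y\<close> by \<open>m \<otimes> y\<close>
    corrects the \<open>C\<close>-coset without leaving the correspondence. Stated for a general
    correspondence so that it also applies to the converse of \<open>R\<close>.\<close>
  have *: "\<exists>m. (\<one>, m) \<in> R' \<and> C #> x = C #> (m \<otimes> y)"
    if R': "corr R'" "K \<subseteq> C <#> {y. (\<one>, y) \<in> R'}" "\<And>x y. (x, y) \<in> R' \<Longrightarrow> K #> x = K #> y" and xy: "(x, y) \<in> R'" for R' x y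
  proof -
    have G: "x \<in> carrier G" "y \<in> carrier G" using corr_carrier[OF R'(1) xy] by auto
    have "x \<in> K #> y" using R'(3)[OF xy] rcos_self[OF G(1) level_subgroup[OF K]] by simp
    then have "x \<otimes> inv y \<in> K" using mem_rcoset_iff[OF level_subgroup[OF K] G(2)] by simp
    then obtain c m where cm: "x \<otimes> inv y = c \<otimes> m" "c \<in> C" "(\<one>, m) \<in> R'" using R'(2) by (auto simp: set_mult_def)
    have mG: "m \<in> carrier G" using corr_carrier[OF R'(1) cm(3)] by simp
    have "x = x \<otimes> inv y \<otimes> y" using G by (simp add: m_assoc)
    then have "x = c \<otimes> (m \<otimes> y)" using G mG C.mem_carrier[OF cm(2)] cm(1) by (simp add: m_assoc)
    then have "x \<in> C #> (m \<otimes> y)" using cm by (auto simp: r_coset_def)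
    then have "C #> x = C #> (m \<otimes> y)" using repr_independence[OF _ _ C.is_subgroup, of x "m \<otimes> y"] G mG by simp
    then show ?thesis using cm by auto
  qed
  have t: "\<exists>y. (x, y) \<in> ?R" if x: "x \<in> carrier G" for x
  proof -
    obtain y where xy: "(x, y) \<in> R" using corr_total[OF R x] by auto
    obtain m where m: "(\<one>, m) \<in> R" "C #> x = C #> (m \<otimes> y)" using *[OF R r id xy] by auto
    have "(\<one> \<otimes> x, m \<otimes> y) \<in> R" using corr_mult[OF R m(1) xy] .
    then show ?thesis using m x by auto
  qed
  have s: "\<exists>x. (x, y) \<in> ?R" if y: "y \<in> carrier G" for y
  proof -
    obtain x where xy: "(x, y) \<in> R" using corr_onto[OF R y] by auto
    obtain m where m: "(m, \<one>) \<in> R" "C #> y = C #> (m \<otimes> x)"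
      using *[OF corr_converse[OF R], of y x] l id xy by auto
    have "(m \<otimes> x, \<one> \<otimes> y) \<in> R" using corr_mult[OF R m(1) xy] .
    then show ?thesis using m y by auto
  qed
  show ?thesis unfolding corr_def
  proof (intro conjI allI impI; (elim conjE)?)
    fix x y x' y' assume "(x, y) \<in> ?R" "(x', y') \<in> ?R"
    then show "(x \<otimes> x', y \<otimes> y') \<in> ?R"
      using corr_mult[OF R, of x y x' y'] corr_mult[OF Rc, of x y x' y'] corr_carrier[OF R] by auto
  next
    fix x y assume "(x, y) \<in> ?R"
    then show "(inv x, inv y) \<in> ?R"
      using corr_inv[OF R, of x y] corr_inv[OF Rc, of x y] corr_carrier[OF R] by auto
  qed (use k t s corr_carrier[OF R] in auto)
qed

text \<open>The quotient is copied to natural numbers because \<open>embedding_property\<close>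
  quantifies over finite groups of that type.\<close>

lemma level_epi:
  assumes N: "N \<in> levels"
  obtains A :: "nat monoid" and f where "group A" "finite (carrier A)" "f \<in> continuous_epi G T A"
    "\<And>x y. x \<in> carrier G \<Longrightarrow> y \<in> carrier G \<Longrightarrow> f x = f y \<longleftrightarrow> N #> x = N #> y"
proof -
  interpret N: normal N G using N level_normal by blast
  obtain \<iota> :: "'a set \<Rightarrow> nat" where \<iota>: "inj_on \<iota> (rcosets N)"
    using finite_imp_inj_to_nat_seg[OF level_finite[OF N]] by blast
  define f where "f x = \<iota> (N #> x)" for x
  define A :: "nat monoid" where "A = \<lparr>carrier = \<iota> ` (rcosets N),
    mult = (\<lambda>i j. \<iota> (inv_into (rcosets N) \<iota> i <#> inv_into (rcosets N) \<iota> j)), one = \<iota> N\<rparr>"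
  have fA: "f ` carrier G = carrier A" by (auto simp: A_def f_def RCOSETS_def)
  have hom: "f \<in> hom G A"
    by (rule homI) (auto simp: A_def f_def inv_into_f_f[OF \<iota>] rcosetsI N.subset N.rcos_sum)
  have "A\<lparr>carrier := f ` carrier G, one := f \<one>\<rparr> = A" by (simp add: fA) (simp add: A_def f_def N.subset)
  then have gA: "group A" using hom_imp_img_group[OF hom] by simp
  have eq: "f x = f y \<longleftrightarrow> N #> x = N #> y" if "x \<in> carrier G" "y \<in> carrier G" for x y
    using that inj_on_eq_iff[OF \<iota>] by (simp add: f_def rcosetsI N.subset)
  have "openin T {x \<in> carrier G. f x \<in> V}" for V
  proof (subst openin_subopen, intro ballI)
    fix x assume x: "x \<in> {x \<in> carrier G. f x \<in> V}"
    let ?W = "{y \<in> carrier G. y \<otimes> inv x \<in> N}"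
    have xG: "x \<in> carrier G" using x by simp
    have sub: "?W \<subseteq> {x \<in> carrier G. f x \<in> V}"
    proof
      fix y assume y: "y \<in> ?W"
      then have "y \<in> N #> x" using mem_rcoset_iff[OF N.is_subgroup xG] by simp
      from repr_independence[OF this xG N.is_subgroup] have "f x = f y" by (simp add: f_def)
      then show "y \<in> {x \<in> carrier G. f x \<in> V}" using x y by simp
    qed
    have "x \<in> ?W" using xG by simp
    with sub show "\<exists>W. openin T W \<and> x \<in> W \<and> W \<subseteq> {x \<in> carrier G. f x \<in> V}"
      using openin_translate[OF level_open[OF N], of "inv x"] xG by (intro exI[of _ ?W]) simp
  qed
  then have "f \<in> continuous_epi G T A" using hom fA
    by (auto simp: continuous_epi_def epi_def continuous_map_def topspace_eq)
  moreover have "finite (carrier A)" using level_finite[OF N] by (simp add: A_def)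
  ultimately show thesis using that gA eq by blast
qed

text \<open>The kernel is the preimage of an open point of a discrete space, and its quotient is
  isomorphic to the finite group \<open>A\<close>.\<close>

lemma continuous_epi_kernel_level:
  assumes A: "group A" "finite (carrier A)" and f: "f \<in> continuous_epi G T A"
  shows "{x \<in> carrier G. f x = \<one>\<^bsub>A\<^esub>} \<in> levels"
proof -
  interpret A: group A by fact
  have f': "f \<in> hom G A" "f ` carrier G = carrier A" "continuous_map T (discrete_topology (carrier A)) f"
    using f by (auto simp: continuous_epi_def epi_def)
  interpret f: group_hom G A f by unfold_locales fact
  have k: "{x \<in> carrier G. f x = \<one>\<^bsub>A\<^esub>} = kernel G A f" by (auto simp: kernel_def)
  have "finite (carrier (G Mod kernel G A f))"
    using f.FactGroup_iso_set[OF f'(2)] A(2) by (auto simp: iso_def dest: bij_betw_finite)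
  moreover have "openin T {x \<in> topspace T. f x \<in> {\<one>\<^bsub>A\<^esub>}}"
    by (rule openin_continuous_map_preimage[OF f'(3)]) simp
  ultimately show ?thesis using f.normal_kernel
    by (simp add: levels_def open_normal_def k FactGroup_def topspace_eq)
qed

end

locale embedding_group = profinite_group +
  assumes embedding: "embedding_property G T"
begin

text \<open>The only use of the embedding property.\<close>

lemma corr_refine:
  assumes R: "corr R" and M: "M \<in> levels"
  obtains R' where "corr R'" "R' \<subseteq> R" "{x. (x, \<one>) \<in> R'} \<subseteq> M"
proof -
  \<comment> \<open>\<open>B\<close> will be a copy of \<open>G/K\<close> with projection
    \<open>k\<close>, and \<open>A\<close> a copy of the quotient by the right kernel with
    projection \<open>f\<close>. Intersecting with the left kernel makes \<open>A\<close> a quotient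
    of \<open>B\<close> by way of \<open>R\<close>.\<close>
  define K where "K = {x. (x, \<one>) \<in> R} \<inter> M"
  have K: "K \<in> levels" unfolding K_def by (rule level_Int(1)[OF corr_lker[OF R] M])
  let ?N = "{y. (\<one>, y) \<in> R}"
  obtain A :: "nat monoid" and f where A: "group A" "finite (carrier A)" "f \<in> continuous_epi G T A"
    and f: "\<And>x y. x \<in> carrier G \<Longrightarrow> y \<in> carrier G \<Longrightarrow> f x = f y \<longleftrightarrow> ?N #> x = ?N #> y"
    using level_epi[OF corr_rker[OF R]] by blast
  obtain B :: "nat monoid" and k where B: "group B" "finite (carrier B)" "k \<in> continuous_epi G T B"
    and k: "\<And>x y. x \<in> carrier G \<Longrightarrow> y \<in> carrier G \<Longrightarrow> k x = k y \<longleftrightarrow> K #> x = K #> y"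
    using level_epi[OF K] by blast
  interpret A: group A by fact
  interpret B: group B by fact
  have fh: "f \<in> hom G A" "f ` carrier G = carrier A" and kh: "k \<in> hom G B" "k ` carrier G = carrier B"
    using A B by (auto simp: continuous_epi_def epi_def)
  interpret f: group_hom G A f by unfold_locales fact
  interpret k: group_hom G B k by unfold_locales fact
  \<comment> \<open>\<open>g\<close> projects \<open>G/K\<close> to the quotient by the left kernel
    and then applies the isomorphism given by \<open>R\<close>. It is well defined because
    \<open>K\<close> lies in the left kernel.\<close>
  define g where "g b = f (SOME y. \<exists>x \<in> carrier G. k x = b \<and> (x, y) \<in> R)" for b
  have g: "g (k x) = f y" if xy: "(x, y) \<in> R" for x y
  proof -
    have G: "x \<in> carrier G" "y \<in> carrier G" using corr_carrier[OF R xy] by auto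
    let ?y = "SOME y. \<exists>x' \<in> carrier G. k x' = k x \<and> (x', y) \<in> R"
    have "\<exists>x' \<in> carrier G. k x' = k x \<and> (x', ?y) \<in> R"
      by (rule someI[where x = y]) (use xy G in blast)
    then obtain x' where x': "x' \<in> carrier G" "k x' = k x" "(x', ?y) \<in> R" by blast
    have yG: "?y \<in> carrier G" using corr_carrier[OF R x'(3)] by simp
    have "K #> x' = K #> x" using k x' G by blast
    then have "x' \<otimes> inv x \<in> K"
      using rcos_self[OF x'(1) level_subgroup[OF K]] mem_rcoset_iff[OF level_subgroup[OF K] G(1)] by simp
    then have 1: "(x' \<otimes> inv x, \<one>) \<in> R" by (simp add: K_def)
    have 2: "(x' \<otimes> inv x, ?y \<otimes> inv y) \<in> R" using corr_mult[OF R x'(3) corr_inv[OF R xy]] .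
    have "(inv (x' \<otimes> inv x) \<otimes> (x' \<otimes> inv x), inv \<one> \<otimes> (?y \<otimes> inv y)) \<in> R"
      using corr_mult[OF R corr_inv[OF R 1] 2] .
    then have "?y \<otimes> inv y \<in> ?N" using x' G yG by simp
    then have "?y \<in> ?N #> y" using mem_rcoset_iff[OF level_subgroup[OF corr_rker[OF R]] G(2)] yG by simp
    then have "?N #> y = ?N #> ?y" by (rule repr_independence[OF _ G(2) level_subgroup[OF corr_rker[OF R]]])
    then show ?thesis using f[OF yG G(2)] by (simp add: g_def)
  qed
  have lift: "\<exists>x y. (x, y) \<in> R \<and> b = k x" if b: "b \<in> carrier B" for b
  proof -
    obtain x where "x \<in> carrier G" "b = k x" using b kh(2) by blast
    then show ?thesis using corr_total[OF R] by blast
  qed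
  have "g \<in> epi B A"
  proof -
    have "g b \<in> carrier A" if "b \<in> carrier B" for b
      using lift[OF that] g corr_carrier[OF R] by auto
    moreover have "g (b \<otimes>\<^bsub>B\<^esub> b') = g b \<otimes>\<^bsub>A\<^esub> g b'" if bB: "b \<in> carrier B" and b'B: "b' \<in> carrier B" for b b'
    proof -
      obtain x y where p: "(x, y) \<in> R" "b = k x" using lift[OF bB] by blast
      obtain x' y' where q: "(x', y') \<in> R" "b' = k x'" using lift[OF b'B] by blast
      have G: "x \<in> carrier G" "x' \<in> carrier G" "y \<in> carrier G" "y' \<in> carrier G"
        using corr_carrier[OF R p(1)] corr_carrier[OF R q(1)] by auto
      have "b \<otimes>\<^bsub>B\<^esub> b' = k (x \<otimes> x')" using p q G by simp
      then have "g (b \<otimes>\<^bsub>B\<^esub> b') = f (y \<otimes> y')" using g[OF corr_mult[OF R p(1) q(1)]] by simp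
      then show ?thesis using p q g[OF p(1)] g[OF q(1)] G by simp
    qed
    moreover have "carrier A \<subseteq> g ` carrier B"
    proof
      fix a assume "a \<in> carrier A"
      then obtain y where "y \<in> carrier G" "a = f y" using fh(2) by blast
      moreover from this obtain x where "(x, y) \<in> R" using corr_onto[OF R] by blast
      ultimately have "a = g (k x)" "k x \<in> carrier B" using g[of x y] corr_carrier[OF R, of x y] by auto
      then show "a \<in> g ` carrier B" by blast
    qed
    ultimately show ?thesis by (auto simp: epi_def hom_def)
  qed
  \<comment> \<open>Here \<open>k\<close> serves as the given epimorphism onto \<open>B\<close>. The
    new epimorphism \<open>h\<close> lifts \<open>f\<close> through \<open>g\<close>.\<close>
  then obtain h where h: "h \<in> continuous_epi G T B" "\<And>x. x \<in> carrier G \<Longrightarrow> f x = g (h x)"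
    using embedding A B unfolding embedding_property_def by meson
  have hh: "h \<in> hom G B" "h ` carrier G = carrier B" using h by (auto simp: continuous_epi_def epi_def)
  interpret h: group_hom G B h by unfold_locales fact
  \<comment> \<open>The fibre product of \<open>k\<close> and \<open>h\<close> has left kernel
    \<open>K\<close>, which lies in \<open>M\<close>. It is contained in \<open>R\<close> because
    \<open>g (k x)\<close> describes the right-hand coset belonging to \<open>x\<close> and
    \<open>f\<close> equals \<open>g\<close> after \<open>h\<close>.\<close>
  define R' where "R' = {(x, y). x \<in> carrier G \<and> y \<in> carrier G \<and> k x = h y}"
  have "{x. (x, \<one>) \<in> R'} = {x \<in> carrier G. k x = \<one>\<^bsub>B\<^esub>}" "{y. (\<one>, y) \<in> R'} = {y \<in> carrier G. h y = \<one>\<^bsub>B\<^esub>}"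
    by (auto simp: R'_def)
  then have l: "{x. (x, \<one>) \<in> R'} \<in> levels" "{y. (\<one>, y) \<in> R'} \<in> levels"
    using continuous_epi_kernel_level[OF B] continuous_epi_kernel_level[OF B(1,2) h(1)] by auto
  have "\<exists>y. (x, y) \<in> R'" if "x \<in> carrier G" for x
  proof -
    have "k x \<in> h ` carrier G" using hh(2) that by simp
    then show ?thesis using that by (auto simp: R'_def)
  qed
  moreover have "\<exists>x. (x, y) \<in> R'" if "y \<in> carrier G" for y
  proof -
    have "h y \<in> k ` carrier G" using kh(2) that by simp
    then show ?thesis using that by (auto simp: R'_def)
  qed
  moreover have "R' \<subseteq> carrier G \<times> carrier G"
    "\<And>x y x' y'. (x, y) \<in> R' \<Longrightarrow> (x', y') \<in> R' \<Longrightarrow> (x \<otimes> x', y \<otimes> y') \<in> R'"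
    "\<And>x y. (x, y) \<in> R' \<Longrightarrow> (inv x, inv y) \<in> R'"
    by (auto simp: R'_def)
  ultimately have 1: "corr R'" using l unfolding corr_def by (auto simp: subset_iff Domain_iff Range_iff)
  have 2: "R' \<subseteq> R"
  proof safe
    fix x y assume "(x, y) \<in> R'"
    then have xy: "x \<in> carrier G" "y \<in> carrier G" "k x = h y" by (auto simp: R'_def)
    obtain z where z: "(x, z) \<in> R" using corr_total[OF R xy(1)] by blast
    then have zG: "z \<in> carrier G" using corr_carrier[OF R] by blast
    have "f y = f z" using h(2)[OF xy(2)] g[OF z] xy(3) by simp
    then have "?N #> y = ?N #> z" using f xy zG by blast
    then have "y \<otimes> inv z \<in> ?N"
      using rcos_self[OF xy(2) level_subgroup[OF corr_rker[OF R]]] mem_rcoset_iff[OF level_subgroup[OF corr_rker[OF R]] zG] by simp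
    then have "(\<one> \<otimes> x, y \<otimes> inv z \<otimes> z) \<in> R" using corr_mult[OF R _ z] by blast
    then show "(x, y) \<in> R" using xy zG by (simp add: m_assoc)
  qed
  have "{x. (x, \<one>) \<in> R'} \<subseteq> M"
  proof
    fix x assume "x \<in> {x. (x, \<one>) \<in> R'}"
    then have "x \<in> carrier G" "k x = k \<one>" by (auto simp: R'_def)
    then have "K #> x = K #> \<one>" using k by blast
    then have "K #> x = K" using subgroup.subset[OF level_subgroup[OF K]] by simp
    then show "x \<in> M" using rcos_eq_self_iff[OF level_subgroup[OF K] \<open>x \<in> carrier G\<close>] by (simp add: K_def)
  qed
  then show thesis using that 1 2 by blast
qed

text \<open>The "forth" half of back-and-forth, for finitely many elements at once: after shrinking
  the correspondence below all subgroups occurring in \<open>F\<close>, every member of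
  \<open>F\<close> has an image. "Back" follows through \<open>sim_converse\<close>.\<close>

lemma sim_extend:
  assumes P: "sim P" and F: "finite F" "F \<subseteq> elems"
  obtains h where "sim (P \<union> (\<lambda>\<alpha>. (\<alpha>, h \<alpha>)) ` F)"
proof -
  obtain R where R: "corr R" "\<And>\<alpha> \<beta>. (\<alpha>, \<beta>) \<in> P \<Longrightarrow> mv R \<alpha> \<beta>" and Pe: "P \<subseteq> elems \<times> elems"
    using P unfolding sim_def by blast
  have "carrier G \<inter> \<Inter>(fst ` F) \<in> levels" using F elem_level by (intro levels_Inter) auto
  then obtain R' where R': "corr R'" "R' \<subseteq> R" "{x. (x, \<one>) \<in> R'} \<subseteq> carrier G \<inter> \<Inter>(fst ` F)"
    using corr_refine[OF R(1)] by blast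
  define h where "h \<alpha> = (R' `` fst \<alpha>, R' `` snd \<alpha>)" for \<alpha>
  have "h \<alpha> \<in> elems" "mv R' \<alpha> (h \<alpha>)" if "\<alpha> \<in> F" for \<alpha>
    unfolding h_def using corr_image_elem[OF R'(1), of \<alpha>] that F R'(3) by auto
  moreover have "mv R' \<alpha> \<beta>" if "(\<alpha>, \<beta>) \<in> P" for \<alpha> \<beta>
    using R(2)[OF that] R'(2) unfolding mv_def by blast
  ultimately have "sim (P \<union> (\<lambda>\<alpha>. (\<alpha>, h \<alpha>)) ` F)"
    using Pe F by (intro simI[OF _ R'(1)]) auto
  then show thesis using that by blast
qed

end

context profinite_group
begin

section \<open>The complete system as a structure and the invariance of its atomic relations\<close>

abbreviation "S \<equiv> complete_system G T"

lemma sort_dom_iff: "\<alpha> \<in> sort_dom S n \<longleftrightarrow> \<alpha> \<in> elems \<and> card (rcosets (fst \<alpha>)) \<le> n"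
  by (cases \<alpha>) (auto simp: complete_system_def cs_univ_def elems_def levels_def FactGroup_def)

lemma universe_eq: "universe S = elems"
  by (auto simp: universe_def sort_dom_iff)

lemma elems_cs_univ: "elems \<subseteq> cs_univ G T"
  by (auto simp: elems_def cs_univ_def levels_def FactGroup_def)

lemma rel_int_eq: "set us \<subseteq> elems \<Longrightarrow> rel_int S r us \<longleftrightarrow> cs_rel_int G r us"
  using elems_cs_univ by (auto simp: complete_system_def)

lemma one_elem: "(carrier G, carrier G) \<in> elems"
  using carrier_level subgroup_self by (auto simp: elems_def RCOSETS_def coset_join2 intro!: bexI[where x = \<one>])

lemma const_int_eq: "const_int S c = (carrier G, carrier G)"
  by (simp add: complete_system_def)

lemma mv_one: "corr R \<Longrightarrow> mv R (carrier G, carrier G) (carrier G, carrier G)"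
  using corr_carrier by (auto simp: mv_def)

lemma tuples_elems: "us \<in> tuples S ss \<Longrightarrow> set us \<subseteq> elems"
  using tuples_subset_universe[of us S ss] by (simp add: universe_eq)

lemma mv_rel:
  assumes R: "corr R" and us: "list_all2 (\<lambda>\<alpha> \<beta>. \<alpha> \<in> elems \<and> \<beta> \<in> elems \<and> mv R \<alpha> \<beta>) us vs"
    and rel: "rel_int S r us"
  shows "rel_int S r vs"
proof -
  have e: "set us \<subseteq> elems" "set vs \<subseteq> elems" unfolding subset_eq all_set_conv_all_nth using us by (simp_all add: list_all2_conv_all_nth)
  have rel': "cs_rel_int G r us" using rel rel_int_eq e by simp
  have "cs_rel_int G r vs"
  proof (cases r)
    case R_le
    then obtain \<alpha> \<beta> where 1: "us = [\<alpha>, \<beta>]" "fst \<alpha> \<subseteq> fst \<beta>"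
      using rel' by (cases "(G, r, us)" rule: cs_rel_int.cases) auto
    then obtain \<alpha>' \<beta>' where 2: "vs = [\<alpha>', \<beta>']" using us by (auto simp: list_all2_Cons1)
    then have "fst \<alpha>' \<subseteq> fst \<beta>'" using mv_le(1)[OF R, of \<alpha> \<beta> \<alpha>' \<beta>'] us 1 by simp
    then show ?thesis using R_le 2 by (cases \<alpha>', cases \<beta>') simp
  next
    case R_C
    then obtain \<alpha> \<beta> where 1: "us = [\<alpha>, \<beta>]" "snd \<alpha> \<subseteq> snd \<beta>"
      using rel' by (cases "(G, r, us)" rule: cs_rel_int.cases) auto
    then obtain \<alpha>' \<beta>' where 2: "vs = [\<alpha>', \<beta>']" using us by (auto simp: list_all2_Cons1)
    then have "snd \<alpha>' \<subseteq> snd \<beta>'" using mv_le(2)[OF R, of \<alpha> \<beta> \<alpha>' \<beta>'] us 1 by simp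
    then show ?thesis using R_C 2 by (cases \<alpha>', cases \<beta>') simp
  next
    case R_P
    then obtain \<alpha> \<beta> \<gamma> where 1: "us = [\<alpha>, \<beta>, \<gamma>]" "fst \<alpha> = fst \<beta>" "fst \<beta> = fst \<gamma>" "snd \<alpha> <#> snd \<beta> = snd \<gamma>"
      using rel' by (cases "(G, r, us)" rule: cs_rel_int.cases) auto
    then obtain \<alpha>' \<beta>' \<gamma>' where 2: "vs = [\<alpha>', \<beta>', \<gamma>']" using us by (auto simp: list_all2_Cons1)
    have "fst \<alpha>' = fst \<beta>'" "fst \<beta>' = fst \<gamma>'" "snd \<alpha>' <#> snd \<beta>' = snd \<gamma>'"
      using mv_le(3)[OF R, of \<alpha> \<beta> \<alpha>' \<beta>'] mv_le(3)[OF R, of \<beta> \<gamma> \<beta>' \<gamma>'] mv_mult[OF R, of \<alpha> \<beta> \<gamma> \<alpha>' \<beta>' \<gamma>'] us 1 2 by simp_all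
    then show ?thesis using R_P 2 by (cases \<alpha>', cases \<beta>', cases \<gamma>') simp
  qed
  then show ?thesis using rel_int_eq e by simp
qed

lemma sim_elems: "sim P \<Longrightarrow> (\<alpha>, \<beta>) \<in> P \<Longrightarrow> \<alpha> \<in> elems \<and> \<beta> \<in> elems"
  unfolding sim_def by blast

lemma sim_corr: "sim P \<Longrightarrow> \<exists>R. corr R \<and> (\<forall>\<alpha> \<beta>. (\<alpha>, \<beta>) \<in> P \<longrightarrow> mv R \<alpha> \<beta> \<and> \<alpha> \<in> elems \<and> \<beta> \<in> elems)"
  unfolding sim_def by (elim conjE exE) (rule exI, rule conjI, assumption, blast)

lemma sim_card:
  assumes "sim P" "(\<alpha>, \<beta>) \<in> P" shows "card (rcosets (fst \<alpha>)) = card (rcosets (fst \<beta>))"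
proof -
  obtain R where "corr R" "mv R \<alpha> \<beta>" using sim_corr[OF assms(1)] assms(2) by blast
  then show ?thesis using mv_card sim_elems[OF assms] by blast
qed

lemma sim_sort_dom: "sim P \<Longrightarrow> (\<alpha>, \<beta>) \<in> P \<Longrightarrow> \<alpha> \<in> sort_dom S n \<longleftrightarrow> \<beta> \<in> sort_dom S n"
  using sim_elems sim_card sort_dom_iff by auto

lemma
  assumes sim: "sim P" and P: "(\<alpha>, \<alpha>') \<in> P" "(\<beta>, \<beta>') \<in> P"
  shows sim_fst_le: "fst \<alpha> \<subseteq> fst \<beta> \<longleftrightarrow> fst \<alpha>' \<subseteq> fst \<beta>'"
    and sim_fst_eq: "fst \<alpha> = fst \<beta> \<longleftrightarrow> fst \<alpha>' = fst \<beta>'"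
    and sim_eq: "\<alpha> = \<beta> \<longleftrightarrow> \<alpha>' = \<beta>'"
proof -
  obtain R where R: "corr R" "mv R \<alpha> \<alpha>'" "mv R \<beta> \<beta>'" using sim_corr[OF sim] P by blast
  have e: "\<alpha> \<in> elems" "\<beta> \<in> elems" "\<alpha>' \<in> elems" "\<beta>' \<in> elems"
    using sim_elems[OF sim P(1)] sim_elems[OF sim P(2)] by auto
  note * = mv_le[OF R(1) e R(2,3)]
  show "fst \<alpha> \<subseteq> fst \<beta> \<longleftrightarrow> fst \<alpha>' \<subseteq> fst \<beta>'" "fst \<alpha> = fst \<beta> \<longleftrightarrow> fst \<alpha>' = fst \<beta>'" "\<alpha> = \<beta> \<longleftrightarrow> \<alpha>' = \<beta>'"
    using * by simp_all
qed

lemma sim_tuples: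
  assumes "sim P" "length us = length vs" "set (zip us vs) \<subseteq> P" "us \<in> tuples S ss"
  shows "vs \<in> tuples S ss"
proof -
  have "vs ! i \<in> sort_dom S (ss ! i)" if "i < length ss" for i
  proof -
    have "(us ! i, vs ! i) \<in> set (zip us vs)" using that assms(2) tuples_length[OF assms(4)] by (auto simp: in_set_zip)
    then show ?thesis using sim_sort_dom[OF assms(1), of "us ! i" "vs ! i"] tuples_nth[OF assms(4) that] assms(3) by blast
  qed
  then show ?thesis using assms(2) tuples_length[OF assms(4)] by (simp add: tuples_def list_all2_conv_all_nth)
qed

end

context embedding_group
begin

lemma sim_extend_elem:
  assumes "sim P" "\<alpha> \<in> elems"
  obtains \<beta> where "sim (insert (\<alpha>, \<beta>) P)"
proof -
  obtain h where "sim (P \<union> (\<lambda>\<beta>. (\<beta>, h \<beta>)) ` {\<alpha>})" using sim_extend[OF assms(1), of "{\<alpha>}"] assms(2) by auto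
  then show thesis using that[of "h \<alpha>"] by simp
qed

lemma sim_extend_tuple:
  assumes "sim P" "a \<in> tuples S ss"
  obtains a' where "a' \<in> tuples S ss" "sim (P \<union> set (zip a a'))"
proof -
  obtain h where h: "sim (P \<union> (\<lambda>\<beta>. (\<beta>, h \<beta>)) ` set a)"
    using sim_extend[OF assms(1), of "set a"] tuples_elems[OF assms(2)] by auto
  have "map h a \<in> tuples S ss" by (rule sim_tuples[OF h _ _ assms(2)]) (auto simp: set_zip_map)
  then show thesis using that h by (simp add: set_zip_map)
qed

text \<open>Partial isomorphisms are elementary. Atoms are preserved by a single correspondence, and
  a quantifier is handled by the extension property; the witness keeps its sort because the index of
  its subgroup is preserved.\<close>

lemma sat_sim:
  assumes "sim ((\<lambda>x. (v x, v' x)) ` fv \<phi>)"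
  shows "sat S v \<phi> \<longleftrightarrow> sat S v' \<phi>"
  using assms
proof (induction \<phi> arbitrary: v v')
  case (Eq t u)
  obtain R where R1: "corr R"
    and R2: "\<forall>\<alpha> \<beta>. (\<alpha>, \<beta>) \<in> (\<lambda>x. (v x, v' x)) ` (fv_trm t \<union> fv_trm u) \<longrightarrow> mv R \<alpha> \<beta> \<and> \<alpha> \<in> elems \<and> \<beta> \<in> elems"
    using sim_corr[OF Eq[unfolded fv.simps]] by blast
  have R: "mv R (v x) (v' x) \<and> v x \<in> elems \<and> v' x \<in> elems" if "x \<in> fv_trm t \<union> fv_trm u" for x
    using R2[rule_format, of "v x" "v' x"] that by (meson imageI)
  have t: "mv R (trm_val S v s) (trm_val S v' s) \<and> trm_val S v s \<in> elems \<and> trm_val S v' s \<in> elems" if "s \<in> {t, u}" for s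
    using R that mv_one[OF R1] one_elem by (cases s) (auto simp: const_int_eq)
  show ?case using mv_le(4)[OF R1] t by simp
next
  case (Rel r ts)
  obtain R where R1: "corr R"
    and R2: "\<forall>\<alpha> \<beta>. (\<alpha>, \<beta>) \<in> (\<lambda>x. (v x, v' x)) ` (\<Union>t \<in> set ts. fv_trm t) \<longrightarrow> mv R \<alpha> \<beta> \<and> \<alpha> \<in> elems \<and> \<beta> \<in> elems"
    using sim_corr[OF Rel[unfolded fv.simps]] by blast
  have R: "mv R (v x) (v' x) \<and> v x \<in> elems \<and> v' x \<in> elems" if "x \<in> (\<Union>t \<in> set ts. fv_trm t)" for x
    using R2[rule_format, of "v x" "v' x"] that by (meson imageI)
  have t: "mv R (trm_val S v s) (trm_val S v' s) \<and> trm_val S v s \<in> elems \<and> trm_val S v' s \<in> elems" if "s \<in> set ts" for s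
  proof (cases s)
    case (Var x)
    then have "x \<in> (\<Union>t \<in> set ts. fv_trm t)" using that by force
    then show ?thesis using R Var by simp
  qed (use mv_one[OF R1] one_elem in \<open>simp add: const_int_eq\<close>)
  have 1: "list_all2 (\<lambda>\<alpha> \<beta>. \<alpha> \<in> elems \<and> \<beta> \<in> elems \<and> mv R \<alpha> \<beta>) (map (trm_val S v) ts) (map (trm_val S v') ts)"
    using t by (simp add: list_all2_conv_all_nth)
  have "mv (R\<inverse>) \<beta> \<alpha>" if "mv R \<alpha> \<beta>" for \<alpha> \<beta> using that by (auto simp: mv_def)
  then have 2: "list_all2 (\<lambda>\<alpha> \<beta>. \<alpha> \<in> elems \<and> \<beta> \<in> elems \<and> mv (R\<inverse>) \<alpha> \<beta>) (map (trm_val S v') ts) (map (trm_val S v) ts)"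
    using 1 unfolding list_all2_conv_all_nth by auto
  show ?case using mv_rel[OF R1 1] mv_rel[OF corr_converse[OF R1] 2] by auto
next
  case (Neg \<phi>)
  then have "sat S v \<phi> \<longleftrightarrow> sat S v' \<phi>" by simp
  then show ?case by simp
next
  case (Conj \<phi>1 \<phi>2)
  have "sat S v \<phi>1 \<longleftrightarrow> sat S v' \<phi>1" by (rule Conj.IH(1)) (rule sim_mono[OF Conj.prems], auto)
  moreover have "sat S v \<phi>2 \<longleftrightarrow> sat S v' \<phi>2" by (rule Conj.IH(2)) (rule sim_mono[OF Conj.prems], auto)
  ultimately show ?case by simp
next
  case (Exs s x \<phi>)
  \<comment> \<open>One implication is proved for arbitrary valuations; exchanging them by
    \<open>sim_converse\<close> yields the other.\<close>
  have *: "sat S v' (Exs s x \<phi>)" if sim: "sim ((\<lambda>x. (v x, v' x)) ` fv (Exs s x \<phi>))" and "sat S v (Exs s x \<phi>)" for v v'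
  proof -
    obtain a where a: "a \<in> sort_dom S s" "sat S (v(x := a)) \<phi>" using \<open>sat S v (Exs s x \<phi>)\<close> by auto
    then obtain a' where h: "sim (insert (a, a') ((\<lambda>x. (v x, v' x)) ` fv (Exs s x \<phi>)))"
      using sim_extend_elem[OF sim, of a] sort_dom_iff by auto
    have "sim ((\<lambda>y. ((v(x := a)) y, (v'(x := a')) y)) ` fv \<phi>)"
      by (rule sim_mono[OF h]) auto
    then have "sat S (v'(x := a')) \<phi>" using Exs.IH a by blast
    moreover have "a' \<in> sort_dom S s" using sim_sort_dom[OF h, of a a'] a by simp
    ultimately show ?thesis by auto
  qed
  have "((\<lambda>x. (v x, v' x)) ` fv (Exs s x \<phi>))\<inverse> = (\<lambda>x. (v' x, v x)) ` fv (Exs s x \<phi>)" by auto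
  then show ?case using *[OF Exs.prems] *[of v' v] sim_converse[OF Exs.prems] by auto
qed

lemma sat_sim_list:
  assumes "sim P" "length us = length vs" "set (zip us vs) \<subseteq> P" "fv \<phi> \<subseteq> {..<length us}"
  shows "sat S ((!) us) \<phi> \<longleftrightarrow> sat S ((!) vs) \<phi>"
  by (rule sat_sim, rule sim_mono[OF assms(1)]) (use assms in \<open>force simp: set_zip\<close>)

end

section \<open>Definability of invariant relations\<close>

context profinite_group
begin

text \<open>Matching positions gives a surjection between two finite groups that respects products,
  hence a homomorphism; the equality pattern makes it injective. The identity and the inverses are
  recovered from products alone.\<close>

lemma corr_enum:
  assumes N: "N \<in> levels" and N': "N' \<in> levels" and len: "length c' = length c"
    and c: "set c = {N} \<times> rcosets N" and c': "set c' = {N'} \<times> rcosets N'"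
    and eq: "\<And>i j. i < length c \<Longrightarrow> j < length c \<Longrightarrow> c ! i = c ! j \<longleftrightarrow> c' ! i = c' ! j"
    and mult: "\<And>i j k. i < length c \<Longrightarrow> j < length c \<Longrightarrow> k < length c \<Longrightarrow>
      snd (c ! i) <#> snd (c ! j) = snd (c ! k) \<Longrightarrow> snd (c' ! i) <#> snd (c' ! j) = snd (c' ! k)"
  shows "corr {(x, y). x \<in> carrier G \<and> y \<in> carrier G \<and> (\<exists>i < length c. c ! i = (N, N #> x) \<and> c' ! i = (N', N' #> y))}"
    (is "corr ?R")
proof -
  interpret N: normal N G using N level_normal by blast
  interpret N': normal N' G using N' level_normal by blast
  have ex: "\<exists>i < length c. c ! i = (N, N #> x)" if "x \<in> carrier G" for x
  proof -
    have "(N, N #> x) \<in> set c" using that c by (auto simp: RCOSETS_def)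
    then show ?thesis by (simp add: in_set_conv_nth)
  qed
  have ex': "\<exists>i < length c. c' ! i = (N', N' #> x)" if "x \<in> carrier G" for x
  proof -
    have "(N', N' #> x) \<in> set c'" using that c' by (auto simp: RCOSETS_def)
    then show ?thesis using len by (simp add: in_set_conv_nth)
  qed
  have form: "\<exists>x \<in> carrier G. c ! i = (N, N #> x)" "\<exists>x \<in> carrier G. c' ! i = (N', N' #> x)" if "i < length c" for i
  proof -
    have "c ! i \<in> {N} \<times> rcosets N" "c' ! i \<in> {N'} \<times> rcosets N'" using that len c c' nth_mem by metis+
    then show "\<exists>x \<in> carrier G. c ! i = (N, N #> x)" "\<exists>x \<in> carrier G. c' ! i = (N', N' #> x)"
      by (auto simp: RCOSETS_def)
  qed
  have sub: "?R \<subseteq> carrier G \<times> carrier G" by auto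
  have tot: "\<exists>y. (x, y) \<in> ?R" if "x \<in> carrier G" for x using ex[OF that] form(2) that by blast
  have onto: "\<exists>x. (x, y) \<in> ?R" if "y \<in> carrier G" for y using ex'[OF that] form(1) that by blast
  have mul: "(x \<otimes> x', y \<otimes> y') \<in> ?R" if xy: "(x, y) \<in> ?R" "(x', y') \<in> ?R" for x y x' y'
  proof -
    obtain i where i: "i < length c" "c ! i = (N, N #> x)" "c' ! i = (N', N' #> y)" using xy by blast
    obtain j where j: "j < length c" "c ! j = (N, N #> x')" "c' ! j = (N', N' #> y')" using xy by blast
    have G: "x \<in> carrier G" "x' \<in> carrier G" "y \<in> carrier G" "y' \<in> carrier G" using xy by auto
    obtain k where k: "k < length c" "c ! k = (N, N #> (x \<otimes> x'))" using ex[of "x \<otimes> x'"] G by auto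
    have "snd (c ! i) <#> snd (c ! j) = snd (c ! k)" using i j k G by (simp add: N.rcos_sum)
    then have "snd (c' ! i) <#> snd (c' ! j) = snd (c' ! k)" using mult i j k by blast
    then have "snd (c' ! k) = N' #> (y \<otimes> y')" using i j G by (simp add: N'.rcos_sum)
    moreover have "fst (c' ! k) = N'" using form(2)[OF k(1)] by auto
    ultimately have "c' ! k = (N', N' #> (y \<otimes> y'))" by (simp add: prod_eq_iff)
    then show ?thesis using k G by auto
  qed
  \<comment> \<open>The coset of \<open>\<one>\<close> is idempotent, hence so is its partner, and
    the only idempotent of a group is the identity.\<close>
  have one: "z \<in> N'" if z: "(\<one>, z) \<in> ?R" for z
  proof -
    obtain i where i: "i < length c" "c ! i = (N, N #> \<one>)" "c' ! i = (N', N' #> z)" using z by blast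
    have G: "z \<in> carrier G" using z by auto
    have "snd (c ! i) <#> snd (c ! i) = snd (c ! i)" using i N.rcos_sum[of \<one> \<one>] by simp
    then have "snd (c' ! i) <#> snd (c' ! i) = snd (c' ! i)" using mult i by blast
    then have "N' #> (z \<otimes> z) = N' #> z" using i G by (simp add: N'.rcos_sum)
    then have "z \<otimes> z \<in> N' #> z" using rcos_self[OF _ N'.is_subgroup, of "z \<otimes> z"] G by simp
    then have "z \<otimes> z \<otimes> inv z \<in> N'" using mem_rcoset_iff[OF N'.is_subgroup G] by simp
    then show ?thesis using G by (simp add: m_assoc)
  qed
  have inv: "(inv x, inv y) \<in> ?R" if xy: "(x, y) \<in> ?R" for x y
  proof -
    have G: "x \<in> carrier G" "y \<in> carrier G" using xy by auto
    obtain w where w: "(inv x, w) \<in> ?R" using tot G by blast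
    have wG: "w \<in> carrier G" using w by auto
    have "(\<one>, y \<otimes> w) \<in> ?R" using mul[OF xy w] G by simp
    then have "y \<otimes> w \<in> N'" by (rule one)
    then have "inv y \<otimes> (y \<otimes> w) \<otimes> y \<in> N'" using N'.inv_op_closed1 G by blast
    then have "w \<otimes> y \<in> N'" using G wG by (simp add: m_assoc[symmetric])
    then have "w \<in> N' #> inv y" using mem_rcoset_iff[OF N'.is_subgroup, of "inv y"] G wG by simp
    then have "N' #> inv y = N' #> w" by (rule repr_independence[OF _ _ N'.is_subgroup]) (use G in simp)
    then show ?thesis using w G by auto
  qed
  have "(\<one>, \<one>) \<in> ?R"
  proof -
    obtain y where y: "(\<one>, y) \<in> ?R" using tot[OF one_closed] by blast
    then have "(inv \<one>, inv y) \<in> ?R" by (rule inv)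
    then have "(\<one> \<otimes> inv \<one>, y \<otimes> inv y) \<in> ?R" using mul[OF y] by blast
    then show ?thesis using y by auto
  qed
  then obtain i0 where i0: "i0 < length c" "c ! i0 = (N, N)" "c' ! i0 = (N', N')"
    using N.subset N'.subset by auto
  have "{x. (x, \<one>) \<in> ?R} = N"
  proof (intro equalityI subsetI)
    fix x assume "x \<in> {x. (x, \<one>) \<in> ?R}"
    then obtain i where i: "i < length c" "c ! i = (N, N #> x)" "c' ! i = (N', N')" "x \<in> carrier G" using N'.subset by auto
    then have "c ! i = c ! i0" using eq[OF i(1) i0(1)] i0(3) by simp
    then show "x \<in> N" using i i0 rcos_eq_self_iff[OF N.is_subgroup] by simp
  next
    fix x assume "x \<in> N"
    then have "N #> x = N" "x \<in> carrier G" using rcos_eq_self_iff[OF N.is_subgroup] N.mem_carrier by auto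
    then show "x \<in> {x. (x, \<one>) \<in> ?R}" using i0 N'.subset by auto
  qed
  moreover have "{y. (\<one>, y) \<in> ?R} = N'"
  proof (intro equalityI subsetI)
    fix y assume "y \<in> N'"
    then have "N' #> y = N'" "y \<in> carrier G" using rcos_eq_self_iff[OF N'.is_subgroup] N'.mem_carrier by auto
    then show "y \<in> {y. (\<one>, y) \<in> ?R}" using i0 N.subset by auto
  qed (use one in blast)
  ultimately have ker: "{x. (x, \<one>) \<in> ?R} \<in> levels" "{y. (\<one>, y) \<in> ?R} \<in> levels" using N N' by simp_all
  show ?thesis unfolding corr_def
  proof (intro conjI allI impI)
    show "carrier G \<subseteq> Domain ?R" using tot by (meson Domain.DomainI subsetI)
    show "carrier G \<subseteq> Range ?R" using onto by (meson Range.intros subsetI)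
  next
    fix x y x' y' assume "(x, y) \<in> ?R \<and> (x', y') \<in> ?R"
    then show "(x \<otimes> x', y \<otimes> y') \<in> ?R" using mul by blast
  next
    fix x y assume "(x, y) \<in> ?R"
    then show "(inv x, inv y) \<in> ?R" by (rule inv)
  qed (rule sub ker)+
qed

text \<open>Turns membership of a point into an inclusion of cosets, which the relation
  \<open>R_C\<close> can express.\<close>

lemma rcos_subset_elem_iff:
  assumes \<alpha>: "\<alpha> \<in> elems" and N: "N \<in> levels" "N \<subseteq> fst \<alpha>" and x: "x \<in> carrier G"
  shows "N #> x \<subseteq> snd \<alpha> \<longleftrightarrow> x \<in> snd \<alpha>"
proof
  assume "N #> x \<subseteq> snd \<alpha>"
  then show "x \<in> snd \<alpha>" using rcos_self[OF x level_subgroup[OF N(1)]] by blast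
next
  assume xa: "x \<in> snd \<alpha>"
  show "N #> x \<subseteq> snd \<alpha>"
  proof
    fix y assume "y \<in> N #> x"
    then have "y \<in> carrier G" "y \<otimes> inv x \<in> N" using mem_rcoset_iff[OF level_subgroup[OF N(1)] x] by auto
    then show "y \<in> snd \<alpha>" using elem_rcos(3)[OF \<alpha> xa] N(2) by blast
  qed
qed

section \<open>Conjugacy of tuples read off from atomic formulas\<close>

lemma rel_elems:
  assumes "\<alpha> \<in> elems" "\<beta> \<in> elems"
  shows rel_le: "rel_int S R_le [\<alpha>, \<beta>] \<longleftrightarrow> fst \<alpha> \<subseteq> fst \<beta>"
    and rel_C: "rel_int S R_C [\<alpha>, \<beta>] \<longleftrightarrow> snd \<alpha> \<subseteq> snd \<beta>"
    and rel_P: "\<gamma> \<in> elems \<Longrightarrow> rel_int S R_P [\<alpha>, \<beta>, \<gamma>] \<longleftrightarrow> fst \<alpha> = fst \<beta> \<and> fst \<beta> = fst \<gamma> \<and> snd \<alpha> <#> snd \<beta> = snd \<gamma>"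
  using assms by (cases \<alpha>; cases \<beta>; cases \<gamma>; simp add: rel_int_eq)+

definition atoms :: "nat \<Rightarrow> (nat, cs_const, cs_rel) fm list" where
  "atoms m = [Eq (Var i) (Var j). i \<leftarrow> [0..<m], j \<leftarrow> [0..<m]] @
     [Rel R_le [Var i, Var j]. i \<leftarrow> [0..<m], j \<leftarrow> [0..<m]] @
     [Rel R_C [Var i, Var j]. i \<leftarrow> [0..<m], j \<leftarrow> [0..<m]] @
     [Rel R_P [Var i, Var j, Var k]. i \<leftarrow> [0..<m], j \<leftarrow> [0..<m], k \<leftarrow> [0..<m]]"

lemma atoms_mem:
  assumes "i < m" "j < m"
  shows "Eq (Var i) (Var j) \<in> set (atoms m)" "Rel R_le [Var i, Var j] \<in> set (atoms m)" "Rel R_C [Var i, Var j] \<in> set (atoms m)"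
    "k < m \<Longrightarrow> Rel R_P [Var i, Var j, Var k] \<in> set (atoms m)"
  using assms by (auto simp: atoms_def image_iff)

lemma fv_atoms: "\<phi> \<in> set (atoms m) \<Longrightarrow> fv \<phi> \<subseteq> {..<m}"
  by (auto simp: atoms_def)

lemma rcosets_nonempty: "subgroup N G \<Longrightarrow> N \<in> rcosets N"
  by (metis coset_mult_one one_closed rcosetsI subgroup.subset)

text \<open>\<open>c\<close> enumerates a quotient that lies below all entries of \<open>a\<close>.
  The atoms among \<open>c\<close> and \<open>c'\<close> make \<open>c'\<close> an enumeration of an
  isomorphic quotient, and the inclusions of those cosets in the entries of \<open>a\<close> and
  \<open>a'\<close> show that the isomorphism takes \<open>a\<close> to \<open>a'\<close>.\<close>

lemma sim_of_atoms:
  assumes a: "a \<in> tuples S ss" "a' \<in> tuples S ss" and N: "N \<in> levels" "\<And>\<alpha>. \<alpha> \<in> set a \<Longrightarrow> N \<subseteq> fst \<alpha>"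
    and c: "set c = {N} \<times> rcosets N" "length c = n" "n = card (rcosets N)"
    and c': "c' \<in> tuples S (replicate n n)"
    and at: "\<And>\<phi>. \<phi> \<in> set (atoms (length ss + n)) \<Longrightarrow> sat S ((!) (a @ c)) \<phi> \<longleftrightarrow> sat S ((!) (a' @ c')) \<phi>"
  shows "sim (set (zip a a'))"
proof -
  let ?l = "length ss" and ?A = "a @ c" and ?A' = "a' @ c'"
  have l: "length a = ?l" "length a' = ?l" "length c' = n" using tuples_length[OF a(1)] tuples_length[OF a(2)] tuples_length[OF c'] by auto
  have ce: "set c \<subseteq> elems" using c N by (auto simp: elems_def)
  have e: "?A ! i \<in> elems" "?A' ! i \<in> elems" if "i < ?l + n" for i
  proof -
    have "?A ! i \<in> set ?A" "?A' ! i \<in> set ?A'" using that l c by (auto intro!: nth_mem simp del: set_append)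
    then show "?A ! i \<in> elems" "?A' ! i \<in> elems"
      using tuples_elems[OF a(1)] tuples_elems[OF a(2)] tuples_elems[OF c'] ce by auto
  qed
  have eq: "?A ! i = ?A ! j \<longleftrightarrow> ?A' ! i = ?A' ! j"
    and le: "fst (?A ! i) \<subseteq> fst (?A ! j) \<longleftrightarrow> fst (?A' ! i) \<subseteq> fst (?A' ! j)"
    and C: "snd (?A ! i) \<subseteq> snd (?A ! j) \<longleftrightarrow> snd (?A' ! i) \<subseteq> snd (?A' ! j)"
    if "i < ?l + n" "j < ?l + n" for i j
    using at[OF atoms_mem(1)[OF that]] at[OF atoms_mem(2)[OF that]] at[OF atoms_mem(3)[OF that]]
      rel_le[OF e(1) e(1), OF that] rel_le[OF e(2) e(2), OF that] rel_C[OF e(1) e(1), OF that] rel_C[OF e(2) e(2), OF that]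
    by simp_all
  have P: "rel_int S R_P [?A ! i, ?A ! j, ?A ! k] \<longleftrightarrow> rel_int S R_P [?A' ! i, ?A' ! j, ?A' ! k]"
    if "i < ?l + n" "j < ?l + n" "k < ?l + n" for i j k
    using at[OF atoms_mem(4)[OF that]] by simp
  have A: "?A ! (?l + i) = c ! i" "?A' ! (?l + i) = c' ! i" for i using l by (simp_all add: nth_append)
  have Aa: "?A ! i = a ! i" "?A' ! i = a' ! i" if "i < ?l" for i using that l by (simp_all add: nth_append)
  have ci: "c ! i \<in> elems" "c' ! i \<in> elems" if "i < n" for i
    using e[of "?l + i"] that unfolding A by simp_all
  have fc: "fst (c ! i) = N" if "i < n" for i
    using c that nth_mem[of i c] by (metis mem_Sigma_iff prod.collapse singletonD)
  have n0: "0 < n" using c(3) rcosets_nonempty[OF level_subgroup[OF N(1)]] level_finite[OF N(1)] card_gt_0_iff by auto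
  define N' where "N' = fst (c' ! 0)"
  have c0e: "c' ! 0 \<in> sort_dom S n" using tuples_nth[OF c', of 0] n0 by simp
  have N': "N' \<in> levels" "card (rcosets N') \<le> n"
    using c0e elem_level unfolding N'_def sort_dom_iff by auto
  have fc': "fst (c' ! i) = N'" if "i < n" for i
    using le[of "?l + i" "?l"] le[of "?l" "?l + i"] that n0 fc[OF that] fc[OF n0] A[of i] A[of 0] by (auto simp: N'_def)
  have ceq: "c ! i = c ! j \<longleftrightarrow> c' ! i = c' ! j" if "i < n" "j < n" for i j
    using eq[of "?l + i" "?l + j"] that by (simp add: A)
  \<comment> \<open>The sort bounds the order of \<open>G/N'\<close> by \<open>n\<close> from above.
    The \<open>n\<close> distinct entries of \<open>c'\<close> bound it from below, so they exhaust
    it.\<close>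
  have "distinct c" using c card_distinct[of c] by (simp add: card_cartesian_product)
  then have "distinct c'" using ceq l c by (simp add: distinct_conv_nth)
  then have card: "card (set c') = n" using distinct_card l by auto
  have "set c' \<subseteq> {N'} \<times> rcosets N'"
  proof
    fix \<beta> assume "\<beta> \<in> set c'"
    then obtain i where i: "i < n" "\<beta> = c' ! i" using l by (auto simp: in_set_conv_nth)
    have "\<beta> \<in> elems" using tuples_elems[OF c'] \<open>\<beta> \<in> set c'\<close> by blast
    then show "\<beta> \<in> {N'} \<times> rcosets N'" using fc'[OF i(1)] i by (auto simp: elems_def)
  qed
  then have c'set: "set c' = {N'} \<times> rcosets N'"
    using card_seteq[of "{N'} \<times> rcosets N'" "set c'"] N' card level_finite[OF N'(1)] by (simp add: card_cartesian_product)
  define R where "R = {(x, y). x \<in> carrier G \<and> y \<in> carrier G \<and> (\<exists>i < length c. c ! i = (N, N #> x) \<and> c' ! i = (N', N' #> y))}"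
  have R: "corr R" unfolding R_def
  proof (rule corr_enum[OF N(1) N'(1)])
    fix i j k assume ijk: "i < length c" "j < length c" "k < length c" "snd (c ! i) <#> snd (c ! j) = snd (c ! k)"
    then have "rel_int S R_P [c ! i, c ! j, c ! k]"
      using rel_P[OF ci(1) ci(1) ci(1), of i j k] fc[of i] fc[of j] fc[of k] c(2) by simp
    then have "rel_int S R_P [c' ! i, c' ! j, c' ! k]" using P[of "?l + i" "?l + j" "?l + k"] ijk c by (simp add: A)
    then show "snd (c' ! i) <#> snd (c' ! j) = snd (c' ! k)"
      using rel_P[OF ci(2) ci(2) ci(2), of i j k] ijk c(2) by simp
  qed (use l c c'set ceq in auto)
  show ?thesis
  proof (rule simI[OF _ R])
    show "set (zip a a') \<subseteq> elems \<times> elems"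
      using tuples_elems[OF a(1)] tuples_elems[OF a(2)] by (auto dest: set_zip_leftD set_zip_rightD)
    fix \<alpha> \<beta> assume "(\<alpha>, \<beta>) \<in> set (zip a a')"
    then obtain i where i: "i < ?l" "\<alpha> = a ! i" "\<beta> = a' ! i" using l by (auto simp: in_set_zip)
    have \<alpha>: "\<alpha> \<in> elems" "\<beta> \<in> elems" using e[of i] i Aa by auto
    have N\<alpha>: "N \<subseteq> fst \<alpha>" using N(2) i l by simp
    have N\<beta>: "N' \<subseteq> fst \<beta>" using le[of "?l + 0" i] i n0 N\<alpha> fc[OF n0] unfolding A N'_def by (simp add: Aa)
    show "mv R \<alpha> \<beta>" unfolding mv_def
    proof (intro allI impI)
      fix x y assume "(x, y) \<in> R"
      then obtain j where j: "j < n" "c ! j = (N, N #> x)" "c' ! j = (N', N' #> y)" "x \<in> carrier G" "y \<in> carrier G"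
        using c by (auto simp: R_def)
      have "snd (c ! j) \<subseteq> snd (a ! i) \<longleftrightarrow> snd (c' ! j) \<subseteq> snd (a' ! i)"
        using C[of "?l + j" i] j i unfolding A by (simp add: Aa)
      then show "x \<in> snd \<alpha> \<longleftrightarrow> y \<in> snd \<beta>"
        using rcos_subset_elem_iff[OF \<alpha>(1) N(1) N\<alpha> j(4)] rcos_subset_elem_iff[OF \<alpha>(2) N'(1) N\<beta> j(5)] j i by simp
    qed
  qed
qed

text \<open>The index bound depends on the sorts alone; it is what keeps the set \<open>L\<close> of
  formulas in \<open>invariant_definable\<close> finite.\<close>

lemma common_level:
  assumes "a \<in> tuples S ss"
  shows "\<exists>N \<in> levels. (\<forall>\<alpha> \<in> set a. N \<subseteq> fst \<alpha>) \<and> card (rcosets N) \<le> prod_list ss"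
  using assms
proof (induction ss arbitrary: a)
  case Nil
  have "rcosets (carrier G) = {carrier G}"
    by (auto simp: RCOSETS_def coset_join2 subgroup_self)
  then show ?case using Nil carrier_level by (intro bexI[of _ "carrier G"]) auto
next
  case (Cons s ss)
  then obtain \<alpha> b where a: "a = \<alpha> # b" "\<alpha> \<in> sort_dom S s" "b \<in> tuples S ss" by (auto simp: tuples_Cons)
  obtain N where N: "N \<in> levels" "\<forall>\<alpha> \<in> set b. N \<subseteq> fst \<alpha>" "card (rcosets N) \<le> prod_list ss" using Cons.IH[OF a(3)] by blast
  have \<alpha>: "fst \<alpha> \<in> levels" "card (rcosets (fst \<alpha>)) \<le> s" using a(2) elem_level unfolding sort_dom_iff by auto
  have "card (rcosets (fst \<alpha> \<inter> N)) \<le> s * prod_list ss"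
    using level_Int(2)[OF \<alpha>(1) N(1)] mult_le_mono[OF \<alpha>(2) N(3)] by linarith
  then show ?case using level_Int(1)[OF \<alpha>(1) N(1)] N(2) a(1) by (intro bexI[of _ "fst \<alpha> \<inter> N"]) auto
qed

definition invariant :: "nat list \<Rightarrow> (('a set \<times> 'a set) list \<Rightarrow> bool) \<Rightarrow> bool" where
  "invariant ss Q \<longleftrightarrow> (\<forall>a \<in> tuples S ss. \<forall>a' \<in> tuples S ss. Q a \<longrightarrow> sim (set (zip a a')) \<longrightarrow> Q a')"

text \<open>The formulas in \<open>L\<close> say that some tuple of length \<open>n\<close> realizes
  a given atomic diagram together with \<open>a\<close>. One of them describes an enumeration of a
  quotient below \<open>a\<close>, so agreement on \<open>L\<close> implies conjugacy by
  \<open>sim_of_atoms\<close>. Every invariant relation is then a Boolean combination of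
  \<open>L\<close>.\<close>

lemma invariant_definable:
  "\<exists>\<Phi>. finite \<Phi> \<and> (\<forall>\<psi> \<in> \<Phi>. fv \<psi> \<subseteq> {..<length ss}) \<and>
     (\<forall>Q. invariant ss Q \<longrightarrow> (\<exists>\<psi> \<in> \<Phi>. \<forall>a \<in> tuples S ss. sat S ((!) a) \<psi> \<longleftrightarrow> Q a))"
proof -
  let ?l = "length ss"
  define L where "L = (\<Union>n \<in> {..prod_list ss}. (\<lambda>p. exl ?l (replicate n n) (diag (atoms (?l + n)) p)) ` Pow (set (atoms (?l + n))))"
  have fv_diag: "fv (diag (atoms m) p) \<subseteq> {..<m}" for m p
    unfolding fv_diag using fv_atoms by blast
  have "finite L" by (simp add: L_def)
  moreover have "fv \<phi> \<subseteq> {..<?l}" if "\<phi> \<in> L" for \<phi>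
    using that fv_diag by (fastforce simp: L_def fv_exl)
  ultimately have "\<exists>\<Phi>. finite \<Phi> \<and> (\<forall>\<psi> \<in> \<Phi>. fv \<psi> \<subseteq> {..<?l}) \<and>
      (\<forall>D Q. (\<forall>v \<in> D. \<forall>v' \<in> D. Q v \<longrightarrow> (\<forall>\<phi> \<in> L. sat S v \<phi> \<longleftrightarrow> sat S v' \<phi>) \<longrightarrow> Q v') \<longrightarrow>
         (\<exists>\<psi> \<in> \<Phi>. \<forall>v \<in> D. sat S v \<psi> \<longleftrightarrow> Q v))"
    by (rule boolean_combinations)
  then obtain \<Phi> where \<Phi>: "finite \<Phi>" "\<forall>\<psi> \<in> \<Phi>. fv \<psi> \<subseteq> {..<?l}"
    and bool: "\<forall>D Q. (\<forall>v \<in> D. \<forall>v' \<in> D. Q v \<longrightarrow> (\<forall>\<phi> \<in> L. sat S v \<phi> \<longleftrightarrow> sat S v' \<phi>) \<longrightarrow> Q v') \<longrightarrow>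
       (\<exists>\<psi> \<in> \<Phi>. \<forall>v \<in> D. sat S v \<psi> \<longleftrightarrow> Q v)"
    by (elim exE conjE) (rule that)
  have "\<exists>\<psi> \<in> \<Phi>. \<forall>a \<in> tuples S ss. sat S ((!) a) \<psi> \<longleftrightarrow> Q a" if Q: "invariant ss Q" for Q
  proof -
    \<comment> \<open>\<open>boolean_combinations\<close> speaks of valuations. On lists of one
      fixed length \<open>(!)\<close> is injective, so \<open>Q\<close> can be read as a property of
      valuations.\<close>
    define Q' where "Q' v \<longleftrightarrow> (\<exists>a \<in> tuples S ss. v = (!) a \<and> Q a)" for v
    have inj: "a = a'" if "(!) a = (!) a'" "a \<in> tuples S ss" "a' \<in> tuples S ss" for a a'
      using that tuples_length by (metis nth_equalityI)
    have "Q a'" if a: "a \<in> tuples S ss" "a' \<in> tuples S ss" and "Q a" and same: "\<forall>\<phi> \<in> L. sat S ((!) a) \<phi> \<longleftrightarrow> sat S ((!) a') \<phi>" for a a'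
    proof -
      obtain N where N: "N \<in> levels" "\<forall>\<alpha> \<in> set a. N \<subseteq> fst \<alpha>" "card (rcosets N) \<le> prod_list ss"
        using common_level[OF a(1)] by blast
      define n where "n = card (rcosets N)"
      obtain c where c: "set c = {N} \<times> rcosets N" "distinct c"
        using finite_distinct_list[of "{N} \<times> rcosets N"] level_finite[OF N(1)] by auto
      have cn: "length c = n" using distinct_card[OF c(2)] c(1) by (simp add: n_def card_cartesian_product)
      have cS: "c \<in> tuples S (replicate n n)"
        using c cn N(1) by (auto simp: tuples_replicate sort_dom_iff elems_def n_def)
      define p where "p = {\<phi> \<in> set (atoms (?l + n)). sat S ((!) (a @ c)) \<phi>}"
      have la: "length a = ?l" "length a' = ?l" using a tuples_length by blast+
      have upd: "sat S (upd ((!) b) ?l d) (diag (atoms (?l + n)) p) \<longleftrightarrow> sat S ((!) (b @ d)) (diag (atoms (?l + n)) p)"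
        if "length b = ?l" "d \<in> tuples S (replicate n n)" for b d
        using sat_upd_append[of "diag (atoms (?l + n)) p" b d S] fv_diag that tuples_length[OF that(2)] by simp
      have "sat S ((!) (a @ c)) (diag (atoms (?l + n)) p)" unfolding sat_diag by (auto simp: p_def)
      then have "sat S ((!) a) (exl ?l (replicate n n) (diag (atoms (?l + n)) p))"
        unfolding sat_exl using upd[OF la(1) cS] cS by blast
      moreover have "exl ?l (replicate n n) (diag (atoms (?l + n)) p) \<in> L"
        using N(3) by (auto simp: L_def n_def p_def)
      ultimately have "sat S ((!) a') (exl ?l (replicate n n) (diag (atoms (?l + n)) p))" using same by blast
      then obtain c' where c': "c' \<in> tuples S (replicate n n)" "sat S ((!) (a' @ c')) (diag (atoms (?l + n)) p)"
        unfolding sat_exl using upd[OF la(2)] by blast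
      have "sim (set (zip a a'))"
        by (rule sim_of_atoms[OF a N(1) _ c(1) cn n_def c'(1)]) (use N(2) c'(2) in \<open>auto simp: sat_diag p_def\<close>)
      then show "Q a'" using Q a \<open>Q a\<close> unfolding invariant_def by blast
    qed
    then have "\<forall>v \<in> (!) ` tuples S ss. \<forall>v' \<in> (!) ` tuples S ss. Q' v \<longrightarrow> (\<forall>\<phi> \<in> L. sat S v \<phi> \<longleftrightarrow> sat S v' \<phi>) \<longrightarrow> Q' v'"
      unfolding Q'_def by blast
    from bool[THEN spec, THEN spec, THEN mp, OF this] obtain \<psi> where \<psi>: "\<psi> \<in> \<Phi>" "\<forall>v \<in> (!) ` tuples S ss. sat S v \<psi> \<longleftrightarrow> Q' v"
      by (elim bexE) (rule that)
    have "sat S ((!) a) \<psi> \<longleftrightarrow> Q a" if a: "a \<in> tuples S ss" for a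
    proof -
      have "Q' ((!) a) \<longleftrightarrow> Q a" unfolding Q'_def using inj[OF _ a] a by metis
      then show ?thesis using \<psi>(2) a by simp
    qed
    then show ?thesis using \<psi>(1) by blast
  qed
  then show ?thesis using \<Phi> by blast
qed

end

section \<open>Supports\<close>

context profinite_group
begin

definition class_id :: "'a set \<Rightarrow> (('a set \<times> 'a set) \<times> ('a set \<times> 'a set)) set" where
  "class_id N = Id_on ({N} \<times> rcosets N)"

lemma class_id_cosets:
  assumes R: "corr R" and N: "N \<in> levels" and mv: "\<And>\<alpha> \<beta>. (\<alpha>, \<beta>) \<in> class_id N \<Longrightarrow> mv R \<alpha> \<beta>" and xy: "(x, y) \<in> R"
  shows "N #> x = N #> y"
proof -
  have G: "x \<in> carrier G" using corr_carrier[OF R xy] by simp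
  then have "((N, N #> x), (N, N #> x)) \<in> class_id N" by (auto simp: class_id_def RCOSETS_def)
  then have "y \<in> N #> x" using mv xy rcos_self[OF G level_subgroup[OF N]] by (fastforce simp: mv_def)
  then show ?thesis by (rule repr_independence[OF _ G level_subgroup[OF N]])
qed

lemma mv_refl:
  assumes R: "corr R" and N: "N \<in> levels" and id: "\<And>x y. (x, y) \<in> R \<Longrightarrow> N #> x = N #> y"
    and \<alpha>: "\<alpha> \<in> elems" "N \<subseteq> fst \<alpha>"
  shows "mv R \<alpha> \<alpha>"
  unfolding mv_def
proof (intro allI impI)
  fix x y assume xy: "(x, y) \<in> R"
  then have "x \<in> carrier G" "y \<in> carrier G" using corr_carrier[OF R] by blast+
  then show "x \<in> snd \<alpha> \<longleftrightarrow> y \<in> snd \<alpha>"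
    using rcos_subset_elem_iff[OF \<alpha>(1) N \<alpha>(2)] id[OF xy] by metis
qed

lemma class_id_elems: "N \<in> levels \<Longrightarrow> class_id N \<subseteq> elems \<times> elems"
  by (auto simp: class_id_def elems_def)

text \<open>An isomorphism that fixes every element of \<open>G/N\<close> preserves all cosets of
  \<open>N\<close>, hence every coset of a larger subgroup.\<close>

lemma sim_class_id_mono:
  assumes sim: "sim (P \<union> class_id N)" and N: "N \<in> levels" and F: "F \<subseteq> elems" "\<And>\<alpha>. \<alpha> \<in> F \<Longrightarrow> N \<subseteq> fst \<alpha>"
  shows "sim (P \<union> Id_on F)"
proof -
  obtain R where R: "corr R" "\<forall>\<alpha> \<beta>. (\<alpha>, \<beta>) \<in> P \<union> class_id N \<longrightarrow> mv R \<alpha> \<beta> \<and> \<alpha> \<in> elems \<and> \<beta> \<in> elems"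
    using sim_corr[OF sim] by blast
  have id: "N #> x = N #> y" if "(x, y) \<in> R" for x y
    by (rule class_id_cosets[OF R(1) N _ that]) (use R(2) in blast)
  show ?thesis
  proof (rule simI[OF _ R(1)])
    show "P \<union> Id_on F \<subseteq> elems \<times> elems" using sim F(1) by (auto simp: sim_def)
    fix \<alpha> \<beta> assume "(\<alpha>, \<beta>) \<in> P \<union> Id_on F"
    then show "mv R \<alpha> \<beta>"
    proof
      assume "(\<alpha>, \<beta>) \<in> Id_on F"
      then have "\<alpha> = \<beta>" "\<alpha> \<in> F" by auto
      then show ?thesis using mv_refl[OF R(1) N id] F by blast
    qed (use R(2) in blast)
  qed
qed

text \<open>Repetitions are allowed so that one length serves all quotients of bounded order.\<close>

lemma enumeration_exists:
  assumes N: "N \<in> levels" and "card (rcosets N) \<le> B"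
  obtains c where "c \<in> tuples S (replicate B B)" "set c = {N} \<times> rcosets N"
proof -
  obtain xs where xs: "set xs = {N} \<times> rcosets N" "distinct xs"
    using finite_distinct_list[of "{N} \<times> rcosets N"] level_finite[OF N] by auto
  have len: "length xs = card (rcosets N)" using distinct_card[OF xs(2)] xs(1) by (simp add: card_cartesian_product)
  have "xs \<noteq> []" using xs(1) rcosets_nonempty[OF level_subgroup[OF N]] by auto
  then have hd: "hd xs \<in> set xs" by simp
  define c where "c = xs @ replicate (B - length xs) (hd xs)"
  have "set c = set xs" unfolding c_def set_append set_replicate_conv_if using hd by simp blast
  then have "set c = {N} \<times> rcosets N" using xs(1) by simp
  moreover have "length c = B" using len assms by (simp add: c_def)
  moreover have "{N} \<times> rcosets N \<subseteq> sort_dom S B" using assms by (auto simp: sort_dom_iff elems_def)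
  ultimately show thesis using that by (simp add: tuples_replicate)
qed

end

text \<open>\<open>\<kappa>\<close> stands for the class of a tuple. Only the relation
  \<open>\<kappa> a = \<kappa> b\<close> is asked to be invariant, so the type of the values is
  arbitrary; \<open>cls S \<sigma>\<close> is the intended instance.\<close>

locale invariant_map = embedding_group +
  fixes ss :: "nat list" and \<kappa> :: "('a set \<times> 'a set) list \<Rightarrow> 'k"
  assumes \<kappa>_invariant: "\<And>P a b a' b'. sim P \<Longrightarrow> a \<in> tuples S ss \<Longrightarrow> b \<in> tuples S ss \<Longrightarrow> a' \<in> tuples S ss \<Longrightarrow> b' \<in> tuples S ss \<Longrightarrow>
     set (zip a a') \<subseteq> P \<Longrightarrow> set (zip b b') \<subseteq> P \<Longrightarrow> \<kappa> a = \<kappa> b \<Longrightarrow> \<kappa> a' = \<kappa> b'"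
begin

text \<open>The test ranges over all \<open>b\<close> with the same value as \<open>a\<close>. Thus
  supports, and everything derived from them, depend on the class alone.\<close>

definition support :: "('a set \<times> 'a set) list \<Rightarrow> 'a set \<Rightarrow> bool" where
  "support a N \<longleftrightarrow> N \<in> levels \<and> (\<forall>b \<in> tuples S ss. \<forall>b' \<in> tuples S ss.
     \<kappa> b = \<kappa> a \<longrightarrow> sim (set (zip b b') \<union> class_id N) \<longrightarrow> \<kappa> b' = \<kappa> a)"

lemma supportD:
  "support a N \<Longrightarrow> b \<in> tuples S ss \<Longrightarrow> b' \<in> tuples S ss \<Longrightarrow> \<kappa> b = \<kappa> a \<Longrightarrow> sim (set (zip b b') \<union> class_id N) \<Longrightarrow> \<kappa> b' = \<kappa> a"
  unfolding support_def by (elim conjE) (drule (1) bspec, drule (1) bspec, simp only: simp_thms)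

text \<open>An isomorphism that is the identity on a quotient below all entries of \<open>a\<close>
  fixes \<open>a\<close> itself, hence its class.\<close>

lemma support_exists:
  assumes a: "a \<in> tuples S ss" shows "\<exists>N. support a N"
proof -
  obtain N where N: "N \<in> levels" "\<forall>\<alpha> \<in> set a. N \<subseteq> fst \<alpha>" using common_level[OF a] by blast
  have "\<kappa> b' = \<kappa> a" if b: "b \<in> tuples S ss" "b' \<in> tuples S ss" "\<kappa> b = \<kappa> a" "sim (set (zip b b') \<union> class_id N)" for b b'
  proof -
    have "sim (set (zip b b') \<union> set (zip a a))"
      unfolding set_zip_self by (rule sim_class_id_mono[OF b(4) N(1) tuples_elems[OF a]]) (use N(2) in blast)
    from \<kappa>_invariant[OF this b(1) a b(2) a _ _ b(3)] show ?thesis by simp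
  qed
  then show ?thesis using N(1) unfolding support_def by blast
qed

lemma support_mono:
  assumes sup: "support a N" and M: "M \<in> levels" "M \<subseteq> N" shows "support a M"
  unfolding support_def
proof (intro conjI M ballI impI)
  fix b b' assume b: "b \<in> tuples S ss" "b' \<in> tuples S ss" "\<kappa> b = \<kappa> a" "sim (set (zip b b') \<union> class_id M)"
  have N: "N \<in> levels" using sup by (simp add: support_def)
  have "sim (set (zip b b') \<union> class_id N)"
    unfolding class_id_def[of N] by (rule sim_class_id_mono[OF b(4) M(1)]) (use N M in \<open>auto simp: elems_def\<close>)
  then show "\<kappa> b' = \<kappa> a" using supportD[OF sup b(1-3)] by blast
qed

text \<open>The test for \<open>a'\<close> is conjugated: \<open>b\<close> and \<open>b1\<close> are
  pulled back along an extension of the isomorphism, the support of \<open>a\<close> is applied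
  there, and the result is pushed forward again.\<close>

lemma support_invariant:
  assumes sim: "sim P" and \<alpha>: "(\<alpha>, \<alpha>') \<in> P" and a: "a \<in> tuples S ss" "a' \<in> tuples S ss" "set (zip a a') \<subseteq> P"
    and sup: "support a (fst \<alpha>)"
  shows "support a' (fst \<alpha>')"
  unfolding support_def
proof (intro conjI ballI impI)
  let ?N = "fst \<alpha>" and ?N' = "fst \<alpha>'"
  have \<alpha>e: "\<alpha> \<in> elems" "\<alpha>' \<in> elems" using sim_elems[OF sim \<alpha>] by auto
  show N': "?N' \<in> levels" using elem_level[OF \<alpha>e(2)] .
  have N: "?N \<in> levels" using elem_level[OF \<alpha>e(1)] .
  fix b b1 assume b: "b \<in> tuples S ss" "b1 \<in> tuples S ss" "\<kappa> b = \<kappa> a'" "sim (set (zip b b1) \<union> class_id ?N')"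
  \<comment> \<open>All of \<open>G/N\<close> is given partners, where \<open>N\<close> is the
    subgroup of \<open>\<alpha>\<close>. By \<open>sim_fst_eq\<close> they lie in the quotient by
    the subgroup of \<open>\<alpha>'\<close>, so conjugation turns the identity there into the
    identity of \<open>G/N\<close>.\<close>
  define F where "F = {?N} \<times> rcosets ?N"
  have F: "finite F" "F \<subseteq> elems" using N level_finite by (auto simp: F_def elems_def)
  obtain h where h: "sim (P \<union> (\<lambda>\<beta>. (\<beta>, h \<beta>)) ` F)" using sim_extend[OF sim F] by blast
  define P1 where "P1 = P \<union> (\<lambda>\<beta>. (\<beta>, h \<beta>)) ` F"
  have "set b \<union> set b1 \<subseteq> elems" using tuples_elems[OF b(1)] tuples_elems[OF b(2)] by simp
  then obtain g where g: "sim (P1\<inverse> \<union> (\<lambda>\<beta>. (\<beta>, g \<beta>)) ` (set b \<union> set b1))"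
    using sim_extend[OF sim_converse[OF h[folded P1_def]], of "set b \<union> set b1"] by blast
  define Q where "Q = P1\<inverse> \<union> (\<lambda>\<beta>. (\<beta>, g \<beta>)) ` (set b \<union> set b1)"
  have Q: "sim Q" using g by (simp add: Q_def)
  have zb: "set (zip b (map g b)) \<subseteq> Q" "set (zip b1 (map g b1)) \<subseteq> Q" by (auto simp: set_zip_map Q_def)
  have za: "set (zip a' a) \<subseteq> Q"
    unfolding set_zip_converse[of a a', symmetric] using a(3) by (auto simp: Q_def P1_def)
  have gb: "map g b \<in> tuples S ss" "map g b1 \<in> tuples S ss"
    using sim_tuples[OF Q _ zb(1) b(1)] sim_tuples[OF Q _ zb(2) b(2)] by simp_all
  have "\<kappa> (map g b) = \<kappa> a" using \<kappa>_invariant[OF Q b(1) a(2) gb(1) a(1) zb(1) za b(3)] .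
  moreover have "sim (set (zip (map g b) (map g b1)) \<union> class_id ?N)"
  proof (rule sim_mono[OF sim_relcomp[OF sim_converse[OF Q] sim_relcomp[OF b(4) Q]]], rule Un_least)
    have l: "length b = length b1" using tuples_length[OF b(1)] tuples_length[OF b(2)] by simp
    show "set (zip (map g b) (map g b1)) \<subseteq> Q\<inverse> O (set (zip b b1) \<union> class_id ?N') O Q"
    proof
      fix \<beta> assume "\<beta> \<in> set (zip (map g b) (map g b1))"
      then obtain i where i: "i < length b" "\<beta> = (g (b ! i), g (b1 ! i))" using l by (auto simp: set_zip)
      have "(g (b ! i), b ! i) \<in> Q\<inverse>" "(b1 ! i, g (b1 ! i)) \<in> Q" using i l by (auto simp: Q_def)
      moreover have "(b ! i, b1 ! i) \<in> set (zip b b1)" using i l by (auto simp: set_zip)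
      ultimately show "\<beta> \<in> Q\<inverse> O (set (zip b b1) \<union> class_id ?N') O Q" using i by blast
    qed
    show "class_id ?N \<subseteq> Q\<inverse> O (set (zip b b1) \<union> class_id ?N') O Q"
    proof
      fix \<beta> assume "\<beta> \<in> class_id ?N"
      then obtain \<gamma> where \<gamma>: "\<gamma> \<in> F" "\<beta> = (\<gamma>, \<gamma>)" by (auto simp: class_id_def F_def)
      have in1: "(\<gamma>, h \<gamma>) \<in> P1" "(\<alpha>, \<alpha>') \<in> P1" using \<gamma> \<alpha> by (auto simp: P1_def)
      have "fst (h \<gamma>) = ?N'" using sim_fst_eq[OF h[folded P1_def] in1] \<gamma>(1) by (auto simp: F_def)
      moreover have "h \<gamma> \<in> elems" using sim_elems[OF h[folded P1_def] in1(1)] by simp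
      ultimately have "(h \<gamma>, h \<gamma>) \<in> class_id ?N'" by (cases "h \<gamma>") (auto simp: class_id_def elems_def)
      moreover have "(\<gamma>, h \<gamma>) \<in> Q\<inverse>" "(h \<gamma>, \<gamma>) \<in> Q" using in1(1) by (auto simp: Q_def)
      ultimately show "\<beta> \<in> Q\<inverse> O (set (zip b b1) \<union> class_id ?N') O Q" using \<gamma>(2) by blast
    qed
  qed
  ultimately have "\<kappa> (map g b1) = \<kappa> a" using supportD[OF sup gb] by blast
  moreover have "set (zip (map g b1) b1) \<subseteq> Q\<inverse>" "set (zip a a') \<subseteq> Q\<inverse>"
    using zb(2) za unfolding set_zip_converse[of b1 "map g b1", symmetric] set_zip_converse[of a' a, symmetric] by auto
  ultimately show "\<kappa> b1 = \<kappa> a'" using \<kappa>_invariant[OF sim_converse[OF Q] gb(2) a(1) b(2) a(2)] by blast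
qed

section \<open>Supports of minimal index and their intersection\<close>

definition min_index :: "('a set \<times> 'a set) list \<Rightarrow> nat" where
  "min_index a = (LEAST n. \<exists>N. support a N \<and> card (rcosets N) = n)"

definition min_supports :: "('a set \<times> 'a set) list \<Rightarrow> 'a set set" where
  "min_supports a = {N. support a N \<and> card (rcosets N) = min_index a}"

lemma min_index_le: "support a N \<Longrightarrow> min_index a \<le> card (rcosets N)"
  unfolding min_index_def by (rule Least_le) blast

lemma min_supports_nonempty:
  assumes "a \<in> tuples S ss" shows "min_supports a \<noteq> {}"
proof -
  have "\<exists>n N. support a N \<and> card (rcosets N) = n" using support_exists[OF assms] by blast
  from LeastI_ex[OF this] show ?thesis by (auto simp: min_supports_def min_index_def)
qed

lemma min_supports_levels: "min_supports a \<subseteq> levels"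
  by (auto simp: min_supports_def support_def)

text \<open>Otherwise a level above infinitely many minimal supports, and of maximal index with this
  property, is a support of smaller index: some minimal support below it is independent over it
  from any given isomorphism.\<close>

lemma finite_min_supports: "finite (min_supports a)"
proof (rule ccontr)
  assume inf: "infinite (min_supports a)"
  \<comment> \<open>\<open>carrier G\<close> contributes a member, and \<open>min_index a\<close> is
    an upper bound; therefore a level of maximal index in \<open>J\<close> can be chosen.\<close>
  define J where "J = {card (rcosets K) | K. K \<in> levels \<and> infinite {C \<in> min_supports a. C \<subseteq> K}}"
  have le: "card (rcosets K) \<le> card (rcosets C)" if "C \<in> min_supports a" "C \<subseteq> K" "K \<in> levels" for C K
    using card_rcosets_mono[OF _ that(3,2)] that(1) min_supports_levels by blast
  have "J \<subseteq> {..min_index a}"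
  proof
    fix j assume "j \<in> J"
    then obtain K where K: "j = card (rcosets K)" "K \<in> levels" "infinite {C \<in> min_supports a. C \<subseteq> K}" by (auto simp: J_def)
    then obtain C where C: "C \<in> min_supports a" "C \<subseteq> K" using infinite_imp_nonempty by blast
    then show "j \<in> {..min_index a}" using le[OF C K(2)] K(1) by (simp add: min_supports_def)
  qed
  then have finJ: "finite J" by (rule finite_subset) simp
  have "{C \<in> min_supports a. C \<subseteq> carrier G} = min_supports a"
    using min_supports_levels level_subgroup subgroup.subset by blast
  then have "card (rcosets (carrier G)) \<in> J" using inf carrier_level by (auto simp: J_def)
  then have MaxJ: "Max J \<in> J" using finJ by (intro Max_in) auto
  then obtain K where K: "card (rcosets K) = Max J" "K \<in> levels" and infK: "infinite {C \<in> min_supports a. C \<subseteq> K}"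
    by (auto simp: J_def)
  have "support a K" unfolding support_def
  proof (intro conjI K ballI impI)
    fix b b' assume b: "b \<in> tuples S ss" "b' \<in> tuples S ss" "\<kappa> b = \<kappa> a" and sim: "sim (set (zip b b') \<union> class_id K)"
    obtain R where R: "corr R" "\<forall>\<alpha> \<beta>. (\<alpha>, \<beta>) \<in> set (zip b b') \<union> class_id K \<longrightarrow> mv R \<alpha> \<beta> \<and> \<alpha> \<in> elems \<and> \<beta> \<in> elems"
      using sim_corr[OF sim] by blast
    have id: "K #> x = K #> y" if "(x, y) \<in> R" for x y
      by (rule class_id_cosets[OF R(1) K(2) _ that]) (use R(2) in blast)
    define M where "M = K \<inter> ({x. (x, \<one>) \<in> R} \<inter> {y. (\<one>, y) \<in> R})"
    have M: "M \<in> levels" unfolding M_def by (intro level_Int(1) K corr_lker[OF R(1)] corr_rker[OF R(1)])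
    \<comment> \<open>Each member of \<open>F\<close> is properly contained in \<open>K\<close> and
      so has larger index. By the choice of \<open>K\<close> it contains only finitely many minimal
      supports.\<close>
    define F where "F = {K' \<in> levels. M \<subseteq> K' \<and> K' \<subset> K}"
    have "finite F" by (rule finite_subset[OF _ finite_levels_above[OF M]]) (auto simp: F_def)
    moreover have "finite {C \<in> min_supports a. C \<subseteq> K'}" if "K' \<in> F" for K'
    proof (rule ccontr)
      assume "infinite {C \<in> min_supports a. C \<subseteq> K'}"
      moreover have K': "K' \<in> levels" "K' \<subset> K" using that by (auto simp: F_def)
      ultimately have "card (rcosets K') \<in> J" by (auto simp: J_def)
      then have "card (rcosets K') \<le> card (rcosets K)" using K(1) finJ by simp
      then have "K' = K" using card_rcosets_eqD[OF K'(1) K(2)] K'(2) by blast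
      then show False using K' by blast
    qed
    ultimately have "finite (\<Union>K' \<in> F. {C \<in> min_supports a. C \<subseteq> K'})" by blast
    then have "infinite ({C \<in> min_supports a. C \<subseteq> K} - (\<Union>K' \<in> F. {C \<in> min_supports a. C \<subseteq> K'}))"
      using infK by (rule Diff_infinite_finite)
    then have "{C \<in> min_supports a. C \<subseteq> K} - (\<Union>K' \<in> F. {C \<in> min_supports a. C \<subseteq> K'}) \<noteq> {}"
      by (rule infinite_imp_nonempty)
    then obtain C where "C \<in> {C \<in> min_supports a. C \<subseteq> K} - (\<Union>K' \<in> F. {C \<in> min_supports a. C \<subseteq> K'})"
      unfolding ex_in_conv[symmetric] ..
    then have C: "C \<in> min_supports a" "C \<subseteq> K" "\<And>K'. K' \<in> F \<Longrightarrow> \<not> C \<subseteq> K'" by simp_all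
    have Cl: "C \<in> levels" using C min_supports_levels by blast
    have "C <#> M \<subseteq> K"
      using C(2) subgroup.m_closed[OF level_subgroup[OF K(2)]] by (fastforce simp: set_mult_def M_def)
    moreover have "C <#> M \<notin> F" using C(3) level_setmult(2)[OF Cl M] by blast
    \<comment> \<open>Otherwise \<open>C <#> M\<close> would be a member of \<open>F\<close>
      containing \<open>C\<close>. The equality gives the independence assumed in
      \<open>corr_amalgam\<close>, because both kernels of \<open>R\<close> contain
      \<open>M\<close>.\<close>
    ultimately have CM: "C <#> M = K" using level_setmult[OF Cl M] by (auto simp: F_def)
    have mono: "K \<subseteq> C <#> L" if "M \<subseteq> L" for L using CM that by (force simp: set_mult_def)
    define R' where "R' = {(x, y) \<in> R. C #> x = C #> y}"
    have R': "corr R'" unfolding R'_def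
      by (rule corr_amalgam[OF R(1) Cl K(2) C(2) id mono mono]) (auto simp: M_def)
    have idC: "C #> x = C #> y" if "(x, y) \<in> R'" for x y using that by (simp add: R'_def)
    have "sim (set (zip b b') \<union> class_id C)"
    proof (rule simI[OF _ R'])
      show "set (zip b b') \<union> class_id C \<subseteq> elems \<times> elems" using sim class_id_elems[OF Cl] by (simp add: sim_def)
      fix \<alpha> \<beta> assume "(\<alpha>, \<beta>) \<in> set (zip b b') \<union> class_id C"
      then show "mv R' \<alpha> \<beta>"
      proof
        assume "(\<alpha>, \<beta>) \<in> set (zip b b')"
        then have "mv R \<alpha> \<beta>" using R(2) by blast
        then show ?thesis by (auto simp: mv_def R'_def)
      next
        assume "(\<alpha>, \<beta>) \<in> class_id C"
        then have "\<alpha> = \<beta>" "\<alpha> \<in> elems" "C \<subseteq> fst \<alpha>" using class_id_elems[OF Cl] by (auto simp: class_id_def)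
        then show ?thesis using mv_refl[OF R' Cl idC] by blast
      qed
    qed
    moreover have "support a C" using C(1) by (simp add: min_supports_def)
    ultimately show "\<kappa> b' = \<kappa> a" using supportD b by blast
  qed
  then have min: "min_index a \<le> card (rcosets K)" by (rule min_index_le)
  \<comment> \<open>Being a support, \<open>K\<close> has at least the minimal index. A minimal
    support inside \<open>K\<close> therefore has the index of \<open>K\<close> and equals
    it.\<close>
  have "{C \<in> min_supports a. C \<subseteq> K} \<subseteq> {K}"
  proof
    fix C assume C: "C \<in> {C \<in> min_supports a. C \<subseteq> K}"
    then have "card (rcosets C) \<le> card (rcosets K)" using min by (simp add: min_supports_def)
    then show "C \<in> {K}" using card_rcosets_eqD[OF _ K(2)] C min_supports_levels by blast
  qed
  then show False using infK finite_subset by blast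
qed

text \<open>The factor \<open>carrier G\<close> makes \<open>core a\<close> a level even if the
  family is empty, when the intersection alone would be the whole type.\<close>

definition core :: "('a set \<times> 'a set) list \<Rightarrow> 'a set" where
  "core a = carrier G \<inter> \<Inter>(min_supports a)"

lemma core_level: "core a \<in> levels"
  unfolding core_def by (rule levels_Inter[OF finite_min_supports min_supports_levels])

lemma core_support:
  assumes "a \<in> tuples S ss" shows "support a (core a)"
proof -
  obtain N where N: "N \<in> min_supports a" using min_supports_nonempty[OF assms] by blast
  then have "support a N" "core a \<subseteq> N" by (auto simp: min_supports_def core_def)
  then show ?thesis using support_mono core_level by blast
qed

lemma core_cong: "\<kappa> a = \<kappa> a' \<Longrightarrow> core a = core a'"
  unfolding core_def min_supports_def min_index_def support_def by simp

lemma core_greatest: "M \<in> levels \<Longrightarrow> M \<subseteq> core a \<longleftrightarrow> (\<forall>N \<in> min_supports a. M \<subseteq> N)"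
  unfolding core_def using level_subgroup subgroup.subset by blast

lemma level_elem: "N \<in> levels \<Longrightarrow> (N, N) \<in> elems"
  using rcosets_nonempty level_subgroup by (auto simp: elems_def)

lemma min_index_mono:
  assumes sim: "sim P" and a: "a \<in> tuples S ss" "a' \<in> tuples S ss" "set (zip a a') \<subseteq> P"
  shows "min_index a' \<le> min_index a"
proof -
  obtain N where N: "support a N" "card (rcosets N) = min_index a"
    using min_supports_nonempty[OF a(1)] by (auto simp: min_supports_def)
  have "(N, N) \<in> elems" using N(1) level_elem by (simp add: support_def)
  then obtain \<beta> where h: "sim (insert ((N, N), \<beta>) P)" by (rule sim_extend_elem[OF sim])
  have in1: "((N, N), \<beta>) \<in> insert ((N, N), \<beta>) P" by simp
  have "support a' (fst \<beta>)"
    by (rule support_invariant[OF h in1 a(1,2)]) (use a(3) N(1) in auto)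
  then show ?thesis using min_index_le sim_card[OF h in1] N(2) by fastforce
qed

lemma min_supports_invariant:
  assumes sim: "sim P" and \<alpha>: "(\<alpha>, \<alpha>') \<in> P" and a: "a \<in> tuples S ss" "a' \<in> tuples S ss" "set (zip a a') \<subseteq> P"
    and min: "fst \<alpha> \<in> min_supports a"
  shows "fst \<alpha>' \<in> min_supports a'"
proof -
  have "set (zip a' a) \<subseteq> P\<inverse>" using a(3) unfolding set_zip_converse[of a a', symmetric] by blast
  then have "min_index a = min_index a'"
    using min_index_mono[OF sim a] min_index_mono[OF sim_converse[OF sim] a(2,1)] by simp
  then show ?thesis using support_invariant[OF sim \<alpha> a] sim_card[OF sim \<alpha>] min by (simp add: min_supports_def)
qed

text \<open>Lying below the core means lying below each minimal support, and every minimal support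
  of \<open>a'\<close> is pulled back to one of \<open>a\<close>. Applying this in both directions
  gives the equality in \<open>core_invariant\<close>.\<close>

lemma core_lower_invariant:
  assumes sim: "sim P" and \<alpha>: "(\<alpha>, \<alpha>') \<in> P" and a: "a \<in> tuples S ss" "a' \<in> tuples S ss" "set (zip a a') \<subseteq> P"
    and le: "fst \<alpha> \<subseteq> core a"
  shows "fst \<alpha>' \<subseteq> core a'"
proof -
  have \<alpha>e: "fst \<alpha> \<in> levels" "fst \<alpha>' \<in> levels" using sim_elems[OF sim \<alpha>] elem_level by auto
  have "fst \<alpha>' \<subseteq> N" if N: "N \<in> min_supports a'" for N
  proof -
    have "(N, N) \<in> elems" using N level_elem min_supports_levels by blast
    then obtain \<beta> where h: "sim (insert ((N, N), \<beta>) (P\<inverse>))" (is "sim ?Q")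
      by (rule sim_extend_elem[OF sim_converse[OF sim]])
    have in1: "((N, N), \<beta>) \<in> ?Q" "(\<alpha>', \<alpha>) \<in> ?Q" using \<alpha> by auto
    have "set (zip a' a) \<subseteq> ?Q" using a(3) unfolding set_zip_converse[of a a', symmetric] by blast
    then have "fst \<beta> \<in> min_supports a"
      using min_supports_invariant[OF h in1(1) a(2,1)] N by simp
    then have "fst \<alpha> \<subseteq> fst \<beta>" using le core_greatest[OF \<alpha>e(1)] by blast
    then show ?thesis using sim_fst_le[OF h in1(2,1)] by simp
  qed
  then show ?thesis using core_greatest[OF \<alpha>e(2)] by blast
qed

lemma core_invariant:
  assumes sim: "sim P" and \<alpha>: "(\<alpha>, \<alpha>') \<in> P" and a: "a \<in> tuples S ss" "a' \<in> tuples S ss" "set (zip a a') \<subseteq> P"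
    and eq: "fst \<alpha> = core a"
  shows "fst \<alpha>' = core a'"
proof
  show "fst \<alpha>' \<subseteq> core a'" using core_lower_invariant[OF sim \<alpha> a] eq by simp
  let ?N = "core a'"
  have "(?N, ?N) \<in> elems" using level_elem core_level by blast
  then obtain \<beta> where h: "sim (insert ((?N, ?N), \<beta>) (P\<inverse>))" (is "sim ?Q")
    by (rule sim_extend_elem[OF sim_converse[OF sim]])
  have in1: "((?N, ?N), \<beta>) \<in> ?Q" "(\<alpha>', \<alpha>) \<in> ?Q" using \<alpha> by auto
  have "set (zip a' a) \<subseteq> ?Q" using a(3) unfolding set_zip_converse[of a a', symmetric] by blast
  then have "fst \<beta> \<subseteq> core a" using core_lower_invariant[OF h in1(1) a(2,1)] by simp
  then show "core a' \<subseteq> fst \<alpha>'" using sim_fst_le[OF h in1] eq by simp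
qed

lemma card_core_invariant:
  assumes sim: "sim (set (zip a a'))" and a: "a \<in> tuples S ss" "a' \<in> tuples S ss"
  shows "card (rcosets (core a)) = card (rcosets (core a'))"
proof -
  let ?N = "core a"
  have "(?N, ?N) \<in> elems" using level_elem core_level by blast
  then obtain \<beta> where h: "sim (insert ((?N, ?N), \<beta>) (set (zip a a')))" (is "sim ?Q")
    by (rule sim_extend_elem[OF sim])
  have in1: "((?N, ?N), \<beta>) \<in> ?Q" by simp
  have "fst \<beta> = core a'" using core_invariant[OF h in1 a] by auto
  then show ?thesis using sim_card[OF h in1] by simp
qed

text \<open>Counting in place of compactness: the conditions "index at most k" are invariant, so
  finitely many formulas define them all and one formula serves infinitely many k. Any such k bounds
  every index, since it defines the same set as some arbitrarily large number.\<close>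

lemma core_bounded: "\<exists>B. \<forall>a \<in> tuples S ss. card (rcosets (core a)) \<le> B"
proof -
  obtain \<Phi> where \<Phi>: "finite \<Phi>"
    "\<forall>Q. invariant ss Q \<longrightarrow> (\<exists>\<psi> \<in> \<Phi>. \<forall>a \<in> tuples S ss. sat S ((!) a) \<psi> \<longleftrightarrow> Q a)"
    using invariant_definable[of ss] by blast
  have "invariant ss (\<lambda>a. card (rcosets (core a)) \<le> k)" for k
    unfolding invariant_def using card_core_invariant by metis
  then have "\<forall>k. \<exists>\<psi> \<in> \<Phi>. \<forall>a \<in> tuples S ss. sat S ((!) a) \<psi> \<longleftrightarrow> card (rcosets (core a)) \<le> k" using \<Phi>(2) by blast
  then obtain f where f: "\<And>k. f k \<in> \<Phi>" "\<And>k a. a \<in> tuples S ss \<Longrightarrow> sat S ((!) a) (f k) \<longleftrightarrow> card (rcosets (core a)) \<le> k" by metis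
  have "finite (f ` (UNIV :: nat set))" using \<Phi>(1) f(1) by (meson finite_subset image_subsetI)
  then obtain k where k: "infinite {j. f j = f k}" using pigeonhole_infinite[of "UNIV :: nat set" f] by auto
  have "card (rcosets (core a)) \<le> k" if a: "a \<in> tuples S ss" for a
  proof -
    obtain j where j: "card (rcosets (core a)) < j" "f j = f k"
      using k unfolding infinite_nat_iff_unbounded by blast
    then show ?thesis using f(2)[OF a, of j] f(2)[OF a, of k] by simp
  qed
  then show ?thesis by blast
qed

text \<open>For an enumeration \<open>c0\<close> of \<open>G/core a0\<close>, the tuple \<open>c\<close> is a code of the class of \<open>a\<close> if together with
  some member of that class it is conjugate to \<open>a0\<close> and \<open>c0\<close>.\<close>

definition code :: "('a set \<times> 'a set) list \<Rightarrow> ('a set \<times> 'a set) list \<Rightarrow> ('a set \<times> 'a set) list \<Rightarrow> ('a set \<times> 'a set) list \<Rightarrow> bool" where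
  "code a0 c0 a c \<longleftrightarrow> (\<exists>a1 \<in> tuples S ss. \<kappa> a1 = \<kappa> a \<and> length c = length c0 \<and> sim (set (zip a1 a0) \<union> set (zip c c0)))"

lemma code_cong: "\<kappa> a = \<kappa> a' \<Longrightarrow> code a0 c0 a c \<longleftrightarrow> code a0 c0 a' c"
  by (simp add: code_def)

context
  fixes a0 c0
  assumes a0: "a0 \<in> tuples S ss" and c0: "set c0 = {core a0} \<times> rcosets (core a0)"
begin

text \<open>The isomorphism matches \<open>core a\<close> with \<open>core a0\<close>, so the
  entries matched with an enumeration of one quotient enumerate the other.\<close>

lemma set_code_aux:
  assumes a: "a \<in> tuples S ss" and len: "length c = length c0" and sim: "sim (set (zip a a0) \<union> set (zip c c0))"
  shows "set c = {core a} \<times> rcosets (core a)"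
proof (intro equalityI subsetI)
  fix \<gamma> assume "\<gamma> \<in> set c"
  then obtain i where i: "i < length c" "\<gamma> = c ! i" by (auto simp: in_set_conv_nth)
  have in1: "(c0 ! i, \<gamma>) \<in> (set (zip a a0) \<union> set (zip c c0))\<inverse>" using i len by (auto simp: in_set_zip)
  have "c0 ! i \<in> set c0" using i len by simp
  then have "fst (c0 ! i) = core a0" using c0 by auto
  moreover have "set (zip a0 a) \<subseteq> (set (zip a a0) \<union> set (zip c c0))\<inverse>"
    unfolding set_zip_converse[of a a0, symmetric] by blast
  ultimately have "fst \<gamma> = core a" using core_invariant[OF sim_converse[OF sim] in1 a0 a] by blast
  moreover have "\<gamma> \<in> elems" using sim_elems[OF sim_converse[OF sim] in1] by simp
  ultimately show "\<gamma> \<in> {core a} \<times> rcosets (core a)" by (cases \<gamma>) (simp add: elems_def)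
next
  fix \<gamma> assume "\<gamma> \<in> {core a} \<times> rcosets (core a)"
  then have \<gamma>: "\<gamma> \<in> elems" "fst \<gamma> = core a" using core_level by (auto simp: elems_def)
  obtain \<delta> where h: "sim (insert (\<gamma>, \<delta>) (set (zip a a0) \<union> set (zip c c0)))" (is "sim ?Q")
    by (rule sim_extend_elem[OF sim \<gamma>(1)])
  have in1: "(\<gamma>, \<delta>) \<in> ?Q" by simp
  have "fst \<delta> = core a0" using core_invariant[OF h in1 a a0 _ \<gamma>(2)] by auto
  moreover have "\<delta> \<in> elems" using sim_elems[OF h in1] by simp
  ultimately have "\<delta> \<in> set c0" unfolding c0 by (cases \<delta>) (simp add: elems_def)
  then obtain i where i: "i < length c" "\<delta> = c0 ! i" using len by (auto simp: in_set_conv_nth)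
  have in2: "(c ! i, c0 ! i) \<in> ?Q" using i len by (auto simp: in_set_zip)
  have "\<gamma> = c ! i" using sim_eq[OF h in1 in2] i(2) by simp
  then show "\<gamma> \<in> set c" using i(1) by simp
qed

lemma set_code:
  assumes "code a0 c0 a c" shows "set c = {core a} \<times> rcosets (core a)"
proof -
  obtain a1 where a1: "a1 \<in> tuples S ss" "\<kappa> a1 = \<kappa> a" "length c = length c0" "sim (set (zip a1 a0) \<union> set (zip c c0))"
    using assms unfolding code_def by blast
  show ?thesis using set_code_aux[OF a1(1,3,4)] core_cong[OF a1(2)] by simp
qed

text \<open>Composing one isomorphism with the converse of the other takes \<open>a1\<close> to
  \<open>a2\<close> and fixes all entries of \<open>c\<close>. These exhaust the quotient by
  \<open>core a1\<close>, and the core is a support.\<close>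

lemma code_eqD:
  assumes code: "code a0 c0 a c" "code a0 c0 a' c" shows "\<kappa> a = \<kappa> a'"
proof -
  obtain a1 where a1: "a1 \<in> tuples S ss" "\<kappa> a1 = \<kappa> a" "length c = length c0" "sim (set (zip a1 a0) \<union> set (zip c c0))"
    using code(1) unfolding code_def by blast
  obtain a2 where a2: "a2 \<in> tuples S ss" "\<kappa> a2 = \<kappa> a'" "sim (set (zip a2 a0) \<union> set (zip c c0))"
    using code(2) unfolding code_def by blast
  let ?P = "set (zip a1 a0) \<union> set (zip c c0)" and ?Q = "set (zip a2 a0) \<union> set (zip c c0)"
  have l: "length a1 = length a0" "length a0 = length a2"
    using tuples_length[OF a1(1)] tuples_length[OF a0] tuples_length[OF a2(1)] by simp_all
  have sim: "sim (?P O ?Q\<inverse>)" by (rule sim_relcomp[OF a1(4) sim_converse[OF a2(3)]])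
  have "set (zip a1 a2) \<subseteq> ?P O ?Q\<inverse>"
    using set_zip_relcomp[OF l] unfolding converse_Un set_zip_converse by blast
  moreover have "class_id (core a1) \<subseteq> ?P O ?Q\<inverse>"
  proof
    fix \<beta> assume "\<beta> \<in> class_id (core a1)"
    then obtain \<gamma> where "\<gamma> \<in> set c" "\<beta> = (\<gamma>, \<gamma>)" using set_code_aux[OF a1(1,3,4)] by (auto simp: class_id_def)
    moreover from this obtain i where i: "i < length c" "\<gamma> = c ! i" by (auto simp: in_set_conv_nth)
    moreover have "(c ! i, c0 ! i) \<in> set (zip c c0)" using i a1(3) by (auto simp: in_set_zip)
    ultimately show "\<beta> \<in> ?P O ?Q\<inverse>" by blast
  qed
  ultimately have "sim (set (zip a1 a2) \<union> class_id (core a1))" using sim_mono[OF sim] by blast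
  then have "\<kappa> a2 = \<kappa> a1" using supportD[OF core_support[OF a1(1)] a1(1) a2(1)] by blast
  then show ?thesis using a1(2) a2(2) by simp
qed

lemma code_iff: "code a0 c0 a c \<Longrightarrow> code a0 c0 a' c \<longleftrightarrow> \<kappa> a = \<kappa> a'"
  using code_eqD code_cong by blast

lemma code_self: "code a0 c0 a0 c0"
proof -
  have "set c0 \<subseteq> elems" unfolding c0 elems_def using core_level by auto
  then have "sim (Id_on (set a0 \<union> set c0))" using tuples_elems[OF a0] by (intro sim_refl) simp_all
  moreover have "set (zip a0 a0) \<union> set (zip c0 c0) \<subseteq> Id_on (set a0 \<union> set c0)" by (auto simp: set_zip_self)
  ultimately have "sim (set (zip a0 a0) \<union> set (zip c0 c0))" by (rule sim_mono)
  then show ?thesis unfolding code_def using a0 by (intro bexI[of _ a0] conjI) simp_all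
qed

text \<open>A code is witnessed by some member \<open>a1\<close> of the class, which
  \<open>P\<close> need not move. After an extension of \<open>P\<close> the image of
  \<open>a1\<close> witnesses the code of \<open>a'\<close>.\<close>

lemma code_invariant:
  assumes sim: "sim P" and a: "a \<in> tuples S ss" "a' \<in> tuples S ss" "set (zip a a') \<subseteq> P"
    and c: "length c = length c'" "set (zip c c') \<subseteq> P" and code: "code a0 c0 a c"
  shows "code a0 c0 a' c'"
proof -
  obtain a1 where a1: "a1 \<in> tuples S ss" "\<kappa> a1 = \<kappa> a" "length c = length c0" "sim (set (zip a1 a0) \<union> set (zip c c0))"
    using code unfolding code_def by blast
  obtain b where T: "b \<in> tuples S ss" and h: "sim (P \<union> set (zip a1 b))" (is "sim ?Q")
    by (rule sim_extend_tuple[OF sim a1(1)])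
  have z: "set (zip a1 b) \<subseteq> ?Q" "set (zip a a') \<subseteq> ?Q" using a(3) by auto
  have "\<kappa> b = \<kappa> a'" by (rule \<kappa>_invariant[OF h a1(1) a(1) T a(2) z a1(2)])
  moreover have "sim (set (zip b a0) \<union> set (zip c' c0))"
  proof (rule sim_mono[OF sim_relcomp[OF sim_converse[OF h] a1(4)]])
    have l: "length b = length a1" "length a1 = length a0" "length c' = length c"
      using tuples_length[OF a1(1)] tuples_length[OF a0] tuples_length[OF T] c by simp_all
    have "set (zip b a1) \<subseteq> ?Q\<inverse>" "set (zip c' c) \<subseteq> ?Q\<inverse>"
      using z(1) c(2) unfolding set_zip_converse[of a1, symmetric] set_zip_converse[of c, symmetric] by auto
    then show "set (zip b a0) \<union> set (zip c' c0) \<subseteq> ?Q\<inverse> O (set (zip a1 a0) \<union> set (zip c c0))"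
      using set_zip_relcomp[OF l(1,2)] set_zip_relcomp[OF l(3) a1(3)] by blast
  qed
  ultimately show ?thesis unfolding code_def using T a1(3) c(1) by auto
qed

end

end

context profinite_group
begin

section \<open>The finite group of an element and the automorphisms given by its
  enumerations\<close>

lemma sim_class_eq:
  assumes "\<alpha> \<in> elems" shows "sim_class S \<alpha> = {fst \<alpha>} \<times> rcosets (fst \<alpha>)"
proof -
  have "\<beta> \<in> sim_class S \<alpha> \<longleftrightarrow> \<beta> \<in> elems \<and> fst \<beta> = fst \<alpha>" for \<beta>
    using rel_le[OF assms, of \<beta>] rel_le[OF _ assms, of \<beta>] by (auto simp: sim_class_def universe_eq)
  then show ?thesis using elem_level[OF assms] by (force simp: elems_def)
qed

lemma class_group_mult:
  assumes \<alpha>: "\<alpha> \<in> elems" and \<beta>: "\<beta> \<in> sim_class S \<alpha>" "\<gamma> \<in> sim_class S \<alpha>"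
  shows "\<beta> \<otimes>\<^bsub>class_group S \<alpha>\<^esub> \<gamma> = (fst \<alpha>, snd \<beta> <#> snd \<gamma>)"
proof -
  interpret N: normal "fst \<alpha>" G using level_normal[OF elem_level[OF \<alpha>]] .
  have e: "\<delta> \<in> elems" "fst \<delta> = fst \<alpha>" "snd \<delta> \<in> rcosets (fst \<alpha>)" if "\<delta> \<in> sim_class S \<alpha>" for \<delta>
    using that elem_level[OF \<alpha>] unfolding sim_class_eq[OF \<alpha>] by (auto simp: elems_def)
  have in1: "(fst \<alpha>, snd \<beta> <#> snd \<gamma>) \<in> sim_class S \<alpha>"
    unfolding sim_class_eq[OF \<alpha>] using N.setmult_closed e(3)[OF \<beta>(1)] e(3)[OF \<beta>(2)] by simp
  have iff: "rel_int S R_P [\<beta>, \<gamma>, \<delta>] \<longleftrightarrow> snd \<beta> <#> snd \<gamma> = snd \<delta>" if "\<delta> \<in> sim_class S \<alpha>" for \<delta>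
    using rel_P[OF e(1)[OF \<beta>(1)] e(1)[OF \<beta>(2)] e(1)[OF that]] e(2)[OF \<beta>(1)] e(2)[OF \<beta>(2)] e(2)[OF that] by simp
  have "(THE \<delta>. \<delta> \<in> sim_class S \<alpha> \<and> rel_int S R_P [\<beta>, \<gamma>, \<delta>]) = (fst \<alpha>, snd \<beta> <#> snd \<gamma>)"
  proof (rule the_equality)
    show "(fst \<alpha>, snd \<beta> <#> snd \<gamma>) \<in> sim_class S \<alpha> \<and> rel_int S R_P [\<beta>, \<gamma>, (fst \<alpha>, snd \<beta> <#> snd \<gamma>)]"
      using in1 iff[OF in1] by simp
    fix \<delta> assume "\<delta> \<in> sim_class S \<alpha> \<and> rel_int S R_P [\<beta>, \<gamma>, \<delta>]"
    then show "\<delta> = (fst \<alpha>, snd \<beta> <#> snd \<gamma>)" using iff[of \<delta>] e(2)[of \<delta>] by (simp add: prod_eq_iff)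
  qed
  then show ?thesis by (simp add: class_group_def)
qed

text \<open>\<open>t'\<close> is only known to lie in the group. Having the equality pattern of a
  full enumeration it has as many entries, hence is one too, and \<open>corr_enum\<close>
  applies.\<close>

lemma sim_of_enum:
  assumes C: "C \<in> levels" and len: "length t' = length t" and t: "set t = {C} \<times> rcosets C" "set t' \<subseteq> {C} \<times> rcosets C"
    and eq: "\<And>i j. i < length t \<Longrightarrow> j < length t \<Longrightarrow> t ! i = t ! j \<longleftrightarrow> t' ! i = t' ! j"
    and mult: "\<And>i j k. i < length t \<Longrightarrow> j < length t \<Longrightarrow> k < length t \<Longrightarrow>
      snd (t ! i) <#> snd (t ! j) = snd (t ! k) \<Longrightarrow> snd (t' ! i) <#> snd (t' ! j) = snd (t' ! k)"
  shows "sim (set (zip t t'))"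
proof -
  have fin: "finite ({C} \<times> rcosets C)" using level_finite[OF C] by simp
  have "card (set t) \<le> card (set t')" by (rule card_set_le_of_nth_eq[OF len]) (use eq in simp)
  then have t': "set t' = {C} \<times> rcosets C" using card_seteq[OF fin t(2)] t(1) by simp
  define R where "R = {(x, y). x \<in> carrier G \<and> y \<in> carrier G \<and> (\<exists>i < length t. t ! i = (C, C #> x) \<and> t' ! i = (C, C #> y))}"
  have R: "corr R" unfolding R_def by (rule corr_enum[OF C C len t(1) t' eq mult])
  have mem: "x \<in> snd \<gamma> \<longleftrightarrow> \<gamma> = (C, C #> x)" if \<gamma>: "\<gamma> \<in> {C} \<times> rcosets C" and x: "x \<in> carrier G" for x \<gamma>
  proof -
    have "\<gamma> \<in> elems" "fst \<gamma> = C" using \<gamma> C by (auto simp: elems_def)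
    then show ?thesis using elem_rcos(2)[of \<gamma> x] rcos_self[OF x level_subgroup[OF C]] by (auto simp: prod_eq_iff)
  qed
  show ?thesis
  proof (rule simI[OF _ R])
    show "set (zip t t') \<subseteq> elems \<times> elems"
    proof -
      have "{C} \<times> rcosets C \<subseteq> elems" using C by (auto simp: elems_def)
      then have "set t \<times> set t' \<subseteq> elems \<times> elems" using t by (intro Sigma_mono) auto
      then show ?thesis using set_zip_leftD set_zip_rightD by fastforce
    qed
    fix \<alpha> \<beta> assume "(\<alpha>, \<beta>) \<in> set (zip t t')"
    then obtain i where i: "i < length t" "\<alpha> = t ! i" "\<beta> = t' ! i" by (auto simp: in_set_zip)
    show "mv R \<alpha> \<beta>" unfolding mv_def
    proof (intro allI impI)
      fix x y assume "(x, y) \<in> R"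
      then obtain j where j: "j < length t" "t ! j = (C, C #> x)" "t' ! j = (C, C #> y)" "x \<in> carrier G" "y \<in> carrier G"
        by (auto simp: R_def)
      have "x \<in> snd \<alpha> \<longleftrightarrow> t ! i = t ! j" using mem[OF _ j(4), of "t ! i"] t(1) i j(2) nth_mem[OF i(1)] by simp
      moreover have "y \<in> snd \<beta> \<longleftrightarrow> t' ! i = t' ! j" using mem[OF _ j(5), of "t' ! i"] t' i j(3) nth_mem[of i t'] len by simp
      ultimately show "x \<in> snd \<alpha> \<longleftrightarrow> y \<in> snd \<beta>" using eq[OF i(1) j(1)] by simp
    qed
  qed
qed

lemma sim_nth_eq:
  assumes sim: "sim P" and z: "set (zip s s') \<subseteq> P" "set (zip t t') \<subseteq> P" and l: "length s = length s'" "length t = length t'" and "s = t"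
  shows "s' = t'"
proof (rule nth_equalityI)
  show "length s' = length t'" using l \<open>s = t\<close> by simp
  fix i assume i: "i < length s'"
  have 1: "(s ! i, s' ! i) \<in> P" "(t ! i, t' ! i) \<in> P" using z l i \<open>s = t\<close> by (auto simp: set_zip)
  show "s' ! i = t' ! i" using sim_eq[OF sim 1] \<open>s = t\<close> by simp
qed

lemma sim_mem:
  assumes sim: "sim P" and z: "set (zip s s') \<subseteq> P" "(\<beta>, \<beta>') \<in> P" and l: "length s = length s'" and "\<beta> \<in> set s"
  shows "\<beta>' \<in> set s'"
proof -
  obtain i where i: "i < length s" "\<beta> = s ! i" using \<open>\<beta> \<in> set s\<close> by (auto simp: in_set_conv_nth)
  have 1: "(s ! i, s' ! i) \<in> P" using z(1) l i by (auto simp: set_zip)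
  have "\<beta>' = s' ! i" using sim_eq[OF sim z(2) 1] i(2) by simp
  then show ?thesis using i l by simp
qed

end

context embedding_group
begin

definition invariant2 :: "nat list \<Rightarrow> nat list \<Rightarrow> (('a set \<times> 'a set) list \<Rightarrow> ('a set \<times> 'a set) list \<Rightarrow> bool) \<Rightarrow> bool" where
  "invariant2 ss ts Q \<longleftrightarrow> (\<forall>a \<in> tuples S ss. \<forall>b \<in> tuples S ts. \<forall>a' \<in> tuples S ss. \<forall>b' \<in> tuples S ts.
     Q a b \<longrightarrow> sim (set (zip a a') \<union> set (zip b b')) \<longrightarrow> Q a' b')"

lemma invariant2_flip:
  assumes "invariant2 ss ts Q" shows "invariant2 ts ss (\<lambda>b a. Q a b)"
  unfolding invariant2_def
proof (intro ballI impI)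
  fix b a b' a' assume *: "b \<in> tuples S ts" "a \<in> tuples S ss" "b' \<in> tuples S ts" "a' \<in> tuples S ss" "Q a b"
    "sim (set (zip b b') \<union> set (zip a a'))"
  show "Q a' b'"
    by (rule assms[unfolded invariant2_def, rule_format, OF *(2,1,4,3,5)]) (use *(6) in \<open>simp only: Un_commute\<close>)
qed

lemma invariant2_definable:
  "\<exists>\<Phi>. finite \<Phi> \<and> (\<forall>\<psi> \<in> \<Phi>. fv \<psi> \<subseteq> {..<length ss + length ts}) \<and>
     (\<forall>Q. invariant2 ss ts Q \<longrightarrow> (\<exists>\<psi> \<in> \<Phi>. \<forall>a \<in> tuples S ss. \<forall>b \<in> tuples S ts. sat S ((!) (a @ b)) \<psi> \<longleftrightarrow> Q a b))"
proof -
  let ?l = "length ss"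
  obtain \<Phi> where \<Phi>: "finite \<Phi>" "\<forall>\<psi> \<in> \<Phi>. fv \<psi> \<subseteq> {..<length (ss @ ts)}"
    "\<forall>Q. invariant (ss @ ts) Q \<longrightarrow> (\<exists>\<psi> \<in> \<Phi>. \<forall>a \<in> tuples S (ss @ ts). sat S ((!) a) \<psi> \<longleftrightarrow> Q a)"
    using invariant_definable[of "ss @ ts"] by blast
  have "\<exists>\<psi> \<in> \<Phi>. \<forall>a \<in> tuples S ss. \<forall>b \<in> tuples S ts. sat S ((!) (a @ b)) \<psi> \<longleftrightarrow> Q a b" if Q: "invariant2 ss ts Q" for Q
  proof -
    have "invariant (ss @ ts) (\<lambda>t. Q (take ?l t) (drop ?l t))"
      unfolding invariant_def ball_tuples_append
    proof (intro ballI impI)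
      fix a b a' b' assume a: "a \<in> tuples S ss" "a' \<in> tuples S ss" and b: "b \<in> tuples S ts" "b' \<in> tuples S ts"
        and Qab: "Q (take ?l (a @ b)) (drop ?l (a @ b))" and sim: "sim (set (zip (a @ b) (a' @ b')))"
      note l = a[THEN tuples_length]
      have "Q a b" "sim (set (zip a a') \<union> set (zip b b'))" using Qab sim l by simp_all
      then have "Q a' b'" using Q a b unfolding invariant2_def by blast
      then show "Q (take ?l (a' @ b')) (drop ?l (a' @ b'))" using l by simp
    qed
    then obtain \<psi> where \<psi>: "\<psi> \<in> \<Phi>" "\<forall>t \<in> tuples S (ss @ ts). sat S ((!) t) \<psi> \<longleftrightarrow> Q (take ?l t) (drop ?l t)"
      using \<Phi>(3) by blast
    have "sat S ((!) (a @ b)) \<psi> \<longleftrightarrow> Q a b" if "a \<in> tuples S ss" "b \<in> tuples S ts" for a b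
      using \<psi>(2)[unfolded ball_tuples_append] that tuples_length[OF that(1)] by simp
    then show ?thesis using \<psi>(1) by blast
  qed
  then show ?thesis using \<Phi>(1,2) by (intro exI[of _ \<Phi>]) simp
qed

lemma invariant2_definableE:
  assumes "invariant2 ss ts Q"
  obtains \<psi> where "fv \<psi> \<subseteq> {..<length ss + length ts}"
    "\<forall>a \<in> tuples S ss. \<forall>b \<in> tuples S ts. sat S ((!) (a @ b)) \<psi> \<longleftrightarrow> Q a b"
  using invariant2_definable[of ss ts] assms by blast

text \<open>Equality of classes is expressed by the formula \<open>eqf \<sigma>\<close>, and partial
  isomorphisms are elementary.\<close>

lemma invariant_map_cls:
  assumes \<sigma>: "wf_sort S \<sigma>"
  shows "invariant_map G T (arity \<sigma>) (cls S \<sigma>)"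
proof (intro invariant_map.intro embedding_group_axioms invariant_map_axioms.intro)
  fix P a b a' b'
  assume sim: "sim P" and T: "a \<in> tuples S (arity \<sigma>)" "b \<in> tuples S (arity \<sigma>)" "a' \<in> tuples S (arity \<sigma>)" "b' \<in> tuples S (arity \<sigma>)"
    and z: "set (zip a a') \<subseteq> P" "set (zip b b') \<subseteq> P" and eq: "cls S \<sigma> a = cls S \<sigma> b"
  note l = T[THEN tuples_length]
  have "sat S ((!) (a @ b)) (eqf \<sigma>) \<longleftrightarrow> sat S ((!) (a' @ b')) (eqf \<sigma>)"
    by (rule sat_sim_list[OF sim]) (use z l fv_eqf[OF \<sigma>] in \<open>auto simp: mult_2\<close>)
  then show "cls S \<sigma> a' = cls S \<sigma> b'" using sat_eqf[OF \<sigma>] T eq by simp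
qed

end

context invariant_map
begin

text \<open>The finite set \<open>\<Phi>\<close> is chosen before \<open>a0\<close> and
  \<open>c0\<close>, so the codes of all classes of the sort are covered by finitely many
  formulas.\<close>

lemma code_definable:
  "\<exists>\<Phi>. finite \<Phi> \<and> (\<forall>\<psi> \<in> \<Phi>. fv \<psi> \<subseteq> {..<length ss + B}) \<and>
    (\<forall>a0 c0. a0 \<in> tuples S ss \<longrightarrow> set c0 = {core a0} \<times> rcosets (core a0) \<longrightarrow>
      (\<exists>\<psi> \<in> \<Phi>. \<forall>a \<in> tuples S ss. \<forall>c \<in> tuples S (replicate B B). sat S ((!) (a @ c)) \<psi> \<longleftrightarrow> code a0 c0 a c))"
proof -
  have "invariant2 ss (replicate B B) (code a0 c0)"
    if a0: "a0 \<in> tuples S ss" and c0: "set c0 = {core a0} \<times> rcosets (core a0)" for a0 c0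
    unfolding invariant2_def
  proof (intro ballI impI)
    fix a c a' c' assume a: "a \<in> tuples S ss" "a' \<in> tuples S ss" and c: "c \<in> tuples S (replicate B B)" "c' \<in> tuples S (replicate B B)"
      and code: "code a0 c0 a c" and sim: "sim (set (zip a a') \<union> set (zip c c'))"
    show "code a0 c0 a' c'"
      by (rule code_invariant[OF a0 c0 sim a _ _ _ code]) (use c[THEN tuples_length] in auto)
  qed
  then show ?thesis using invariant2_definable[of ss "replicate B B"] by simp metis
qed

end

context embedding_group
begin

text \<open>\<open>core_bounded\<close> supplies one length \<open>B\<close> for the enumerations
  belonging to all classes of the sort. The tuple \<open>d\<close> required by \<open>codes\<close>
  is any enumeration of the quotient by the core, since every code has exactly these
  entries.\<close>

lemma complete_system_codes:
  assumes \<sigma>: "wf_sort S \<sigma>"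
  shows "\<exists>ts \<Phi>. finite \<Phi> \<and> (\<forall>\<psi> \<in> \<Phi>. fv \<psi> \<subseteq> {..<length (arity \<sigma>) + length ts}) \<and>
     (\<forall>a \<in> tuples S (arity \<sigma>). \<exists>\<psi> \<in> \<Phi>. codes S \<sigma> ts \<psi> \<and> (\<exists>c \<in> tuples S ts. sat S ((!) (a @ c)) \<psi>))"
proof -
  interpret invariant_map G T "arity \<sigma>" "cls S \<sigma>" by (rule invariant_map_cls[OF \<sigma>])
  let ?T = "tuples S (arity \<sigma>)"
  obtain B where B: "\<forall>a \<in> ?T. card (rcosets (core a)) \<le> B" using core_bounded by blast
  let ?r = "replicate B B"
  obtain \<Phi> where \<Phi>: "finite \<Phi>" "\<forall>\<psi> \<in> \<Phi>. fv \<psi> \<subseteq> {..<length (arity \<sigma>) + B}"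
    and def: "\<forall>a0 c0. a0 \<in> ?T \<longrightarrow> set c0 = {core a0} \<times> rcosets (core a0) \<longrightarrow>
      (\<exists>\<psi> \<in> \<Phi>. \<forall>a \<in> ?T. \<forall>c \<in> tuples S ?r. sat S ((!) (a @ c)) \<psi> \<longleftrightarrow> code a0 c0 a c)"
    using code_definable[of B] by blast
  have "\<exists>\<psi> \<in> \<Phi>. codes S \<sigma> ?r \<psi> \<and> (\<exists>c \<in> tuples S ?r. sat S ((!) (a0 @ c)) \<psi>)" if a0: "a0 \<in> ?T" for a0
  proof -
    obtain c0 where c0: "c0 \<in> tuples S ?r" "set c0 = {core a0} \<times> rcosets (core a0)"
      using enumeration_exists[OF core_level] B a0 by blast
    obtain \<psi> where \<psi>: "\<psi> \<in> \<Phi>" "\<forall>a \<in> ?T. \<forall>c \<in> tuples S ?r. sat S ((!) (a @ c)) \<psi> \<longleftrightarrow> code a0 c0 a c"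
      using def a0 c0(2) by blast
    have "codes S \<sigma> ?r \<psi>" unfolding codes_def
    proof (intro conjI ballI impI)
      fix a c a' assume *: "a \<in> ?T" "c \<in> tuples S ?r" "a' \<in> ?T" "sat S ((!) (a @ c)) \<psi>"
      then have "code a0 c0 a c" using \<psi>(2) by blast
      from code_iff[OF a0 c0(2) this] have "code a0 c0 a' c \<longleftrightarrow> cls S \<sigma> a = cls S \<sigma> a'" .
      then show "sat S ((!) (a' @ c)) \<psi> \<longleftrightarrow> sat S ((!) (a @ a')) (eqf \<sigma>)"
        using \<psi>(2) * sat_eqf[OF \<sigma> *(1,3)] by simp
    next
      fix a assume a: "a \<in> ?T"
      obtain d where d: "d \<in> tuples S ?r" "set d = {core a} \<times> rcosets (core a)"
        using enumeration_exists[OF core_level] B a by blast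
      have "set c \<subseteq> set d" if "c \<in> tuples S ?r" "sat S ((!) (a @ c)) \<psi>" for c
        using set_code[OF a0 c0(2), of a c] \<psi>(2) a that d(2) by simp
      then show "\<exists>d \<in> tuples S ?r. \<forall>c \<in> tuples S ?r. sat S ((!) (a @ c)) \<psi> \<longrightarrow> set c \<subseteq> set d" using d(1) by blast
    qed
    moreover have "sat S ((!) (a0 @ c0)) \<psi>" using \<psi>(2) a0 c0(1) code_self[OF a0 c0(2)] by simp
    ultimately show ?thesis using \<psi>(1) c0(1) by blast
  qed
  then show ?thesis using \<Phi> by (intro exI[of _ ?r] exI[of _ \<Phi>]) simp
qed

end

section \<open>The imaginaries of the group\<close>

definition group_atoms :: "nat \<Rightarrow> (unit, grp_const, grp_rel) fm set" where
  "group_atoms m = (\<lambda>(i, j). Eq (Var i) (Var j)) ` ({..<m} \<times> {..<m}) \<union>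
     (\<lambda>(i, j, k). Rel G_mult [Var i, Var j, Var k]) ` ({..<m} \<times> {..<m} \<times> {..<m})"

lemma finite_group_atoms: "finite (group_atoms m)"
  by (simp add: group_atoms_def)

lemma fv_group_atoms: "\<phi> \<in> group_atoms m \<Longrightarrow> fv \<phi> \<subseteq> {..<m}"
  by (auto simp: group_atoms_def)

lemma group_atoms_mem:
  assumes "i < m" "j < m"
  shows "Eq (Var i) (Var j) \<in> group_atoms m" "k < m \<Longrightarrow> Rel G_mult [Var i, Var j, Var k] \<in> group_atoms m"
  using assms by (force simp: group_atoms_def)+

context profinite_group
begin

abbreviation group_of :: "'a set \<times> 'a set \<Rightarrow> (unit, grp_const, grp_rel, 'a set \<times> 'a set) struct" where
  "group_of \<alpha> \<equiv> group_struct (class_group S \<alpha>)"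

lemma group_of_dom: "sort_dom (group_of \<alpha>) s = sim_class S \<alpha>"
  by (simp add: group_struct_def class_group_def)

lemma group_of_mult:
  assumes \<alpha>: "\<alpha> \<in> elems" and "\<beta> \<in> sim_class S \<alpha>" "\<gamma> \<in> sim_class S \<alpha>" "\<delta> \<in> sim_class S \<alpha>"
  shows "rel_int (group_of \<alpha>) G_mult [\<beta>, \<gamma>, \<delta>] \<longleftrightarrow> snd \<beta> <#> snd \<gamma> = snd \<delta>"
proof -
  have "rel_int (group_of \<alpha>) G_mult [\<beta>, \<gamma>, \<delta>] \<longleftrightarrow> \<delta> = \<beta> \<otimes>\<^bsub>class_group S \<alpha>\<^esub> \<gamma>"
    using assms by (auto simp: group_struct_def class_group_def)
  moreover have "fst \<delta> = fst \<alpha>" using assms(4) by (auto simp: sim_class_eq[OF \<alpha>])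
  ultimately show ?thesis using class_group_mult[OF assms(1-3)] by (auto simp: prod_eq_iff)
qed

text \<open>As \<open>t\<close> runs through the whole group, agreement on equalities and products
  makes the matching of \<open>t\<close> with \<open>t'\<close> a group automorphism, and every
  automorphism of a finite quotient comes from a correspondence.\<close>

lemma sim_of_group_atoms:
  assumes \<alpha>: "\<alpha> \<in> elems" and t: "set t = sim_class S \<alpha>" "set t' \<subseteq> sim_class S \<alpha>" "length t' = length t"
    and at: "\<forall>\<phi> \<in> group_atoms (length t). sat (group_of \<alpha>) ((!) t) \<phi> \<longleftrightarrow> sat (group_of \<alpha>) ((!) t') \<phi>"
  shows "sim (set (zip t t'))"
proof (rule sim_of_enum[OF elem_level[OF \<alpha>] t(3)])
  show "set t = {fst \<alpha>} \<times> rcosets (fst \<alpha>)" "set t' \<subseteq> {fst \<alpha>} \<times> rcosets (fst \<alpha>)"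
    using t sim_class_eq[OF \<alpha>] by simp_all
  have mem: "t ! i \<in> sim_class S \<alpha>" "t' ! i \<in> sim_class S \<alpha>" if "i < length t" for i
    using that t nth_mem[of i t] nth_mem[of i t'] by auto
  show "t ! i = t ! j \<longleftrightarrow> t' ! i = t' ! j" if "i < length t" "j < length t" for i j
    using bspec[OF at group_atoms_mem(1)[OF that]] by simp
  fix i j k assume i: "i < length t" "j < length t" "k < length t" and eq: "snd (t ! i) <#> snd (t ! j) = snd (t ! k)"
  have "rel_int (group_of \<alpha>) G_mult [t ! i, t ! j, t ! k] \<longleftrightarrow> rel_int (group_of \<alpha>) G_mult [t' ! i, t' ! j, t' ! k]"
    using bspec[OF at group_atoms_mem(2)[OF i]] by simp
  then show "snd (t' ! i) <#> snd (t' ! j) = snd (t' ! k)"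
    using group_of_mult[OF \<alpha> mem(1) mem(1) mem(1), OF i] group_of_mult[OF \<alpha> mem(2) mem(2) mem(2), OF i] eq by simp
qed

end

context invariant_map
begin

context
  fixes a0 c0 B
  assumes a0: "a0 \<in> tuples S ss" and c0: "c0 \<in> tuples S (replicate B B)" "set c0 = {core a0} \<times> rcosets (core a0)"
begin

section \<open>Two equivalence relations whose classes are sets of codes\<close>

lemma code_tuples:
  assumes "code a0 c0 a c" shows "c \<in> tuples S (replicate B B)"
proof -
  obtain a1 where a1: "length c = length c0" "sim (set (zip a1 a0) \<union> set (zip c c0))"
    using assms unfolding code_def by blast
  show ?thesis
    by (rule sim_tuples[OF sim_converse[OF a1(2)] _ _ c0(1)])
      (use a1(1) in \<open>simp_all add: set_zip_converse[of c c0, symmetric] converse_Un\<close>)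
qed

lemma c0_nonempty: "c0 \<noteq> []"
proof -
  have "(core a0, core a0) \<in> set c0" unfolding c0(2) using rcosets_nonempty[OF level_subgroup[OF core_level]] by simp
  then show ?thesis by auto
qed

text \<open>The tail is a code and the head an arbitrary element of the group it enumerates. The
  free head produces the shape required by \<open>is_class_pair\<close>.\<close>

definition pair_rel :: "('a set \<times> 'a set) list \<Rightarrow> ('a set \<times> 'a set) list \<Rightarrow> bool" where
  "pair_rel a t \<longleftrightarrow> code a0 c0 a (tl t) \<and> hd t \<in> set (tl t)"

text \<open>The disjunct \<open>t = t'\<close> puts tuples that do not come from a code into
  singleton classes, so the relation is an equivalence on all tuples of these sorts.\<close>

definition pair_eq :: "('a set \<times> 'a set) list \<Rightarrow> ('a set \<times> 'a set) list \<Rightarrow> bool" where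
  "pair_eq t t' \<longleftrightarrow> t = t' \<or> (\<exists>a \<in> tuples S ss. pair_rel a t \<and> pair_rel a t')"

text \<open>Conjugacy of enumerations over a class, again completed by equality. It is later
  restricted to tuples of the single group of \<open>hd c0\<close>.\<close>

definition group_eq :: "('a set \<times> 'a set) list \<Rightarrow> ('a set \<times> 'a set) list \<Rightarrow> bool" where
  "group_eq b b' \<longleftrightarrow> b = b' \<or> (\<exists>a \<in> tuples S ss. code a0 c0 a b \<and> code a0 c0 a b')"

abbreviation "pair_sorts \<equiv> B # replicate B B"

lemma pair_rel_cong: "\<kappa> a = \<kappa> a' \<Longrightarrow> pair_rel a t \<longleftrightarrow> pair_rel a' t"
  unfolding pair_rel_def using code_cong by blast

lemma pair_rel_eqD: "pair_rel a t \<Longrightarrow> pair_rel a' t \<Longrightarrow> \<kappa> a = \<kappa> a'"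
  unfolding pair_rel_def using code_eqD[OF a0 c0(2)] by blast

lemma pair_rel_self: "pair_rel a0 (hd c0 # c0)"
proof -
  show ?thesis using hd_in_set[OF c0_nonempty] code_self[OF a0 c0(2)] by (simp add: pair_rel_def)
qed

lemma pair_rel_invariant:
  assumes sim: "sim P" and a: "a \<in> tuples S ss" "a' \<in> tuples S ss" "set (zip a a') \<subseteq> P"
    and t: "t \<in> tuples S pair_sorts" "t' \<in> tuples S pair_sorts" "set (zip t t') \<subseteq> P" and rel: "pair_rel a t"
  shows "pair_rel a' t'"
proof -
  obtain \<beta> b where b: "t = \<beta> # b" "b \<in> tuples S (replicate B B)" using t(1) by (auto simp: tuples_Cons)
  obtain \<beta>' b' where b': "t' = \<beta>' # b'" "b' \<in> tuples S (replicate B B)" using t(2) by (auto simp: tuples_Cons)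
  have l: "length b = length b'" using tuples_length[OF b(2)] tuples_length[OF b'(2)] by simp
  have z: "set (zip b b') \<subseteq> P" "(\<beta>, \<beta>') \<in> P" using t(3) b(1) b'(1) by auto
  have r: "code a0 c0 a b" "\<beta> \<in> set b" using rel b(1) by (simp_all add: pair_rel_def)
  have "code a0 c0 a' b'" by (rule code_invariant[OF a0 c0(2) sim a l z(1) r(1)])
  then show ?thesis using sim_mem[OF sim z l r(2)] b'(1) by (simp add: pair_rel_def)
qed

lemma pair_eq_invariant: "invariant2 pair_sorts pair_sorts pair_eq"
  unfolding invariant2_def
proof (intro ballI impI)
  fix t u t' u' assume T: "t \<in> tuples S pair_sorts" "u \<in> tuples S pair_sorts" "t' \<in> tuples S pair_sorts" "u' \<in> tuples S pair_sorts"
    and eq: "pair_eq t u" and sim: "sim (set (zip t t') \<union> set (zip u u'))" (is "sim ?P")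
  note l = T[THEN tuples_length]
  show "pair_eq t' u'"
  proof (cases "t = u")
    case True
    have "t' = u'" by (rule sim_nth_eq[OF sim _ _ _ _ True]) (use l in auto)
    then show ?thesis by (simp add: pair_eq_def)
  next
    case False
    then obtain a where a: "a \<in> tuples S ss" "pair_rel a t" "pair_rel a u" using eq unfolding pair_eq_def by blast
    obtain a' where ha: "a' \<in> tuples S ss" and h: "sim (?P \<union> set (zip a a'))" (is "sim ?Q")
      by (rule sim_extend_tuple[OF sim a(1)])
    have z: "set (zip a a') \<subseteq> ?Q" "set (zip t t') \<subseteq> ?Q" "set (zip u u') \<subseteq> ?Q" by auto
    have "pair_rel a' t'" by (rule pair_rel_invariant[OF h a(1) ha z(1) T(1,3) z(2) a(2)])
    moreover have "pair_rel a' u'" by (rule pair_rel_invariant[OF h a(1) ha z(1) T(2,4) z(3) a(3)])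
    ultimately show ?thesis using ha unfolding pair_eq_def by blast
  qed
qed

lemma pair_eq_self_iff: "pair_eq (hd c0 # c0) t \<longleftrightarrow> pair_rel a0 t"
proof
  assume "pair_eq (hd c0 # c0) t"
  then show "pair_rel a0 t"
    unfolding pair_eq_def using pair_rel_self pair_rel_eqD pair_rel_cong by metis
qed (use pair_rel_self a0 in \<open>auto simp: pair_eq_def\<close>)

lemma pair_eq_sym: "pair_eq t u \<Longrightarrow> pair_eq u t"
  unfolding pair_eq_def by blast

lemma pair_eq_trans: "pair_eq t u \<Longrightarrow> pair_eq u v \<Longrightarrow> pair_eq t v"
  unfolding pair_eq_def using pair_rel_eqD pair_rel_cong by metis

lemma group_eq_sym: "group_eq b b' \<Longrightarrow> group_eq b' b"
  unfolding group_eq_def by blast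

lemma group_eq_trans: "group_eq b b' \<Longrightarrow> group_eq b' b'' \<Longrightarrow> group_eq b b''"
  unfolding group_eq_def using code_eqD[OF a0 c0(2)] code_cong by metis

lemma group_eq_self_iff: "group_eq c0 b \<longleftrightarrow> code a0 c0 a0 b"
  unfolding group_eq_def using code_eqD[OF a0 c0(2)] code_cong code_self[OF a0 c0(2)] a0 by metis

lemma hd_elem: "hd c0 \<in> elems" "fst (hd c0) = core a0"
proof -
  have "hd c0 \<in> {core a0} \<times> rcosets (core a0)" using c0(2) hd_in_set[OF c0_nonempty] by simp
  then show "hd c0 \<in> elems" "fst (hd c0) = core a0" using core_level by (auto simp: elems_def)
qed

lemma hd_class: "sim_class S (hd c0) = set c0"
  using sim_class_eq[OF hd_elem(1)] hd_elem(2) c0(2) by simp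

lemma pair_rel_class: "{t. pair_rel a0 t} \<inter> tuples S pair_sorts = {\<beta> # b |\<beta> b. \<beta> \<in> sim_class S (hd c0) \<and> code a0 c0 a0 b}"
proof -
  have set: "set b = set c0" if "code a0 c0 a0 b" for b using set_code[OF a0 c0(2) that] c0(2) by simp
  have "t \<in> {t. pair_rel a0 t} \<inter> tuples S pair_sorts \<longleftrightarrow> (\<exists>\<beta> b. t = \<beta> # b \<and> \<beta> \<in> set c0 \<and> code a0 c0 a0 b)" for t
  proof
    assume "t \<in> {t. pair_rel a0 t} \<inter> tuples S pair_sorts"
    then obtain \<beta> b where "t = \<beta> # b" "pair_rel a0 (\<beta> # b)" by (auto simp: tuples_Cons)
    then show "\<exists>\<beta> b. t = \<beta> # b \<and> \<beta> \<in> set c0 \<and> code a0 c0 a0 b" using set by (auto simp: pair_rel_def)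
  next
    assume "\<exists>\<beta> b. t = \<beta> # b \<and> \<beta> \<in> set c0 \<and> code a0 c0 a0 b"
    then obtain \<beta> b where t: "t = \<beta> # b" "\<beta> \<in> set c0" "code a0 c0 a0 b" by blast
    then have "pair_rel a0 t" using set[OF t(3)] by (simp add: pair_rel_def)
    moreover have "\<beta> \<in> sort_dom S B" using t(2) c0(1) by (auto simp: tuples_replicate)
    ultimately show "t \<in> {t. pair_rel a0 t} \<inter> tuples S pair_sorts"
      using t(1) code_tuples[OF t(3)] by (auto simp: tuples_Cons)
  qed
  then show ?thesis unfolding hd_class by blast
qed

text \<open>The relation is defined through all of \<open>S\<close>, yet must be expressed in the
  bare group. An enumeration fixes every group element, so tuples with the same group atoms differ
  by a group automorphism; this is a partial isomorphism of \<open>S\<close> and hence preserves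
  \<open>group_eq\<close>.\<close>

lemma group_eq_definable:
  "\<exists>\<psi>. fv \<psi> \<subseteq> {..<2 * B} \<and> (\<forall>b \<in> tuples (group_of (hd c0)) (replicate B ()). \<forall>b' \<in> tuples (group_of (hd c0)) (replicate B ()).
     sat (group_of (hd c0)) ((!) (b @ b')) \<psi> \<longleftrightarrow> group_eq b b')"
proof -
  let ?M = "group_of (hd c0)" and ?r = "replicate B ()"
  have T: "b \<in> tuples ?M ?r \<longleftrightarrow> length b = B \<and> set b \<subseteq> set c0" for b
    unfolding tuples_replicate group_of_dom hd_class ..
  define Q where "Q v \<longleftrightarrow> (\<exists>b \<in> tuples ?M ?r. \<exists>b' \<in> tuples ?M ?r. v = (!) (b @ b') \<and> group_eq b b')" for v
  have inj: "b = d \<and> b' = d'" if "(!) (b @ b') = (!) (d @ d')" "b \<in> tuples ?M ?r" "b' \<in> tuples ?M ?r" "d \<in> tuples ?M ?r" "d' \<in> tuples ?M ?r"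
    for b b' d d'
  proof -
    note l = that(2-)[THEN tuples_length]
    have "b @ b' = d @ d'" by (rule nth_equalityI) (use l that(1) in simp_all)
    then show ?thesis using l by simp
  qed
  have step: "group_eq d d'"
    if b: "b \<in> tuples ?M ?r" "b' \<in> tuples ?M ?r" and d: "d \<in> tuples ?M ?r" "d' \<in> tuples ?M ?r" and eq: "group_eq b b'"
      and at: "\<forall>\<phi> \<in> group_atoms (2 * B). sat ?M ((!) (b @ b')) \<phi> \<longleftrightarrow> sat ?M ((!) (d @ d')) \<phi>" for b b' d d'
  proof (cases "b = b'")
    case True
    have l: "length b = B" "length b' = B" "length d = B" "length d' = B" using b d T by auto
    have "d = d'"
    proof (rule nth_equalityI)
      fix i assume i: "i < length d"
      have "Eq (Var i) (Var (B + i)) \<in> group_atoms (2 * B)" by (rule group_atoms_mem) (use i l in auto)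
      from bspec[OF at this] have "b ! i = b' ! i \<longleftrightarrow> d ! i = d' ! i" using i l by (simp add: nth_append)
      then show "d ! i = d' ! i" using True by simp
    qed (use l in simp)
    then show ?thesis by (simp add: group_eq_def)
  next
    case False
    then obtain a where a: "a \<in> tuples S ss" "code a0 c0 a b" "code a0 c0 a b'" using eq unfolding group_eq_def by blast
    have l: "length b = B" "length b' = B" "length d = B" "length d' = B" using b d T by auto
    \<comment> \<open>\<open>b\<close> enumerates the quotient by \<open>core a\<close>, while its
      entries lie in the quotient by \<open>core a0\<close>. As an element of \<open>S\<close>
      carries its subgroup along, the two cores coincide.\<close>
    have "set b \<subseteq> set c0" using b T by simp
    moreover have "set b = {core a} \<times> rcosets (core a)" using set_code[OF a0 c0(2) a(2)] .
    moreover have "core a \<in> rcosets (core a)" using rcosets_nonempty[OF level_subgroup[OF core_level]] .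
    ultimately have "core a = core a0" using c0(2) by auto
    then have "set b = set c0" using \<open>set b = {core a} \<times> rcosets (core a)\<close> c0(2) by simp
    then have 1: "set (b @ b') = sim_class S (hd c0)" "set (d @ d') \<subseteq> sim_class S (hd c0)" "length (d @ d') = length (b @ b')"
      using b d T l hd_class by auto
    have "sim (set (zip (b @ b') (d @ d')))"
      by (rule sim_of_group_atoms[OF hd_elem(1) 1]) (use at l in \<open>simp add: mult_2\<close>)
    then have sim: "sim (set (zip b d) \<union> set (zip b' d'))" (is "sim ?P") using l by simp
    obtain a' where ha: "a' \<in> tuples S ss" and h: "sim (?P \<union> set (zip a a'))" (is "sim ?Q")
      by (rule sim_extend_tuple[OF sim a(1)])
    have z: "set (zip a a') \<subseteq> ?Q" "set (zip b d) \<subseteq> ?Q" "set (zip b' d') \<subseteq> ?Q" by auto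
    have "code a0 c0 a' d" by (rule code_invariant[OF a0 c0(2) h a(1) ha z(1) _ z(2) a(2)]) (use l in simp)
    moreover have "code a0 c0 a' d'" by (rule code_invariant[OF a0 c0(2) h a(1) ha z(1) _ z(3) a(3)]) (use l in simp)
    ultimately show ?thesis using ha unfolding group_eq_def by blast
  qed
  define D where "D = {(!) (b @ b') |b b'. b \<in> tuples ?M ?r \<and> b' \<in> tuples ?M ?r}"
  have "\<forall>v \<in> D. \<forall>v' \<in> D. Q v \<longrightarrow> (\<forall>\<phi> \<in> group_atoms (2 * B). sat ?M v \<phi> \<longleftrightarrow> sat ?M v' \<phi>) \<longrightarrow> Q v'"
  proof (intro ballI impI)
    fix v v' assume "v \<in> D" "v' \<in> D" "Q v" and at: "\<forall>\<phi> \<in> group_atoms (2 * B). sat ?M v \<phi> \<longleftrightarrow> sat ?M v' \<phi>"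
    obtain b b' where b: "b \<in> tuples ?M ?r" "b' \<in> tuples ?M ?r" "v = (!) (b @ b')" "group_eq b b'"
      using \<open>Q v\<close> unfolding Q_def by blast
    obtain d d' where d: "d \<in> tuples ?M ?r" "d' \<in> tuples ?M ?r" "v' = (!) (d @ d')" using \<open>v' \<in> D\<close> unfolding D_def by blast
    show "Q v'" using step[OF b(1,2) d(1,2) b(4)] at b(3) d unfolding Q_def by blast
  qed
  note step' = this
  have "\<exists>\<Phi>. finite \<Phi> \<and> (\<forall>\<psi> \<in> \<Phi>. fv \<psi> \<subseteq> {..<2 * B}) \<and> (\<forall>D Q. (\<forall>v \<in> D. \<forall>v' \<in> D. Q v \<longrightarrow>
      (\<forall>\<phi> \<in> group_atoms (2 * B). sat ?M v \<phi> \<longleftrightarrow> sat ?M v' \<phi>) \<longrightarrow> Q v') \<longrightarrow> (\<exists>\<psi> \<in> \<Phi>. \<forall>v \<in> D. sat ?M v \<psi> \<longleftrightarrow> Q v))"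
    by (rule boolean_combinations[OF finite_group_atoms fv_group_atoms])
  then obtain \<Phi> where \<Phi>: "\<forall>\<psi> \<in> \<Phi>. fv \<psi> \<subseteq> {..<2 * B}" "\<forall>D Q. (\<forall>v \<in> D. \<forall>v' \<in> D. Q v \<longrightarrow>
      (\<forall>\<phi> \<in> group_atoms (2 * B). sat ?M v \<phi> \<longleftrightarrow> sat ?M v' \<phi>) \<longrightarrow> Q v') \<longrightarrow> (\<exists>\<psi> \<in> \<Phi>. \<forall>v \<in> D. sat ?M v \<psi> \<longleftrightarrow> Q v)"
    by (elim exE conjE) (rule that)
  have "\<exists>\<psi> \<in> \<Phi>. \<forall>v \<in> D. sat ?M v \<psi> \<longleftrightarrow> Q v" by (rule \<Phi>(2)[THEN spec, THEN spec, THEN mp, OF step'])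
  then obtain \<psi> where \<psi>: "\<psi> \<in> \<Phi>" "\<forall>v \<in> D. sat ?M v \<psi> \<longleftrightarrow> Q v" by (elim bexE) (rule that)
  have "sat ?M ((!) (b @ b')) \<psi> \<longleftrightarrow> group_eq b b'" if b: "b \<in> tuples ?M ?r" "b' \<in> tuples ?M ?r" for b b'
  proof -
    have "Q ((!) (b @ b')) \<longleftrightarrow> group_eq b b'" unfolding Q_def using inj[OF _ b] b by metis
    moreover have "(!) (b @ b') \<in> D" using b unfolding D_def by blast
    ultimately show ?thesis using \<psi>(2) by simp
  qed
  then show ?thesis using \<Phi>(1) \<psi>(1) by blast
qed

end

end

context embedding_group
begin

text \<open>Passing from one enumeration to the set of all codes of the class replaces a choice by
  something that \<open>e\<close> determines, while each member of that set determines
  \<open>e\<close>.\<close>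

lemma imaginary_equidefinable:
  assumes e: "e \<in> imaginaries S"
  shows "\<exists>\<alpha> \<in> universe S. \<exists>\<epsilon> \<in> imaginaries (group_of \<alpha>). \<exists>p. is_class_pair S \<alpha> \<epsilon> p \<and> equidefinable S e p"
proof -
  obtain \<sigma> where \<sigma>: "e \<in> eq_dom S \<sigma>" using e unfolding imaginaries_eq by blast
  then have wf: "wf_sort S \<sigma>" by (simp add: eq_dom_cls)
  obtain a0 where a0: "a0 \<in> tuples S (arity \<sigma>)" "e = cls S \<sigma> a0" using \<sigma> by (auto simp: eq_dom_cls)
  interpret invariant_map G T "arity \<sigma>" "cls S \<sigma>" by (rule invariant_map_cls[OF wf])
  \<comment> \<open>Only one class is considered, so the index of its own core takes the place of
    the uniform bound.\<close>
  define B where "B = card (rcosets (core a0))"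
  have "card (rcosets (core a0)) \<le> B" by (simp add: B_def)
  then obtain c0 where c0: "c0 \<in> tuples S (replicate B B)" "set c0 = {core a0} \<times> rcosets (core a0)"
    by (rule enumeration_exists[OF core_level])
  note ctx = a0(1) c0
  let ?eq = "pair_eq a0 c0" and ?rel = "pair_rel a0 c0" and ?ps = "B # replicate B B" and ?\<alpha> = "hd c0"
  let ?t0 = "?\<alpha> # c0" and ?T = "tuples S (B # replicate B B)"
  have \<alpha>: "?\<alpha> \<in> elems" using hd_elem(1)[OF ctx] .
  have "?\<alpha> \<in> sort_dom S B" using c0(1) hd_in_set[OF c0_nonempty[OF ctx]] by (auto simp: tuples_replicate)
  then have t0: "?t0 \<in> ?T" using c0(1) by (simp add: tuples_Cons)
  obtain \<phi> where \<phi>: "fv \<phi> \<subseteq> {..<length ?ps + length ?ps}" "\<forall>t \<in> ?T. \<forall>u \<in> ?T. sat S ((!) (t @ u)) \<phi> \<longleftrightarrow> ?eq t u"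
    using invariant2_definableE[OF pair_eq_invariant[OF ctx]] by blast
  have fm: "fm_rel S ?ps \<phi> = {(t, u). t \<in> ?T \<and> u \<in> ?T \<and> ?eq t u}"
    using \<phi>(2) by (auto simp: fm_rel_def)
  have "equiv ?T (fm_rel S ?ps \<phi>)"
    unfolding fm equiv_Collect_iff
    using pair_eq_sym[OF ctx] pair_eq_trans[OF ctx] pair_eq_def[OF ctx] by blast
  then have def: "defines_equiv S ?ps \<phi>" using \<phi>(1) by (simp add: defines_equiv_def mult_2)
  define \<tau> where "\<tau> = Quot ?ps \<phi>"
  have wf\<tau>: "wf_sort S \<tau>" and ar: "arity \<tau> = ?ps" using def by (simp_all add: \<tau>_def)
  define p where "p = cls S \<tau> ?t0"
  have p: "p \<in> eq_dom S \<tau>" using wf\<tau> t0 ar by (auto simp: eq_dom_cls p_def)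
  have cls_p: "cls S \<tau> t = p \<longleftrightarrow> ?rel a0 t" if "t \<in> ?T" for t
  proof -
    have "cls S \<tau> ?t0 = cls S \<tau> t \<longleftrightarrow> sat S ((!) (?t0 @ t)) \<phi>"
      using sat_eqf[OF wf\<tau>, of ?t0 t] t0 that by (simp add: ar) (simp add: \<tau>_def)
    then show ?thesis using \<phi>(2) t0 that pair_eq_self_iff[OF ctx, of t] by (auto simp: p_def)
  qed
  obtain \<psi> where \<psi>: "fv \<psi> \<subseteq> {..<2 * B}" "\<forall>b \<in> tuples (group_of ?\<alpha>) (replicate B ()). \<forall>b' \<in> tuples (group_of ?\<alpha>) (replicate B ()).
     sat (group_of ?\<alpha>) ((!) (b @ b')) \<psi> \<longleftrightarrow> group_eq a0 c0 b b'"
    using group_eq_definable[OF ctx] by blast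
  let ?g = "replicate B ()" and ?M = "group_of ?\<alpha>"
  have gT: "b \<in> tuples ?M ?g \<longleftrightarrow> length b = B \<and> set b \<subseteq> set c0" for b
    unfolding tuples_replicate group_of_dom hd_class[OF ctx] ..
  have gfm: "fm_rel ?M ?g \<psi> = {(b, b'). b \<in> tuples ?M ?g \<and> b' \<in> tuples ?M ?g \<and> group_eq a0 c0 b b'}"
    using \<psi>(2) by (auto simp: fm_rel_def)
  have "equiv (tuples ?M ?g) (fm_rel ?M ?g \<psi>)"
    unfolding gfm equiv_Collect_iff
    using group_eq_sym[OF ctx] group_eq_trans[OF ctx] group_eq_def[OF ctx] by blast
  then have gdef: "defines_equiv ?M ?g \<psi>" using \<psi>(1) by (simp add: defines_equiv_def)
  \<comment> \<open>All codes of the class of \<open>a0\<close> have their entries in the group of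
    \<open>hd c0\<close>, so the class of \<open>c0\<close> contains every one of them.\<close>
  define \<epsilon> where "\<epsilon> = Imag ?g \<psi> (fm_rel ?M ?g \<psi> `` {c0})"
  have c0g: "c0 \<in> tuples ?M ?g" using gT tuples_length[OF c0(1)] by simp
  have "\<epsilon> \<in> eq_dom ?M (Quot ?g \<psi>)" using gdef c0g by (auto simp: \<epsilon>_def quotient_def)
  then have \<epsilon>: "\<epsilon> \<in> imaginaries ?M" unfolding imaginaries_eq by blast
  have "imag_tuples \<epsilon> = {b. code a0 c0 a0 b}"
  proof -
    have "b \<in> tuples ?M ?g" if "code a0 c0 a0 b" for b
      using set_code[OF a0(1) c0(2) that] c0(2) tuples_length[OF code_tuples[OF ctx that]] gT by simp
    then show ?thesis using c0g group_eq_self_iff[OF ctx] by (auto simp: \<epsilon>_def gfm)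
  qed
  moreover have "fm_rel S ?ps \<phi> `` {?t0} = {t. ?rel a0 t} \<inter> ?T"
    unfolding fm using t0 pair_eq_self_iff[OF ctx] by auto
  ultimately have "p = Imag ?ps \<phi> {\<beta> # b |\<beta> b. \<beta> \<in> sim_class S ?\<alpha> \<and> b \<in> imag_tuples \<epsilon>}"
    using pair_rel_class[OF ctx] by (simp add: p_def \<tau>_def)
  moreover have "p \<in> imaginaries S" using p unfolding imaginaries_eq by blast
  ultimately have pair: "is_class_pair S ?\<alpha> \<epsilon> p" unfolding is_class_pair_def by blast
  have inv1: "invariant2 (arity \<sigma>) ?ps ?rel"
    unfolding invariant2_def
  proof (intro ballI impI)
    fix a t a' t' assume *: "a \<in> tuples S (arity \<sigma>)" "t \<in> ?T" "a' \<in> tuples S (arity \<sigma>)" "t' \<in> ?T" "?rel a t"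
      "sim (set (zip a a') \<union> set (zip t t'))"
    show "?rel a' t'" by (rule pair_rel_invariant[OF ctx *(6,1,3) _ *(2,4) _ *(5)]) auto
  qed
  obtain \<psi>1 where \<psi>1: "fv \<psi>1 \<subseteq> {..<length (arity \<sigma>) + length ?ps}"
    "\<forall>a \<in> tuples S (arity \<sigma>). \<forall>t \<in> ?T. sat S ((!) (a @ t)) \<psi>1 \<longleftrightarrow> ?rel a t"
    using invariant2_definableE[OF inv1] by blast
  obtain \<psi>2 where \<psi>2: "fv \<psi>2 \<subseteq> {..<length ?ps + length (arity \<sigma>)}"
    "\<forall>t \<in> ?T. \<forall>a \<in> tuples S (arity \<sigma>). sat S ((!) (t @ a)) \<psi>2 \<longleftrightarrow> ?rel a t"
    using invariant2_definableE[OF invariant2_flip[OF inv1]] by blast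
  have rel0: "?rel a0 ?t0" using pair_rel_self[OF ctx] .
  \<comment> \<open>Both directions use the same invariant relation: a tuple related to
    \<open>a\<close> determines the class of \<open>a\<close>, and the tuples related to
    \<open>a0\<close> form exactly the class \<open>p\<close>.\<close>
  have "e \<in> dcl_eq S {p}"
  proof (rule dcl_eq_imagI[OF \<sigma> p])
    show "fv \<psi>2 \<subseteq> {..<length (arity \<tau>) + length (arity \<sigma>)}" using \<psi>2(1) ar by simp
    show "a0 \<in> tuples S (arity \<sigma>)" "?t0 \<in> tuples S (arity \<tau>)" "cls S \<sigma> a0 = e" "cls S \<tau> ?t0 = p" "sat S ((!) (?t0 @ a0)) \<psi>2"
      using a0 t0 ar \<psi>2(2) rel0 unfolding p_def by auto
    fix a t assume *: "a \<in> tuples S (arity \<sigma>)" "t \<in> tuples S (arity \<tau>)" "cls S \<tau> t = p" "sat S ((!) (t @ a)) \<psi>2"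
    then have "?rel a t" "?rel a0 t" using \<psi>2(2) cls_p ar by auto
    then show "cls S \<sigma> a = e" using pair_rel_eqD[OF ctx] a0(2) by metis
  qed
  moreover have "p \<in> dcl_eq S {e}"
  proof (rule dcl_eq_imagI[OF p \<sigma>])
    show "fv \<psi>1 \<subseteq> {..<length (arity \<sigma>) + length (arity \<tau>)}" using \<psi>1(1) ar by simp
    show "?t0 \<in> tuples S (arity \<tau>)" "a0 \<in> tuples S (arity \<sigma>)" "cls S \<tau> ?t0 = p" "cls S \<sigma> a0 = e" "sat S ((!) (a0 @ ?t0)) \<psi>1"
      using a0 t0 ar \<psi>1(2) rel0 unfolding p_def by auto
    fix t a assume *: "t \<in> tuples S (arity \<tau>)" "a \<in> tuples S (arity \<sigma>)" "cls S \<sigma> a = e" "sat S ((!) (a @ t)) \<psi>1"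
    then have "?rel a t" using \<psi>1(2) ar by auto
    then have "?rel a0 t" using pair_rel_cong[OF ctx, of a a0 t] *(3) a0(2) by simp
    then show "cls S \<tau> t = p" using cls_p *(1) ar by simp
  qed
  ultimately have "equidefinable S e p" by (simp add: equidefinable_def)
  then show ?thesis using pair \<epsilon> \<alpha> by (auto simp: universe_eq)
qed

end

theorem theorem4p6:
  fixes G :: "('a, 'm) monoid_scheme" and T :: "'a topology"
  assumes "profinite_group G T"
    and "embedding_property G T"
  shows "weakly_eliminates_imaginaries TYPE('u) (Th (complete_system G T)) \<and>
    (\<forall>e\<in>imaginaries (complete_system G T).
       \<exists>\<alpha>\<in>universe (complete_system G T).
       \<exists>\<epsilon>\<in>imaginaries (group_struct (class_group (complete_system G T) \<alpha>)).
       \<exists>p. is_class_pair (complete_system G T) \<alpha> \<epsilon> p \<and>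
           equidefinable (complete_system G T) e p)"
proof -
  interpret embedding_group G T
    using assms by (simp add: embedding_group_def embedding_group_axioms_def)
  show ?thesis
    using weak_elimination_transfer[OF complete_system_codes] imaginary_equidefinable by blast
qed

end
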